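(* Let $\bm\sigma=\sigma_1\bm e_1+\dots+\sigma_r\bm e_r$ be a very slack changemaker vector with $\sigma_r>1$ and $\bm\sigma\cdot\bm\sigma=n$, and let $L_n=\langle\bm\sigma\rangle^\perp\subseteq\mathbb{Z}^r$. Suppose $L_n$ admits an obtuse superbase $B$. Let $L_{n-\frac12}$ be the $(n-\frac12)$-changemaker lattice and $L_{n-1}$ the $(n-1)$-changemaker lattice with the same stable coefficients as $L_n$. Then (1) $L_{n-\frac12}$ admits an obtuse superbase, which can be taken planar if $B$ is planar; and (2) $L_{n-1}$ is decomposable.
   Context: Lattices are integral: free abelian groups with symmetric positive definite integral bilinear form; $\mathbb{Z}^k$ has the standard pairing. A changemaker vector is $\bm\sigma=\sum_{i=1}^r\sigma_i\bm e_i$ in some orthonormal basis with $\sigma_1=1$, $\sigma_{i-1}\le\sigma_i\le 1+\sigma_1+\dots+\sigma_{i-1}$; its stable coefficients are the $\sigma_i\ge2$. It is very slack if $\sigma_k\le\sigma_1+\dots+\sigma_{k-1}-1$ for every $k$ with $\sigma_k>1$. For an integer $n\ge1$, an $n$-changemaker lattice is $\langle\bm\sigma\rangle^\perp\subseteq\mathbb{Z}^r$ for a changemaker $\bm\sigma$ with $\bm\sigma\cdot\bm\sigma=n$. An $(n-\frac12)$-changemaker lattice is $\langle \bm e_{-1}-\bm e_0,\ \bm e_0+\bm\tau\rangle^\perp\subseteq\mathbb{Z}^{s+2}=\langle\bm e_{-1},\bm e_0,\bm e_1,\dots,\bm e_s\rangle$ where $\bm\tau=\sum_{i=1}^s\tau_i\bm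 e_i$ is a changemaker vector with $\bm\tau\cdot\bm\tau=n-1$; its stable coefficients are those of $\bm\tau$. An obtuse superbase of a rank-$k$ lattice $L$ is a spanning set $\{v_0,\dots,v_k\}$ with $v_i\cdot v_j\le0$ for $i\ne j$ and $\sum v_i=0$; its graph $G_B$ has vertex set $B$ and $|v_i\cdot v_j|$ edges between $v_i\ne v_j$; $B$ is planar if $G_B$ is planar. A lattice is decomposable if it is an orthogonal direct sum of two non-zero sublattices. *)

theory Defs
  imports "HOL-Analysis.Analysis" "HOL-Library.Function_Algebras" "HOL-Library.Multiset"
begin

definition zvec :: "nat \<Rightarrow> (nat \<Rightarrow> int) set" where
  "zvec N = {x. \<forall>i\<ge>N. x i = 0}"

definition dot :: "nat \<Rightarrow> (nat \<Rightarrow> int) \<Rightarrow> (nat \<Rightarrow> int) \<Rightarrow> int" where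
  "dot N x y = (\<Sum>i<N. x i * y i)"

definition zsmult :: "int \<Rightarrow> (nat \<Rightarrow> int) \<Rightarrow> (nat \<Rightarrow> int)" where
  "zsmult c x = (\<lambda>i. c * x i)"

definition zspan :: "nat \<Rightarrow> (nat \<Rightarrow> nat \<Rightarrow> int) \<Rightarrow> (nat \<Rightarrow> int) set" where
  "zspan k b = {(\<Sum>i<k. zsmult (c i) (b i)) | c. True}"

definition zlin_indep :: "nat \<Rightarrow> (nat \<Rightarrow> nat \<Rightarrow> int) \<Rightarrow> bool" where
  "zlin_indep k b \<longleftrightarrow> (\<forall>c. (\<Sum>i<k. zsmult (c i) (b i)) = 0 \<longrightarrow> (\<forall>i<k. c i = 0))"

definition has_rank :: "(nat \<Rightarrow> int) set \<Rightarrow> nat \<Rightarrow> bool" where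
  "has_rank L k \<longleftrightarrow> (\<exists>b. (\<forall>i<k. b i \<in> L) \<and> zlin_indep k b \<and> L = zspan k b)"

definition obtuse_superbase ::
  "nat \<Rightarrow> (nat \<Rightarrow> int) set \<Rightarrow> nat \<Rightarrow> (nat \<Rightarrow> nat \<Rightarrow> int) \<Rightarrow> bool" where
  "obtuse_superbase N L k v \<longleftrightarrow>
     has_rank L k \<and> (\<forall>i\<le>k. v i \<in> L) \<and> L = zspan (Suc k) v \<and>
     (\<forall>i\<le>k. \<forall>j\<le>k. i \<noteq> j \<longrightarrow> dot N (v i) (v j) \<le> 0) \<and>
     (\<Sum>i\<le>k. v i) = 0"

definition mg_edges :: "nat \<Rightarrow> (nat \<Rightarrow> nat \<Rightarrow> nat) \<Rightarrow> (nat \<times> nat \<times> nat) set" where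
  "mg_edges k m = {(i, j, t). i < j \<and> j \<le> k \<and> t < m i j}"

definition planar_multigraph :: "nat \<Rightarrow> (nat \<Rightarrow> nat \<Rightarrow> nat) \<Rightarrow> bool" where
  "planar_multigraph k m \<longleftrightarrow>
     (\<exists>(p :: nat \<Rightarrow> complex) (\<gamma> :: nat \<times> nat \<times> nat \<Rightarrow> real \<Rightarrow> complex).
        inj_on p {..k} \<and>
        (\<forall>(i, j, t) \<in> mg_edges k m.
            arc (\<gamma> (i, j, t)) \<and> pathstart (\<gamma> (i, j, t)) = p i \<and>
            pathfinish (\<gamma> (i, j, t)) = p j \<and>
            (\<forall>l\<le>k. p l \<in> path_image (\<gamma> (i, j, t)) \<longrightarrow> l = i \<or> l = j)) \<and>
        (\<forall>(i, j, t) \<in> mg_edges k m. \<forall>(i', j', t') \<in> mg_edges k m.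
            (i, j, t) \<noteq> (i', j', t') \<longrightarrow>
            path_image (\<gamma> (i, j, t)) \<inter> path_image (\<gamma> (i', j', t'))
              \<subseteq> p ` ({i, j} \<inter> {i', j'})))"

definition planar_superbase :: "nat \<Rightarrow> nat \<Rightarrow> (nat \<Rightarrow> nat \<Rightarrow> int) \<Rightarrow> bool" where
  "planar_superbase N k v \<longleftrightarrow> planar_multigraph k (\<lambda>i j. nat \<bar>dot N (v i) (v j)\<bar>)"

definition admits_obtuse_superbase :: "nat \<Rightarrow> (nat \<Rightarrow> int) set \<Rightarrow> bool" where
  "admits_obtuse_superbase N L \<longleftrightarrow> (\<exists>k v. obtuse_superbase N L k v)"

definition admits_planar_obtuse_superbase :: "nat \<Rightarrow> (nat \<Rightarrow> int) set \<Rightarrow> bool" where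
  "admits_planar_obtuse_superbase N L \<longleftrightarrow>
     (\<exists>k v. obtuse_superbase N L k v \<and> planar_superbase N k v)"

definition sublattice :: "(nat \<Rightarrow> int) set \<Rightarrow> (nat \<Rightarrow> int) set \<Rightarrow> bool" where
  "sublattice A L \<longleftrightarrow> A \<subseteq> L \<and> 0 \<in> A \<and> (\<forall>x\<in>A. \<forall>y\<in>A. x - y \<in> A)"

definition decomposable :: "nat \<Rightarrow> (nat \<Rightarrow> int) set \<Rightarrow> bool" where
  "decomposable N L \<longleftrightarrow>
     (\<exists>A C. sublattice A L \<and> sublattice C L \<and> A \<noteq> {0} \<and> C \<noteq> {0} \<and>
        (\<forall>a\<in>A. \<forall>c\<in>C. dot N a c = 0) \<and>
        L = {a + c | a c. a \<in> A \<and> c \<in> C})"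

definition changemaker :: "int list \<Rightarrow> bool" where
  "changemaker s \<longleftrightarrow> s \<noteq> [] \<and> s ! 0 = 1 \<and>
     (\<forall>i. 0 < i \<and> i < length s \<longrightarrow>
        s ! (i - 1) \<le> s ! i \<and> s ! i \<le> 1 + sum_list (take i s))"

definition very_slack :: "int list \<Rightarrow> bool" where
  "very_slack s \<longleftrightarrow> (\<forall>k < length s. s ! k > 1 \<longrightarrow> s ! k \<le> sum_list (take k s) - 1)"

definition stable_coeffs :: "int list \<Rightarrow> int multiset" where
  "stable_coeffs s = mset (filter (\<lambda>x. x \<ge> 2) s)"

definition sqnorm :: "int list \<Rightarrow> int" where
  "sqnorm s = sum_list (map (\<lambda>x. x * x) s)"

text \<open>sigma_{i+1} sits at coordinate i of Z^r.\<close>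
definition cm_vec :: "int list \<Rightarrow> nat \<Rightarrow> int" where
  "cm_vec s = (\<lambda>i. if i < length s then s ! i else 0)"

definition cm_lattice :: "int list \<Rightarrow> (nat \<Rightarrow> int) set" where
  "cm_lattice s = {x \<in> zvec (length s). dot (length s) x (cm_vec s) = 0}"

text \<open>(n-1/2)-changemaker lattice in Z^(s+2): coordinate 0 is e_(-1),
  coordinate 1 is e_0, coordinate i+1 is e_i for 1 <= i <= s.\<close>
definition half_w1 :: "nat \<Rightarrow> int" where
  "half_w1 = (\<lambda>i. if i = 0 then 1 else if i = 1 then -1 else 0)"

definition half_w2 :: "int list \<Rightarrow> nat \<Rightarrow> int" where
  "half_w2 t = (\<lambda>i. if i = 1 then 1
                    else if 2 \<le> i \<and> i < length t + 2 then t ! (i - 2) else 0)"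

definition half_cm_lattice :: "int list \<Rightarrow> (nat \<Rightarrow> int) set" where
  "half_cm_lattice t = {x \<in> zvec (length t + 2).
       dot (length t + 2) x half_w1 = 0 \<and> dot (length t + 2) x (half_w2 t) = 0}"

end

theory Submission imports Defs begin

text \<open>Let \<open>m\<close> be the number of ones in \<open>sigma\<close>; very slackness gives \<open>m \<ge> 3\<close>. The vectors
  \<open>e_i - e_j\<close> with \<open>i, j\<close> in \<open>{0, 1, 2}\<close> are irreducible, hence are sums over sets of superbase elements,
  and they cut the graph of the superbase into three pieces joined cyclically by single edges. Reading off
  coefficient differences along these edges shows that every coefficient \<open>s_k \<ge> 2\<close> is a sum of earlier
  coefficients \<open>\<ge> 2\<close> plus either 1 or \<open>m - 1\<close>, and that the vectors belonging to the first alternative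
  are orthogonal to those belonging to the second. These two families split the sublattice of vectors with
  vanishing coordinate 0, which is the \<open>(n - 1)\<close>-changemaker lattice.

  The same splitting, applied to the superbase elements themselves, shows that their coordinates 0 are in
  \<open>{-1, 0, 1}\<close>, and that two elements with coordinate 1 separate the graph. The Whitney twist of the
  superbase at this pair removes both of these coordinates, so after finitely many twists only one
  coordinate 1 and one coordinate \<open>-1\<close> are left. Since the half-integer lattice is obtained by repeating
  coordinate 0, its superbase then has the same graph with one additional edge. That edge also joins the
  two vertices of a 2-separation; drawing the two sides of the separation in opposite half planes
  shows that twists and the additional edge preserve planarity.\<close>

subsection \<open>Collapsing polygonal arcs in the plane\<close>

text \<open>On the arithmetic side one additive integer decides everything. Along each of the three
  joining edges the coefficients of a lattice vector jump; subtracting the jump from the matching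
  coordinate gives the same number \<open>g\<close> for coordinates 0, 1 and 2. On an irreducible
  vector two equal coordinates determine \<open>g\<close>, because a connected cut cannot leave a
  piece along one edge and come back along the other. Comparing such readings with additivity
  restricts the number of ones and shows which cuts cross which edge.

  On the topological side the obstacle is to move one side of a 2-separation into a half plane with
  both separating vertices on the boundary. No homeomorphism of the plane is needed for this: a map
  that is continuous and injective on the drawn set suffices. An arc through the other side is
  replaced by a polygonal one, whose segments may be contracted one by one until a single slit is
  left; a square root opens the slit. Since edges can be wild near a vertex, they are straightened
  there beforehand.\<close>

definition arcset :: "complex set \<Rightarrow> complex \<Rightarrow> complex \<Rightarrow> bool" where
  "arcset X a b \<longleftrightarrow> (\<exists>g. arc g \<and> path_image g = X \<and> pathstart g = a \<and> pathfinish g = b)"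

lemma arcset_sym: "arcset X a b \<Longrightarrow> arcset X b a"
  unfolding arcset_def
  by (metis arc_reversepath path_image_reversepath pathfinish_reversepath pathstart_reversepath)

lemma arcset_ends: "arcset X a b \<Longrightarrow> a \<in> X \<and> b \<in> X \<and> a \<noteq> b"
  unfolding arcset_def using arc_distinct_ends by fastforce

lemma arcset_compact: "arcset X a b \<Longrightarrow> compact X"
  unfolding arcset_def by (metis compact_arc_image)

lemma arcset_path_connected: "arcset X a b \<Longrightarrow> path_connected X"
  unfolding arcset_def by (metis arc_imp_path path_connected_path_image)

lemma arcset_image:
  assumes "arcset X a b" "continuous_on X f" "inj_on f X"
  shows "arcset (f ` X) (f a) (f b)"
proof -
  obtain g where g: "arc g" "path_image g = X" "pathstart g = a" "pathfinish g = b"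
    using assms(1) arcset_def by auto
  have "path (f \<circ> g)"
    using g assms(2) arc_imp_path path_continuous_image by blast
  moreover have "inj_on (f \<circ> g) {0..1}"
    using g assms(3) by (metis arc_def comp_inj_on path_image_def)
  ultimately have "arc (f \<circ> g)" by (simp add: arc_def)
  then show ?thesis
    unfolding arcset_def
    by (metis g(2-4) path_image_compose pathfinish_compose pathstart_compose)
qed

lemma arcset_segment: "a \<noteq> b \<Longrightarrow> arcset (closed_segment a b) a b"
  unfolding arcset_def by (metis arc_linepath path_image_linepath pathfinish_linepath pathstart_linepath)

section \<open>Polygonal arcs\<close>

text \<open>Arcs grow at the free end while \<open>u\<close> stays fixed. An induction thus meets
  the first segment and a shorter arc to the same \<open>u\<close>, which is the order in which
  segments are contracted later.\<close>

inductive polyarc :: "complex \<Rightarrow> complex \<Rightarrow> complex set \<Rightarrow> bool" for u where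
  base: "a \<noteq> u \<Longrightarrow> polyarc u a (closed_segment a u)"
| step: "polyarc u b P \<Longrightarrow> a \<noteq> b \<Longrightarrow> closed_segment a b \<inter> P = {b} \<Longrightarrow>
    polyarc u a (closed_segment a b \<union> P)"

lemma polyarc_facts: "polyarc u a P \<Longrightarrow> closed P \<and> u \<in> P \<and> a \<in> P \<and> a \<noteq> u"
proof (induction rule: polyarc.induct)
  case (base a)
  then show ?case by simp
next
  case (step b P a)
  have "a \<notin> P" using step(2,3) by (metis IntI ends_in_segment(1) singletonD)
  then show ?case using step by (auto simp: closed_Un)
qed

lemma polyarc_truncate:
  "polyarc u a P \<Longrightarrow> y \<in> P \<Longrightarrow> y \<noteq> u \<Longrightarrow> \<exists>P'\<subseteq>P. polyarc u y P'"
proof (induction rule: polyarc.induct)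
  case (base a)
  then have "closed_segment y u \<subseteq> closed_segment a u"
    by (simp add: subset_closed_segment)
  then show ?case using base polyarc.base by blast
next
  case (step b P a)
  show ?case
  proof (cases "y \<in> P")
    case True
    then show ?thesis using step by blast
  next
    case False
    then have y: "y \<in> closed_segment a b" "y \<noteq> b" using step polyarc_facts by auto
    then have s: "closed_segment y b \<subseteq> closed_segment a b"
      by (simp add: subset_closed_segment)
    then have "closed_segment y b \<inter> P = {b}"
      using step.hyps(3) by auto
    then have "polyarc u y (closed_segment y b \<union> P)"
      using polyarc.step step.hyps y by blast
    then show ?thesis using s by blast
  qed
qed

text \<open>The segment from \<open>y\<close> may meet \<open>P\<close> many times. It is cut off at
  the point \<open>z\<close> of \<open>P\<close> nearest to \<open>y\<close>, and from there the
  tail of \<open>P\<close> is followed.\<close>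

lemma polyarc_extend:
  assumes "polyarc u x P" "y \<noteq> u"
  shows "\<exists>P'\<subseteq>closed_segment y x \<union> P. polyarc u y P'"
proof (cases "y \<in> P")
  case True
  then obtain P' where "P' \<subseteq> P" "polyarc u y P'" using polyarc_truncate[OF assms(1) _ assms(2)] by metis
  then show ?thesis by (intro exI[of _ P']) auto
next
  case False
  let ?C = "closed_segment y x \<inter> P"
  have C: "compact ?C" "?C \<noteq> {}"
    using polyarc_facts[OF assms(1)] by (auto intro: compact_Int_closed)
  have "continuous_on ?C (dist y)" by (intro continuous_on_dist continuous_on_const continuous_on_id)
  from continuous_attains_inf[OF C this]
  obtain z where z: "z \<in> ?C" "\<And>w. w \<in> ?C \<Longrightarrow> dist y z \<le> dist y w" by blast
  have sub: "closed_segment y z \<subseteq> closed_segment y x"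
    using z by (simp add: subset_closed_segment)
  have only: "w = z" if "w \<in> closed_segment y z" "w \<in> P" for w
  proof -
    have "dist y z \<le> dist y w" using z sub that by blast
    moreover have "dist y z = dist y w + dist w z"
      using that(1) between_mem_segment[of y z w] between[of y z w] by simp
    ultimately show ?thesis by (smt (verit) dist_eq_0_iff zero_le_dist)
  qed
  have "y \<noteq> z" using z False by auto
  show ?thesis
  proof (cases "z = u")
    case True
    then have "polyarc u y (closed_segment y z)" using assms polyarc.base by blast
    then show ?thesis using sub by blast
  next
    case False
    obtain P' where P': "P' \<subseteq> P" "polyarc u z P'"
      using polyarc_truncate[OF assms(1)] z False by blast
    have "closed_segment y z \<inter> P' = {z}"
      using only P' polyarc_facts[OF P'(2)] by auto
    then have "polyarc u y (closed_segment y z \<union> P')"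
      using polyarc.step P' \<open>y \<noteq> z\<close> by blast
    then show ?thesis using sub P' by blast
  qed
qed

text \<open>Being joined to \<open>u\<close> by such an arc is locally constant on \<open>S\<close>,
  because two points of a ball in \<open>S\<close> are joined by a segment; connectedness does the
  rest. The end \<open>u\<close> lies outside \<open>S\<close> and is reached along the given
  segment.\<close>

lemma polyarc_exists:
  assumes "connected S" "open S" "x \<in> S" "y \<in> S" "u \<notin> S" "closed_segment x u \<subseteq> insert u S"
  shows "\<exists>P\<subseteq>insert u S. polyarc u y P"
proof -
  define Q where "Q = (\<lambda>y. \<exists>P\<subseteq>insert u S. polyarc u y P)"
  have ext: "Q z'" if Qz: "Q z" and "z' \<in> S" "closed_segment z' z \<subseteq> S" for z z'
  proof -
    obtain P where P: "P \<subseteq> insert u S" "polyarc u z P" using Qz unfolding Q_def by metis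
    have "z' \<noteq> u" using that assms by auto
    then obtain P' where "P' \<subseteq> closed_segment z' z \<union> P" "polyarc u z' P'"
      using polyarc_extend[OF P(2)] by blast
    then show ?thesis unfolding Q_def using P that by blast
  qed
  have Qx: "Q x" unfolding Q_def using assms polyarc.base[of x u] by blast
  have "Q x \<longleftrightarrow> Q y"
  proof (rule connected_equivalence_relation[OF assms(1) assms(3,4)])
    fix a assume a: "a \<in> S"
    then obtain r where r: "r > 0" "ball a r \<subseteq> S" using assms(2) openE by blast
    have "Q a \<longleftrightarrow> Q z" if "z \<in> ball a r" for z
    proof -
      have "closed_segment a z \<subseteq> ball a r" "closed_segment z a \<subseteq> ball a r"
        using r that closed_segment_subset[of a "ball a r" z] by (auto simp: closed_segment_commute)
      then show ?thesis using ext[of a z] ext[of z a] r that a by blast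
    qed
    moreover have "openin (top_of_set S) (ball a r)" using r by (simp add: open_subset)
    ultimately show "\<exists>T. openin (top_of_set S) T \<and> a \<in> T \<and> (\<forall>x\<in>T. Q a \<longleftrightarrow> Q x)"
      using r by (intro exI[of _ "ball a r"]) auto
  qed auto
  then show ?thesis using Qx Q_def by blast
qed

text \<open>A point of \<open>X\<close> need not be accessible from the complement by segments,
  hence the straight hairs at \<open>u\<close> and \<open>v\<close>. The set \<open>T\<close>
  certifies that the free ends of the hairs lie in one component of the complement.\<close>

lemma polyarc_hairs:
  assumes X: "closed X" and u: "x \<noteq> u" "closed_segment x u \<inter> X = {u}"
    and v: "y \<noteq> v" "closed_segment y v \<inter> X = {v}" and "u \<noteq> v"
    and comp: "connected T" "T \<inter> X = {}" "x \<in> T" "y \<in> T"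
  shows "\<exists>P. polyarc u v P \<and> P \<inter> X = {u, v}"
proof -
  let ?S = "connected_component_set (- X) x"
  have S: "open ?S" "connected ?S" "?S \<subseteq> - X"
    using X open_connected_component[of "- X" x] connected_component_subset[of "- X" x]
    by (simp_all add: open_Compl)
  have xy: "x \<in> ?S" "y \<in> ?S"
  proof -
    have "x \<notin> X" using comp by auto
    then show "x \<in> ?S" by simp
    show "y \<in> ?S" using comp by (auto simp: connected_component_def)
  qed
  have uv: "u \<in> X" "v \<in> X" using u v by auto
  have hairmem: "w \<in> ?S" if "w \<in> closed_segment x u" "w \<noteq> u" for w
  proof -
    have "closed_segment x w \<subseteq> closed_segment x u" using that by (simp add: subset_closed_segment)
    moreover have "u \<notin> closed_segment x w"
    proof
      assume "u \<in> closed_segment x w"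
      then have "dist x u + dist u w = dist x w" by (metis between between_mem_segment)
      moreover have "dist x w + dist w u = dist x u" using that by (metis between between_mem_segment)
      ultimately show False using that by (smt (verit) dist_commute dist_eq_0_iff zero_le_dist)
    qed
    moreover have "closed_segment x u \<inter> X \<subseteq> {u}" using u(2) by simp
    ultimately have "closed_segment x w \<inter> X = {}" by auto
    then have "closed_segment x w \<subseteq> - X" by auto
    then show ?thesis unfolding connected_component_def
      by (metis (mono_tags, lifting) connected_segment(1) ends_in_segment mem_Collect_eq)
  qed
  then have "closed_segment x u \<subseteq> insert u ?S" by blast
  moreover have "u \<notin> ?S" using S uv by auto
  ultimately obtain P where P: "P \<subseteq> insert u ?S" "polyarc u y P"
    using polyarc_exists[OF S(2,1) xy] by blast
  obtain P' where P': "P' \<subseteq> closed_segment v y \<union> P" "polyarc u v P'"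
    using polyarc_extend[OF P(2)] \<open>u \<noteq> v\<close> by metis
  have "P' \<inter> X \<subseteq> {u, v}"
    using P' P S v by (auto simp: closed_segment_commute)
  then show ?thesis using P' polyarc_facts[OF P'(2)] uv by blast
qed

lemma polyarc_head:
  assumes "polyarc u b P"
  shows "\<exists>c P'. P = closed_segment b c \<union> P' \<and> c \<in> P' \<and> closed P' \<and> b \<notin> P' \<and> u \<in> P'"
  using assms
proof (cases rule: polyarc.cases)
  case base
  then show ?thesis by (intro exI[of _ u] exI[of _ "{u}"]) auto
next
  case (step c P')
  then have "b \<notin> P'" by (metis IntI ends_in_segment(1) singletonD)
  then show ?thesis
    using step polyarc_facts[OF step(2)] by (intro exI[of _ c] exI[of _ P']) auto
qed

section \<open>Contracting a segment to one of its ends\<close>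

text \<open>A radial contraction towards \<open>p\<close>: the segment from \<open>p\<close> to
  \<open>v\<close> goes to \<open>p\<close>, and points at distance at least \<open>e\<close> from
  it stay fixed. It is not injective on the segment, but it will be applied to sets that meet the
  segment only in \<open>v\<close>.\<close>

definition collapse :: "complex \<Rightarrow> complex \<Rightarrow> real \<Rightarrow> complex \<Rightarrow> complex" where
  "collapse p v e z = p + min 1 (infdist z (closed_segment p v) / e) *\<^sub>R (z - p)"

lemma collapse_continuous: "e > 0 \<Longrightarrow> continuous_on UNIV (collapse p v e)"
  unfolding collapse_def by (intro continuous_intros) auto

text \<open>Scaling towards \<open>p\<close> maps the segment into itself and shrinks distances. So
  the distance to the segment never decreases on the way out along a ray from \<open>p\<close>; this
  keeps the contraction injective.\<close>

lemma infdist_segment_scale: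
  assumes "0 \<le> t" "t \<le> 1"
  shows "infdist (p + t *\<^sub>R (z - p)) (closed_segment p (v::complex)) \<le> infdist z (closed_segment p v)"
proof -
  let ?S = "closed_segment p v"
  obtain s where s: "s \<in> ?S" "infdist z ?S = dist z s"
    using infdist_attains_inf[of ?S z] by auto
  have "p + t *\<^sub>R (s - p) \<in> ?S"
  proof -
    have "(1 - t) *\<^sub>R p + t *\<^sub>R s \<in> ?S"
      using s assms convexD[of ?S p s "1 - t" t] by auto
    then show ?thesis by (simp add: algebra_simps)
  qed
  then have "infdist (p + t *\<^sub>R (z - p)) ?S \<le> dist (p + t *\<^sub>R (z - p)) (p + t *\<^sub>R (s - p))"
    by (rule infdist_le)
  also have "\<dots> = t * dist z s"
    using assms by (simp add: dist_norm flip: scaleR_diff_right)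
  also have "\<dots> \<le> dist z s" using assms by (simp add: mult_left_le_one_le)
  finally show ?thesis using s by simp
qed

lemma infdist_segment_pos:
  "infdist z (closed_segment p v) > 0 \<longleftrightarrow> z \<notin> closed_segment p (v::complex)"
  by (metis closed_segment empty_iff ends_in_segment(1) in_closed_iff_infdist_zero infdist_nonneg
      order_less_le)

text \<open>Two points with the same image other than \<open>p\<close> lie on one ray from
  \<open>p\<close>. The nearer one has a scale factor no larger than the other, so equal images
  force equal factors and equal points.\<close>

lemma collapse_inj:
  assumes e: "e > 0" and z: "z \<notin> closed_segment p v" and eq: "collapse p v e z = collapse p v e z'"
  shows "z = z'"
proof -
  let ?t = "\<lambda>z. min 1 (infdist z (closed_segment p v) / e)"
  have mono: "?t (p + s *\<^sub>R (w - p)) \<le> ?t w" if "0 \<le> s" "s \<le> 1" for s w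
    using infdist_segment_scale[OF that, of p w v] e by (smt (verit) divide_right_mono)
  have pos: "?t w > 0 \<longleftrightarrow> w \<notin> closed_segment p v" for w
    using e infdist_segment_pos[of w p v] by (simp add: zero_less_divide_iff)
  have nn: "?t w \<ge> 0" for w using e by (simp add: infdist_nonneg)
  have zp: "z \<noteq> p" using z by auto
  have key: "w = w'" if "?t w *\<^sub>R (w - p) = ?t w' *\<^sub>R (w' - p)" "?t w > 0" "?t w' > 0"
      "norm (w - p) \<le> norm (w' - p)" "w' \<noteq> p" for w w'
  proof -
    define s where "s = ?t w' / ?t w"
    have s0: "s > 0" using that s_def by simp
    have "?t w *\<^sub>R (w - p) = ?t w *\<^sub>R (s *\<^sub>R (w' - p))"
      unfolding that(1) using that(2) by (simp add: s_def)
    then have ws: "w - p = s *\<^sub>R (w' - p)"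
      by (metis order_less_irrefl scaleR_cancel_left that(2))
    then have "s * norm (w' - p) \<le> norm (w' - p)" using that(4) s0 by simp
    then have s1: "s \<le> 1" using that(5) mult_right_le_imp_le[of s "norm (w' - p)" 1] by simp
    have "w = p + s *\<^sub>R (w' - p)" using ws by (simp add: algebra_simps)
    then have "?t w \<le> ?t w'" using mono[of s w'] s0 s1 by simp
    then have "s \<ge> 1" using that(2) by (simp add: s_def)
    then have "s = 1" using s1 by simp
    then show ?thesis using ws by simp
  qed
  have eq': "?t z *\<^sub>R (z - p) = ?t z' *\<^sub>R (z' - p)"
    using eq unfolding collapse_def by simp
  have tz: "?t z > 0" using pos z by blast
  then have "?t z' *\<^sub>R (z' - p) \<noteq> 0" using eq' zp by (metis eq_iff_diff_eq_0 order_less_irrefl scaleR_eq_0_iff)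
  then have tz': "?t z' > 0" and zp': "z' \<noteq> p" using nn[of z'] by (auto simp: less_le)
  show ?thesis
    using key[OF eq' tz tz' _ zp'] key[OF eq'[symmetric] tz' tz _ zp] linear by metis
qed

lemma collapse_far: "infdist z (closed_segment p v) \<ge> e \<Longrightarrow> e > 0 \<Longrightarrow> collapse p v e z = z"
  unfolding collapse_def by (simp add: le_divide_eq)

lemma collapse_near: "z \<in> closed_segment p v \<Longrightarrow> collapse p v e z = p"
  unfolding collapse_def by simp

lemma infdist_collapse:
  assumes "e > 0"
  shows "infdist (collapse p v e z) (closed_segment p v) \<le> infdist z (closed_segment p v)"
  unfolding collapse_def using assms by (intro infdist_segment_scale) (auto simp: infdist_nonneg)

text \<open>The leading segment of an arc, from \<open>v\<close> to \<open>b\<close>, is contracted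
  to \<open>b\<close>. The constant \<open>e\<close> does not exceed its distance from the later
  part \<open>P'\<close>, which therefore stays fixed; the danger is that a point of
  \<open>X\<close> moves onto the next segment, from \<open>b\<close> to \<open>c\<close>.\<close>

lemma collapse_step:
  fixes P' :: "complex set"
  assumes X: "v \<noteq> b" "closed_segment v b \<inter> P = {b}" "P = closed_segment b c \<union> P'"
    "c \<in> P'" "closed P'" "b \<notin> P'" "u \<in> P'"
    and XP: "X \<inter> (closed_segment v b \<union> P) = {v, u}" and "u \<noteq> v"
  shows "\<exists>\<kappa>. continuous_on UNIV \<kappa> \<and> inj_on \<kappa> X \<and> \<kappa> v = b \<and> \<kappa> u = u \<and> \<kappa> ` X \<inter> P = {b, u}"
proof -
  let ?S = "closed_segment b v"
  have SP: "?S \<inter> P \<subseteq> {b}" using X(2) by (simp add: closed_segment_commute)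
  have "?S \<inter> P' = {}" using SP X(3,6) by auto
  then obtain e where e: "e > 0" "\<And>x y. x \<in> ?S \<Longrightarrow> y \<in> P' \<Longrightarrow> e \<le> dist x y"
    using separate_compact_closed[of ?S P'] X by auto
  have far: "infdist y ?S \<ge> e" if y: "y \<in> P'" for y
  proof -
    obtain s where "s \<in> ?S" "infdist y ?S = dist y s" using infdist_attains_inf[of ?S y] by auto
    then show ?thesis using e y by (metis dist_commute)
  qed
  let ?k = "collapse b v e"
  have ku: "?k u = u" using collapse_far far X e by blast
  have kv: "?k v = b" using collapse_near by simp
  have XS: "z = v" if "z \<in> X" "z \<in> ?S" for z
  proof -
    have "z = v \<or> z = u" using that XP by (auto simp: closed_segment_commute)
    moreover have "u \<notin> ?S" using far[OF X(7)] e infdist_zero[of u ?S] by auto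
    ultimately show ?thesis using that by auto
  qed
  have inj: "inj_on ?k X"
  proof (rule inj_onI)
    fix z z' assume zz: "z \<in> X" "z' \<in> X" "?k z = ?k z'"
    show "z = z'"
    proof (cases "z \<in> ?S")
      case True
      then show ?thesis
        using XS[OF zz(1)] XS[OF zz(2)] collapse_inj[OF e(1), of z' b v z] zz by metis
    next
      case False
      then show ?thesis using collapse_inj[OF e(1)] zz by blast
    qed
  qed
  have sub: "?k z = b \<or> ?k z = u" if z: "z \<in> X" "?k z \<in> P" for z
  proof (cases "z = v")
    case True
    then show ?thesis using kv by simp
  next
    case False
    then have zS: "z \<notin> ?S" using XS z by blast
    have zu: "z = u" if "z \<in> P" using z that XP False by auto
    consider "?k z \<in> P'" | "?k z \<in> closed_segment b c" using z X by auto
    then show ?thesis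
    proof cases
      case 1
      then have "infdist z ?S \<ge> e" using far infdist_collapse[OF e(1), of b v z] by force
      then have "?k z = z" using collapse_far e by blast
      then show ?thesis using zu z by auto
    next
      case 2
      then obtain s where s: "0 \<le> s" "s \<le> 1" "?k z = b + s *\<^sub>R (c - b)"
        unfolding closed_segment_def by (auto simp: algebra_simps)
      define t where "t = min 1 (infdist z ?S / e)"
      have t: "t > 0" "t \<le> 1" using infdist_segment_pos[of z b v] zS e by (auto simp: t_def)
      have eq: "t *\<^sub>R (z - b) = s *\<^sub>R (c - b)" using s(3) unfolding collapse_def t_def by simp
      \<comment> \<open>Either \<open>z\<close> was already on the segment from \<open>b\<close> to
        \<open>c\<close>, or \<open>c\<close> lies between \<open>b\<close> and \<open>z\<close>;
        then \<open>z\<close> is at least as far from the contracted segment as \<open>c\<close>,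
        hence fixed.\<close>
      show ?thesis
      proof (cases "s \<le> t")
        case True
        have "z - b = (s / t) *\<^sub>R (c - b)"
        proof -
          have "z - b = (1/t) *\<^sub>R (t *\<^sub>R (z - b))" using t by simp
          then show ?thesis unfolding eq by (simp add: divide_inverse_commute)
        qed
        then have "z = (1 - s/t) *\<^sub>R b + (s/t) *\<^sub>R c" by (simp add: algebra_simps)
        moreover have "0 \<le> s / t" "s / t \<le> 1" using True s t by auto
        ultimately have "z \<in> closed_segment b c" unfolding closed_segment_def by blast
        then show ?thesis using zu X ku by auto
      next
        case False
        then have "s > 0" using t by auto
        have "c - b = (t / s) *\<^sub>R (z - b)"
        proof -
          have "c - b = (1/s) *\<^sub>R (s *\<^sub>R (c - b))" using \<open>s > 0\<close> by simp
          then show ?thesis unfolding eq[symmetric] by (simp add: divide_inverse_commute)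
        qed
        then have "c = b + (t / s) *\<^sub>R (z - b)" by (simp add: algebra_simps)
        then have "infdist c ?S \<le> infdist z ?S"
          using infdist_segment_scale[of "t/s" b z v] False t \<open>s > 0\<close> by simp
        then have "t = 1" using far[OF X(4)] e by (simp add: t_def le_divide_eq)
        then show ?thesis using False s by simp
      qed
    qed
  qed
  have "b \<in> ?k ` X" "u \<in> ?k ` X" "b \<in> P" "u \<in> P"
  proof -
    have "v \<in> X" "u \<in> X" using XP by auto
    then show "b \<in> ?k ` X" "u \<in> ?k ` X" using kv ku by (metis image_eqI)+
    show "b \<in> P" "u \<in> P" using X(2,3,7) by auto
  qed
  then have "?k ` X \<inter> P = {b, u}" using sub by auto
  then show ?thesis
    using collapse_continuous[OF e(1)] inj kv ku by blast
qed

text \<open>Injectivity is only required on \<open>X\<close>, so the segments of \<open>P\<close>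
  can be contracted in turn until the last one is left.\<close>

lemma polyarc_straighten:
  "polyarc u v P \<Longrightarrow> X \<inter> P = {v, u} \<Longrightarrow>
   \<exists>\<kappa>::complex \<Rightarrow> complex. continuous_on UNIV \<kappa> \<and> inj_on \<kappa> X \<and> \<kappa> ` X \<inter> closed_segment (\<kappa> v) (\<kappa> u) = {\<kappa> v, \<kappa> u}"
proof (induction arbitrary: X rule: polyarc.induct)
  case (base a)
  then show ?case by (intro exI[of _ id]) (simp add: continuous_on_id)
next
  case (step b P a)
  have "u \<noteq> a" using polyarc_facts[OF step(1)] step by (metis IntI ends_in_segment(1) singletonD)
  obtain c P' where h: "P = closed_segment b c \<union> P'" "c \<in> P'" "closed P'" "b \<notin> P'" "u \<in> P'"
    using polyarc_head[OF step(1)] by blast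
  obtain k where k: "continuous_on UNIV k" "inj_on k X" "k a = b" "k u = u" "k ` X \<inter> P = {b, u}"
    using collapse_step[OF step(2,3) h step.prems \<open>u \<noteq> a\<close>] by blast
  obtain l :: "complex \<Rightarrow> complex" where l: "continuous_on UNIV l" "inj_on l (k ` X)"
    "l ` k ` X \<inter> closed_segment (l b) (l u) = {l b, l u}"
    using step.IH[OF k(5)] by metis
  have "continuous_on UNIV (l \<circ> k)"
    using k l continuous_on_compose continuous_on_subset by blast
  moreover have "inj_on (l \<circ> k) X" using k l by (simp add: comp_inj_on)
  moreover have "(l \<circ> k) ` X \<inter> closed_segment ((l \<circ> k) a) ((l \<circ> k) u) = {(l \<circ> k) a, (l \<circ> k) u}"
    using k(3,4) l(3) by (simp only: image_comp[symmetric] comp_apply)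
  ultimately show ?case by blast
qed

section \<open>Opening a slit to a half plane\<close>

text \<open>The point 0 lies on the branch cut, but the modulus of the root tends to 0 with its
  argument. Both ends of the slit are sent to 0 by one of the two quotients used below.\<close>

lemma continuous_within_csqrt_0: "continuous (at 0) csqrt"
proof -
  have "((\<lambda>z. cmod (csqrt z)) \<longlongrightarrow> 0) (at 0)"
    by (simp add: norm_csqrt) (intro tendsto_eq_intros | simp)+
  then have "(csqrt \<longlongrightarrow> 0) (at 0)" using tendsto_norm_zero_iff by blast
  then show ?thesis by (simp add: continuous_within)
qed

text \<open>The Moebius map sending \<open>b\<close> to \<open>0\<close> and \<open>a\<close> to \<open>\<infinity>\<close> takes the slit to the negative real axis,
  so its square root lies in the right half plane, which a Cayley map takes to the upper half plane.\<close>

lemma slit_map: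
  fixes a b :: complex
  assumes ab: "a \<noteq> b" and X: "X \<inter> closed_segment a b = {a, b}"
  shows "\<exists>f. continuous_on X f \<and> inj_on f X \<and> f a = -1 \<and> f b = 1 \<and> (\<forall>z\<in>X. z \<noteq> a \<and> z \<noteq> b \<longrightarrow> Im (f z) > 0)"
proof -
  define r where "r = (\<lambda>z. csqrt ((z - b) / (z - a)))"
  \<comment> \<open>At \<open>a\<close> the quotient in \<open>r\<close> divides by zero, so the
    limit -1 is put into \<open>f\<close> by hand. The reciprocal root \<open>q\<close> is regular
    at \<open>a\<close>, and continuity there is proved with it.\<close>
  define q where "q = (\<lambda>z. csqrt ((z - a) / (z - b)))"
  define f where "f = (\<lambda>z. if z = a then -1 else (1 + \<i> * r z) / (1 - \<i> * r z))"
  \<comment> \<open>A quotient \<open>- s'\<close> with \<open>s' \<ge> 0\<close> makes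
    \<open>z\<close> the convex combination of \<open>a\<close> and \<open>b\<close> with weights
    proportional to \<open>s'\<close> and 1, that is, a point of the slit.\<close>
  have ratio: "(z - b) / (z - a) \<notin> \<real>\<^sub>\<le>\<^sub>0" if z: "z \<in> X" "z \<noteq> a" "z \<noteq> b" for z
  proof
    assume "(z - b) / (z - a) \<in> \<real>\<^sub>\<le>\<^sub>0"
    then obtain s where s: "s \<le> 0" "(z - b) / (z - a) = of_real s"
      by (metis nonpos_Reals_cases)
    define s' where "s' = - s"
    have "z - b = - of_real s' * (z - a)" using s z s'_def by (simp add: field_simps)
    then have "(1 + of_real s') * z = b + of_real s' * a" by (simp add: algebra_simps)
    moreover have n: "(1 + of_real s' :: complex) \<noteq> 0"
      using s s'_def by (metis add_nonneg_eq_0_iff neg_0_le_iff_le of_real_1 of_real_add of_real_eq_0_iff zero_le_one zero_neq_one)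
    ultimately have "z = (b + of_real s' * a) / (1 + of_real s')" by (simp add: field_simps)
    also have "\<dots> = (1 - 1 / (1 + s')) *\<^sub>R a + (1 / (1 + s')) *\<^sub>R b"
    proof -
      have "1 - 1 / (1 + s') = s' / (1 + s')" using s s'_def by (simp add: field_simps)
      then show ?thesis by (simp add: scaleR_conv_of_real add_divide_distrib)
    qed
    finally have "z \<in> closed_segment a b"
      unfolding closed_segment_def using s s'_def by (auto intro!: exI[of _ "1 / (1 + s')"])
    then show False using X z by auto
  qed
  have rneg: "Re (r z) > 0" if "z \<in> X" "z \<noteq> a" "z \<noteq> b" for z
  proof -
    have "Re (r z) \<noteq> 0"
    proof
      assume "Re (r z) = 0"
      then have "r z ^ 2 = - of_real (Im (r z) ^ 2)" by (simp add: complex_eq_iff power2_eq_square)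
      then have "(z - b) / (z - a) = of_real (- (Im (r z) ^ 2))" by (simp add: r_def)
      moreover have "of_real (- (Im (r z) ^ 2)) \<in> (\<real>\<^sub>\<le>\<^sub>0 :: complex set)" by (simp only: nonpos_Reals_of_real_iff) simp
      ultimately show False using ratio[OF that] by metis
    qed
    moreover have "Re (r z) \<ge> 0" unfolding r_def by (rule Re_csqrt)
    ultimately show ?thesis by simp
  qed
  have rb: "r b = 0" by (simp add: r_def)
  have Rer: "Re (r z) \<ge> 0" for z unfolding r_def by (rule Re_csqrt)
  have den: "1 - \<i> * r z \<noteq> 0" if "z \<in> X" "z \<noteq> a" for z
  proof (cases "z = b")
    case False
    then have "Im (1 - \<i> * r z) \<noteq> 0" using rneg that by fastforce
    then show ?thesis by (metis zero_complex.sel(2))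
  qed (simp add: rb)
  have fq: "f z = (q z + \<i>) / (q z - \<i>)" if z: "z \<in> X" "z \<noteq> b" for z
  proof (cases "z = a")
    case True
    then show ?thesis by (simp add: f_def q_def)
  next
    case False
    have "(z - a) / (z - b) = inverse ((z - b) / (z - a))" by simp
    then have qr: "q z = inverse (r z)"
      unfolding q_def r_def using csqrt_inverse[OF ratio[OF z(1) False z(2)]] by simp
    have "r z \<noteq> 0" using rneg[OF z(1) False z(2)] by auto
    then have "(q z + \<i>) / (q z - \<i>) = (r z * (q z + \<i>)) / (r z * (q z - \<i>))" by simp
    also have "\<dots> = (1 + \<i> * r z) / (1 - \<i> * r z)"
      using \<open>r z \<noteq> 0\<close> unfolding qr by (simp add: algebra_simps)
    finally show ?thesis using False by (simp add: f_def)
  qed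
  have qden: "q z - \<i> \<noteq> 0" if z: "z \<in> X" "z \<noteq> b" for z
  proof (cases "z = a")
    case True
    then show ?thesis by (simp add: q_def)
  next
    case False
    have "(z - a) / (z - b) = inverse ((z - b) / (z - a))" by simp
    then have qr: "q z = inverse (r z)"
      unfolding q_def r_def using csqrt_inverse[OF ratio[OF z(1) False z(2)]] by simp
    show ?thesis
    proof
      assume "q z - \<i> = 0"
      then have "inverse (q z) = - \<i>" by simp
      then have "r z = - \<i>" using qr by simp
      then show False using rneg[OF z(1) False z(2)] by simp
    qed
  qed
  have cs: "isCont csqrt w" if "w \<notin> \<real>\<^sub>\<le>\<^sub>0 \<or> w = 0" for w
    using that continuous_at_csqrt continuous_within_csqrt_0 by blast
  have rcont: "isCont r z" if "z \<in> X" "z \<noteq> a" for z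
  proof -
    have "(z - b) / (z - a) \<notin> \<real>\<^sub>\<le>\<^sub>0 \<or> (z - b) / (z - a) = 0"
      using ratio that by auto
    then have "isCont csqrt ((z - b) / (z - a))" by (rule cs)
    moreover have "isCont (\<lambda>z. (z - b) / (z - a)) z" using that by (intro continuous_intros) auto
    ultimately show ?thesis unfolding r_def by (rule isCont_o2[rotated])
  qed
  have qcont: "isCont q z" if z: "z \<in> X" "z \<noteq> b" for z
  proof -
    have "(z - a) / (z - b) \<notin> \<real>\<^sub>\<le>\<^sub>0 \<or> (z - a) / (z - b) = 0"
    proof (cases "z = a")
      case False
      have "(z - a) / (z - b) = inverse ((z - b) / (z - a))" by simp
      then show ?thesis using ratio[OF z(1) False z(2)]
        by (metis inverse_inverse_eq nonpos_Reals_inverse_I)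
    qed simp
    then have "isCont csqrt ((z - a) / (z - b))" by (rule cs)
    moreover have "isCont (\<lambda>z. (z - a) / (z - b)) z" using that by (intro continuous_intros) auto
    ultimately show ?thesis unfolding q_def by (rule isCont_o2[rotated])
  qed
  have cont: "continuous_on X f"
  proof (rule continuous_on_eq_continuous_within[THEN iffD2], rule ballI)
    fix z assume z: "z \<in> X"
    show "continuous (at z within X) f"
    proof (cases "z = a")
      case False
      have c: "continuous (at z within X) (\<lambda>z. (1 + \<i> * r z) / (1 - \<i> * r z))"
      proof -
        have "isCont (\<lambda>w. (1 + \<i> * w) / (1 - \<i> * w)) (r z)"
          using den[OF z False] by (intro continuous_intros) auto
        from isCont_o2[OF rcont[OF z False] this] show ?thesis
          by (rule continuous_at_imp_continuous_at_within)
      qed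
      have "\<forall>\<^sub>F w in at z within X. w \<noteq> a"
        by (rule eventually_neq_at_within)
      then have "\<forall>\<^sub>F w in at z within X. (1 + \<i> * r w) / (1 - \<i> * r w) = f w"
        by eventually_elim (simp add: f_def)
      moreover have "f z = (1 + \<i> * r z) / (1 - \<i> * r z)" using False by (simp add: f_def)
      ultimately show ?thesis using c unfolding continuous_within
        by (simp add: Lim_transform_eventually)
    next
      case True
      then have zb: "z \<noteq> b" using ab by auto
      have c: "continuous (at z within X) (\<lambda>z. (q z + \<i>) / (q z - \<i>))"
      proof -
        have "isCont (\<lambda>w. (w + \<i>) / (w - \<i>)) (q z)"
          using qden[OF z zb] by (intro continuous_intros) auto
        from isCont_o2[OF qcont[OF z zb] this] show ?thesis
          by (rule continuous_at_imp_continuous_at_within)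
      qed
      have "\<forall>\<^sub>F w in at z within X. w \<in> X" by (simp add: eventually_at_filter)
      with eventually_neq_at_within have "\<forall>\<^sub>F w in at z within X. w \<noteq> b \<and> w \<in> X"
        by (rule eventually_conj)
      then have "\<forall>\<^sub>F w in at z within X. (q w + \<i>) / (q w - \<i>) = f w"
        by eventually_elim (simp add: fq)
      moreover have "f z = (q z + \<i>) / (q z - \<i>)" using fq z zb by simp
      ultimately show ?thesis using c unfolding continuous_within
        by (simp add: Lim_transform_eventually)
    qed
  qed
  have Imf: "Im (f z) > 0" if z: "z \<in> X" "z \<noteq> a" "z \<noteq> b" for z
  proof -
    have "Im (f z) = 2 * Re (r z) / (cmod (1 - \<i> * r z))\<^sup>2"
      using z by (simp add: f_def Im_divide cmod_power2 field_simps)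
    then show ?thesis using rneg[OF z] den[OF z(1,2)] by simp
  qed
  have fa: "f a = -1" "f b = 1" using ab rb by (auto simp: f_def)
  have inj: "inj_on f X"
  proof (rule inj_onI)
    fix z w assume zw: "z \<in> X" "w \<in> X" "f z = f w"
    have fne: "f z \<noteq> -1" if "z \<in> X" "z \<noteq> a" for z
      using Imf[of z] fa that by (cases "z = b") auto
    show "z = w"
    proof (cases "z = a \<or> w = a")
      case True
      then show ?thesis using zw fne fa by metis
    next
      case False
      then have "(1 + \<i> * r z) * (1 - \<i> * r w) = (1 + \<i> * r w) * (1 - \<i> * r z)"
        using zw den by (simp add: f_def frac_eq_eq)
      then have "r z = r w" by (simp add: algebra_simps)
      then have "r z ^ 2 = r w ^ 2" by simp
      then have "(z - b) / (z - a) = (w - b) / (w - a)" by (simp add: r_def)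
      then have "(z - b) * (w - a) = (w - b) * (z - a)" using False by (simp add: frac_eq_eq)
      then have "(z - w) * (b - a) = 0" by (simp add: algebra_simps)
      then show ?thesis using ab by simp
    qed
  qed
  show ?thesis using cont inj fa Imf by blast
qed

subsection \<open>Drawings of multigraphs\<close>

text \<open>The ends of an edge are given by the functions \<open>a\<close> and \<open>b\<close>, so
  that a graph can be cut, relabelled and reassembled while its edges keep their names and their
  arcs. Arcs are kept as point sets, without a direction.\<close>

definition drawing ::
  "'v set \<Rightarrow> 'e set \<Rightarrow> ('e \<Rightarrow> 'v) \<Rightarrow> ('e \<Rightarrow> 'v) \<Rightarrow> ('v \<Rightarrow> complex) \<Rightarrow> ('e \<Rightarrow> complex set) \<Rightarrow> bool" where
  "drawing V E a b p G \<longleftrightarrow> inj_on p V \<and>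
     (\<forall>e\<in>E. a e \<in> V \<and> b e \<in> V \<and> arcset (G e) (p (a e)) (p (b e)) \<and>
        (\<forall>l\<in>V. p l \<in> G e \<longrightarrow> l = a e \<or> l = b e)) \<and>
     (\<forall>e\<in>E. \<forall>e'\<in>E. e \<noteq> e' \<longrightarrow> G e \<inter> G e' \<subseteq> p ` ({a e, b e} \<inter> {a e', b e'}))"

definition drawn :: "'v set \<Rightarrow> 'e set \<Rightarrow> ('v \<Rightarrow> complex) \<Rightarrow> ('e \<Rightarrow> complex set) \<Rightarrow> complex set" where
  "drawn V E p G = p ` V \<union> (\<Union>e\<in>E. G e)"

lemma drawingI:
  assumes "inj_on p V"
    and "\<And>e. e \<in> E \<Longrightarrow> a e \<in> V" "\<And>e. e \<in> E \<Longrightarrow> b e \<in> V"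
    and "\<And>e. e \<in> E \<Longrightarrow> arcset (G e) (p (a e)) (p (b e))"
    and "\<And>e l. e \<in> E \<Longrightarrow> l \<in> V \<Longrightarrow> p l \<in> G e \<Longrightarrow> l = a e \<or> l = b e"
    and "\<And>e e' z. e \<in> E \<Longrightarrow> e' \<in> E \<Longrightarrow> e \<noteq> e' \<Longrightarrow> z \<in> G e \<Longrightarrow> z \<in> G e' \<Longrightarrow> z \<in> p ` ({a e, b e} \<inter> {a e', b e'})"
  shows "drawing V E a b p G"
  unfolding drawing_def using assms by (intro conjI ballI impI subsetI) (auto 0 0)

lemma drawingD:
  assumes "drawing V E a b p G"
  shows "inj_on p V"
    and "\<And>e. e \<in> E \<Longrightarrow> a e \<in> V" and "\<And>e. e \<in> E \<Longrightarrow> b e \<in> V"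
    and "\<And>e. e \<in> E \<Longrightarrow> arcset (G e) (p (a e)) (p (b e))"
    and "\<And>e l. e \<in> E \<Longrightarrow> l \<in> V \<Longrightarrow> p l \<in> G e \<Longrightarrow> l = a e \<or> l = b e"
    and "\<And>e e' z. e \<in> E \<Longrightarrow> e' \<in> E \<Longrightarrow> e \<noteq> e' \<Longrightarrow> z \<in> G e \<Longrightarrow> z \<in> G e' \<Longrightarrow> z \<in> p ` ({a e, b e} \<inter> {a e', b e'})"
  using assms unfolding drawing_def by (blast+)

lemma drawing_compact:
  assumes "drawing V E a b p G" "finite V" "finite E"
  shows "compact (drawn V E p G)"
proof -
  have "compact (\<Union>e\<in>E. G e)"
    using assms(3) drawingD(4)[OF assms(1)] arcset_compact by (intro compact_UN) blast+
  moreover have "compact (p ` V)" using assms(2) by (intro finite_imp_compact finite_imageI)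
  ultimately show ?thesis unfolding drawn_def by (rule compact_Un[rotated])
qed

lemma drawing_map:
  assumes d: "drawing V E a b p G" and f: "continuous_on (drawn V E p G) f" "inj_on f (drawn V E p G)"
  shows "drawing V E a b (f \<circ> p) (\<lambda>e. f ` G e)"
proof (rule drawingI)
  note D = drawingD[OF d]
  have sub: "p ` V \<subseteq> drawn V E p G" "\<And>e. e \<in> E \<Longrightarrow> G e \<subseteq> drawn V E p G"
    unfolding drawn_def by auto
  show "inj_on (f \<circ> p) V" using D(1) f sub by (meson comp_inj_on inj_on_subset)
  fix e assume e: "e \<in> E"
  show "a e \<in> V" "b e \<in> V" using D e by auto
  show "arcset (f ` G e) ((f \<circ> p) (a e)) ((f \<circ> p) (b e))"
    using arcset_image[OF D(4)[OF e]] f sub(2)[OF e] by (metis comp_apply continuous_on_subset inj_on_subset)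
  show "l = a e \<or> l = b e" if "l \<in> V" "(f \<circ> p) l \<in> f ` G e" for l
  proof -
    have "p l \<in> drawn V E p G" using sub that by auto
    then have "p l \<in> G e" using that(2) inj_on_image_mem_iff[OF f(2) _ sub(2)[OF e]] by simp
    then show ?thesis using D(5) e that by blast
  qed
  fix e' z assume e': "e' \<in> E" "e \<noteq> e'" "z \<in> f ` G e" "z \<in> f ` G e'"
  then obtain w w' where w: "w \<in> G e" "w' \<in> G e'" "z = f w" "z = f w'" by auto
  then have "w = w'" using f(2) sub(2)[OF e] sub(2)[OF e'(1)] by (metis inj_onD subsetD)
  then have "w \<in> p ` ({a e, b e} \<inter> {a e', b e'})" using D(6)[OF e e'(1,2)] w by blast
  then show "z \<in> (f \<circ> p) ` ({a e, b e} \<inter> {a e', b e'})" using w(3) by (metis image_comp image_eqI)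
qed

lemma drawn_map: "drawn V E (f \<circ> p) (\<lambda>e. f ` G e) = f ` drawn V E p G"
  unfolding drawn_def by (auto simp: image_Un image_UN image_comp)

lemma drawing_reindex:
  assumes d: "drawing V E a b p G" and "inj_on r E'" "r ` E' \<subseteq> E"
    and ends: "\<And>e. e \<in> E' \<Longrightarrow> {a (r e), b (r e)} = {a' e, b' e}"
  shows "drawing V E' a' b' p (\<lambda>e. G (r e))"
proof (rule drawingI)
  note D = drawingD[OF d]
  show "inj_on p V" using D by blast
  fix e assume e: "e \<in> E'"
  then have re: "r e \<in> E" using assms by auto
  have en: "a (r e) = a' e \<and> b (r e) = b' e \<or> a (r e) = b' e \<and> b (r e) = a' e"
    using ends[OF e] by (simp add: doubleton_eq_iff)
  show "a' e \<in> V" "b' e \<in> V" using en D(2,3)[OF re] by auto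
  show "arcset (G (r e)) (p (a' e)) (p (b' e))" using en D(4)[OF re] arcset_sym by metis
  show "l = a' e \<or> l = b' e" if "l \<in> V" "p l \<in> G (r e)" for l
    using D(5)[OF re that] en by auto
  fix e' z assume e': "e' \<in> E'" "e \<noteq> e'" "z \<in> G (r e)" "z \<in> G (r e')"
  then have "r e \<noteq> r e'" "r e' \<in> E" using assms e by (auto dest: inj_onD)
  then show "z \<in> p ` ({a' e, b' e} \<inter> {a' e', b' e'})"
    using D(6)[OF re] e' ends e by metis
qed

text \<open>Meant for the transposition of two separating vertices: the picture is untouched, and
  exchanging the names of two points turns one side of the graph around.\<close>

lemma drawing_relabel:
  assumes d: "drawing V E a b p G" and s: "\<And>x. s (s x) = x" "\<And>x. x \<in> V \<Longrightarrow> s x \<in> V"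
  shows "drawing V E (\<lambda>e. s (a e)) (\<lambda>e. s (b e)) (\<lambda>x. p (s x)) G"
proof (rule drawingI)
  note D = drawingD[OF d]
  show "inj_on (\<lambda>x. p (s x)) V"
  proof (rule inj_onI)
    fix x y assume "x \<in> V" "y \<in> V" "p (s x) = p (s y)"
    then have "s x = s y" using D(1) s(2) by (meson inj_onD)
    then show "x = y" using s(1) by metis
  qed
  fix e assume e: "e \<in> E"
  show "s (a e) \<in> V" "s (b e) \<in> V" using D e s by auto
  show "arcset (G e) (p (s (s (a e)))) (p (s (s (b e))))" using D e s by simp
  show "l = s (a e) \<or> l = s (b e)" if "l \<in> V" "p (s l) \<in> G e" for l
    using D(5)[OF e s(2)[OF that(1)] that(2)] s by metis
  fix e' z assume "e' \<in> E" "e \<noteq> e'" "z \<in> G e" "z \<in> G e'"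
  then obtain x where "z = p x" "x \<in> {a e, b e} \<inter> {a e', b e'}" using D(6)[OF e] by blast
  then show "z \<in> (\<lambda>x. p (s x)) ` ({s (a e), s (b e)} \<inter> {s (a e'), s (b e')})"
    using s(1) by (intro image_eqI[of _ _ "s x"]) auto
qed

lemma drawing_subgraph:
  assumes d: "drawing V E a b p G" and "V' \<subseteq> V" "E' \<subseteq> E" "\<And>e. e \<in> E' \<Longrightarrow> a e \<in> V' \<and> b e \<in> V'"
  shows "drawing V' E' a b p G"
proof (rule drawingI)
  note D = drawingD[OF d]
  show "inj_on p V'" using D(1) assms(2) inj_on_subset by blast
  show "a e \<in> V'" "b e \<in> V'" "arcset (G e) (p (a e)) (p (b e))" if "e \<in> E'" for e
    using D(4) assms(3,4) that by auto
  show "l = a e \<or> l = b e" if "e \<in> E'" "l \<in> V'" "p l \<in> G e" for e l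
    using D(5) assms(2,3) that by blast
  show "z \<in> p ` ({a e, b e} \<inter> {a e', b e'})"
    if "e \<in> E'" "e' \<in> E'" "e \<noteq> e'" "z \<in> G e" "z \<in> G e'" for e e' z
    using D(6)[of e e' z] assms(3) that by blast
qed

lemma drawing_add_edge:
  assumes d: "drawing V E a b p G" and S: "arcset S (p u) (p v)" "S \<inter> drawn V E p G = {p u, p v}"
    and e0: "e0 \<notin> E" "{a e0, b e0} = {u, v}" and uv: "u \<in> V" "v \<in> V"
  shows "drawing V (insert e0 E) a b p (G(e0 := S))"
proof (rule drawingI)
  note D = drawingD[OF d]
  show inj: "inj_on p V" using D by blast
  have en: "a e0 = u \<and> b e0 = v \<or> a e0 = v \<and> b e0 = u" using e0 by (simp add: doubleton_eq_iff)
  have cross: "z \<in> p ` ({u, v} \<inter> {a e, b e})" if e: "e \<in> E" "z \<in> S" "z \<in> G e" for e z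
  proof -
    have "z \<in> {p u, p v}" using S(2) that by (auto simp: drawn_def)
    then obtain x where x: "x \<in> {u, v}" "z = p x" by auto
    then have "x = a e \<or> x = b e" using D(5)[OF e(1), of x] e(3) uv by blast
    then show ?thesis using x by blast
  qed
  fix e assume e: "e \<in> insert e0 E"
  show "a e \<in> V" "b e \<in> V" using D e en uv by auto
  show "arcset ((G(e0 := S)) e) (p (a e)) (p (b e))" using D(4) e en S arcset_sym by auto
  show "l = a e \<or> l = b e" if "l \<in> V" "p l \<in> (G(e0 := S)) e" for l
  proof (cases "e = e0")
    case True
    then have "p l \<in> S" "p l \<in> drawn V E p G" using that by (auto simp: drawn_def)
    then have "p l = p u \<or> p l = p v" using S(2) by auto
    then show ?thesis using inj that(1) uv en True by (auto dest: inj_onD)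
  next
    case False
    then show ?thesis using D(5) e that by auto
  qed
  fix e' z assume e': "e' \<in> insert e0 E" "e \<noteq> e'" "z \<in> (G(e0 := S)) e" "z \<in> (G(e0 := S)) e'"
  consider "e = e0" "e' \<in> E" "e' \<noteq> e0" | "e' = e0" "e \<in> E" "e \<noteq> e0" | "e \<in> E" "e' \<in> E" "e \<noteq> e0" "e' \<noteq> e0"
    using e e' by auto
  then show "z \<in> p ` ({a e, b e} \<inter> {a e', b e'})"
  proof cases
    case 1
    then have "z \<in> p ` ({u, v} \<inter> {a e', b e'})" using e' cross by simp
    then show ?thesis using 1(1) e0(2) by simp
  next
    case 2
    then have "z \<in> p ` ({u, v} \<inter> {a e, b e})" using e' cross by simp
    then show ?thesis using 2(1) e0(2) by (simp add: Int_commute)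
  next
    case 3
    then show ?thesis using D(6) e' by simp
  qed
qed

section \<open>Straightening a drawing near a vertex\<close>

lemma segment_dist_end:
  fixes u w z :: complex
  assumes "z \<in> closed_segment u w" "dist u z = dist u w"
  shows "z = w"
proof -
  have "dist u w = dist u z + dist z w" using assms(1) by (metis between between_mem_segment)
  then show ?thesis using assms(2) by simp
qed

lemma segments_common:
  fixes u w w' z :: complex
  assumes "z \<in> closed_segment u w" "z \<in> closed_segment u w'" "dist u w = dist u w'" "z \<noteq> u"
  shows "w = w'"
proof -
  obtain s where s: "0 \<le> s" "z = (1 - s) *\<^sub>R u + s *\<^sub>R w" using assms by (auto simp: closed_segment_def)
  obtain t where t: "0 \<le> t" "z = (1 - t) *\<^sub>R u + t *\<^sub>R w'" using assms by (auto simp: closed_segment_def)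
  have zs: "z - u = s *\<^sub>R (w - u)" using s by (simp add: algebra_simps)
  have zt: "z - u = t *\<^sub>R (w' - u)" using t by (simp add: algebra_simps)
  have "norm (z - u) = s * dist u w" "norm (z - u) = t * dist u w'"
    unfolding dist_norm norm_minus_commute[of u] using arg_cong[OF zs, of norm] arg_cong[OF zt, of norm] s(1) t(1)
    by simp_all
  moreover have "dist u w \<noteq> 0" using zs assms by auto
  ultimately have "s = t" using assms by auto
  moreover have "s \<noteq> 0" using zs assms by auto
  ultimately show ?thesis using zs zt by auto
qed

text \<open>The arc is cut at its last time in the closed disc of radius \<open>r\<close> about
  \<open>u\<close>. The part \<open>T\<close> after that time never comes back, so a straight radius
  can replace everything before.\<close>

lemma arcset_radial:
  assumes A: "arcset A u c" and r: "0 < r" "r < dist u c"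
  shows "\<exists>w T. w \<in> A \<and> dist u w = r \<and> T \<subseteq> A \<and> connected T \<and> w \<in> T \<and> c \<in> T \<and>
    T \<inter> cball u r = {w} \<and> arcset (closed_segment u w \<union> T) u c"
proof -
  obtain g where g: "arc g" "path_image g = A" "pathstart g = u" "pathfinish g = c"
    using A arcset_def by auto
  have gc: "continuous_on {0..1} g" and gi: "inj_on g {0..1}"
    using g(1) by (auto simp: arc_def path_def)
  let ?d = "\<lambda>t. dist u (g t)"
  have dc: "continuous_on {0..1} ?d" by (intro continuous_on_dist continuous_on_const gc)
  define S where "S = {t \<in> {0..1}. ?d t \<le> r}"
  have "compact S" unfolding S_def

  proof -
    have "closed {t \<in> {0..1}. ?d t \<le> r}"
      using continuous_on_closed_Collect_le[OF dc continuous_on_const[of _ r]] by simp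
    then have "compact ({0..1} \<inter> {t \<in> {0..1}. ?d t \<le> r})" by (rule compact_Int_closed[OF compact_Icc])
    moreover have "{0..1} \<inter> {t \<in> {0..1}. ?d t \<le> r} = {t \<in> {0..1}. ?d t \<le> r}" by auto
    ultimately show "compact {t \<in> {0..1}. ?d t \<le> r}" by simp
  qed
  moreover have "0 \<in> S" using g r by (simp add: S_def pathstart_def)
  ultimately obtain t where t: "t \<in> S" "\<And>s. s \<in> S \<Longrightarrow> s \<le> t"
    using compact_attains_sup[of S] by blast
  have g1: "g 1 = c" "g 0 = u" using g by (auto simp: pathfinish_def pathstart_def)
  have t01: "0 \<le> t" "t \<le> 1" "?d t \<le> r" using t by (auto simp: S_def)
  have tlt: "t < 1" using t01 g1 r by (cases "t = 1") auto
  have dt: "?d t = r"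
  proof -
    have "continuous_on {t..1} ?d" using dc t01 by (auto intro: continuous_on_subset)
    then obtain s where "t \<le> s" "s \<le> 1" "?d s = r"
      using IVT'[of ?d t r 1] t01 g1 r by auto
    then show ?thesis using t(2)[of s] t01 by (simp add: S_def)
  qed
  define w where "w = g t"
  define T where "T = path_image (subpath t 1 g)"
  have Tim: "T = g ` {t..1}" unfolding T_def using t01 by (simp add: path_image_subpath)
  have wA: "w \<in> A" using g(2) t01 by (auto simp: w_def path_image_def)
  have TA: "T \<subseteq> A" using g(2) t01 by (auto simp: Tim path_image_def)
  have arcT: "arc (subpath t 1 g)" using arc_subpath_arc[OF g(1)] t01 tlt by simp
  have "connected T" unfolding T_def using arcT arc_imp_path connected_path_image by blast
  have wT: "w \<in> T" "c \<in> T" using t01 g1 by (auto simp: Tim w_def)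
  have Tcb: "T \<inter> cball u r = {w}"
  proof -
    have "g s = w" if "s \<in> {t..1}" "?d s \<le> r" for s
    proof -
      have "s \<in> S" using that t01 by (auto simp: S_def)
      then show ?thesis using t(2)[of s] that by (simp add: w_def)
    qed
    moreover have "w \<in> cball u r" using dt by (simp add: w_def)
    moreover have "T \<inter> cball u r \<subseteq> {w}"
    proof
      fix z assume z: "z \<in> T \<inter> cball u r"
      then obtain s where s: "s \<in> {t..1}" "z = g s" by (auto simp: Tim)
      then show "z \<in> {w}" using calculation(1)[of s] z by simp
    qed
    ultimately show ?thesis using wT(1) by blast
  qed
  have uw: "u \<noteq> w" using dt r by (auto simp: w_def)
  have seg: "closed_segment u w \<subseteq> cball u r"
    using dt r by (intro closed_segment_subset) (auto simp: w_def)
  have "arc (linepath u w +++ subpath t 1 g)"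
    using uw arcT Tcb seg by (intro arc_join) (auto simp: w_def T_def)
  moreover have "path_image (linepath u w +++ subpath t 1 g) = closed_segment u w \<union> T"
    unfolding T_def by (subst path_image_join) (auto simp: w_def)
  ultimately have "arcset (closed_segment u w \<union> T) u c"
    unfolding arcset_def using g1 by (intro exI[of _ "linepath u w +++ subpath t 1 g"]) simp
  then show ?thesis using wA dt TA \<open>connected T\<close> wT Tcb by (metis w_def)
qed

lemma arcset_split:
  assumes "arcset L x y"
  shows "\<exists>c A B. A \<subseteq> L \<and> B \<subseteq> L \<and> arcset A x c \<and> arcset B y c \<and> A \<inter> B = {c}"
proof -
  obtain g where g: "arc g" "path_image g = L" "pathstart g = x" "pathfinish g = y"
    using assms arcset_def by auto
  have gi: "inj_on g {0..1}" using g(1) by (auto simp: arc_def)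
  have g1: "g 1 = y" "g 0 = x" using g by (auto simp: pathfinish_def pathstart_def)
  let ?A = "path_image (subpath 0 (1/2) g)" and ?B = "path_image (subpath 1 (1/2) g)"
  have im: "?A = g ` {0..1/2}" "?B = g ` {1/2..1}" by (auto simp: path_image_subpath)
  have "arcset ?A x (g (1/2))" unfolding arcset_def
    using arc_subpath_arc[OF g(1), of 0 "1/2"] g1 by (intro exI[of _ "subpath 0 (1/2) g"]) simp
  moreover have "arcset ?B y (g (1/2))" unfolding arcset_def
    using arc_subpath_arc[OF g(1), of 1 "1/2"] g1 by (intro exI[of _ "subpath 1 (1/2) g"]) simp
  moreover have "?A \<inter> ?B = {g (1/2)}"
  proof -
    have "g ` {0..1/2} \<inter> g ` {1/2..1} = g ` ({0..1/2} \<inter> {1/2..1})"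
      using inj_on_image_Int[OF gi, of "{0..1/2}" "{1/2..1}"] by auto
    also have "{0..1/2} \<inter> {1/2..1} = {1/2::real}" by auto
    finally show ?thesis unfolding im by simp
  qed
  moreover have "?A \<subseteq> L" "?B \<subseteq> L" using g(2) unfolding im by (auto simp: path_image_def[of g])
  ultimately show ?thesis by blast
qed

text \<open>In a small disc about \<open>p u\<close> every edge at \<open>u\<close>, and also
  \<open>L\<close>, is replaced by the radius to its last exit point. The radius of \<open>L\<close>
  becomes a straight hair off the drawing, and the rest of \<open>L\<close> still joins it to
  \<open>c\<close>. No new points of the drawing appear on \<open>Z\<close>, so a second use at the
  other end of an arc does not spoil the first.\<close>

lemma drawing_radialize:
  assumes d: "drawing V E a b p G" and fin: "finite V" "finite E" and u: "u \<in> V"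
    and L: "arcset L (p u) c" "L \<inter> drawn V E p G = {p u}" and Z: "closed Z" "p u \<notin> Z"
  shows "\<exists>G' x T. drawing V E a b p G' \<and> x \<noteq> p u \<and> closed_segment x (p u) \<inter> drawn V E p G' = {p u} \<and>
    connected T \<and> x \<in> T \<and> c \<in> T \<and> T \<subseteq> L \<and> T \<inter> drawn V E p G' = {} \<and>
    drawn V E p G' \<inter> Z \<subseteq> drawn V E p G"
proof -
  note D = drawingD[OF d]
  define I where "I = {e \<in> E. a e = u \<or> b e = u}"
  define oth where "oth = (\<lambda>e. if a e = u then b e else a e)"
  \<comment> \<open>Everything that has to stay outside the disc: the edges not at \<open>u\<close>,
    the other vertices, \<open>Z\<close> and the far end of \<open>L\<close>.\<close>
  define K where "K = (\<Union>e\<in>E - I. G e) \<union> p ` (V - {u}) \<union> Z \<union> {c}"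
  have IE: "I \<subseteq> E" by (auto simp: I_def)
  have ends: "{a e, b e} = {u, oth e}" if "e \<in> I" for e using that by (auto simp: I_def oth_def)
  have arcI: "arcset (G e) (p u) (p (oth e))" if "e \<in> I" for e
    using D(4)[of e] that arcset_sym by (auto simp: I_def oth_def)
  have othV: "oth e \<in> V" "oth e \<noteq> u" if "e \<in> I" for e
    using D(2,3)[of e] that arcset_ends[OF arcI[OF that]] by (auto simp: I_def oth_def)
  have "closed K" unfolding K_def
    using fin Z D(4) by (intro closed_Un closed_UN) (auto intro: arcset_compact compact_imp_closed finite_imp_closed)
  moreover have "p u \<notin> K"
  proof -
    have "p u \<notin> G e" if "e \<in> E - I" for e using D(5)[of e u] that u by (auto simp: I_def)
    moreover have "p u \<notin> p ` (V - {u})" using D(1) u by (auto dest: inj_onD)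
    moreover have "p u \<noteq> c" using arcset_ends[OF L(1)] by auto
    ultimately show ?thesis using Z by (auto simp: K_def)
  qed
  ultimately obtain r where r: "r > 0" "cball (p u) r \<inter> K = {}"
    using open_contains_cball[of "- K"] by (metis ComplI disjoint_eq_subset_Compl open_Compl)
  let ?C = "cball (p u) r"
  have far: "r < dist (p u) z" if "z \<in> K" for z
    using r that by (meson disjoint_iff linorder_not_le mem_cball)
  have "\<forall>e\<in>I. \<exists>w T. w \<in> G e \<and> dist (p u) w = r \<and> T \<subseteq> G e \<and> connected T \<and> w \<in> T \<and> p (oth e) \<in> T \<and>
    T \<inter> ?C = {w} \<and> arcset (closed_segment (p u) w \<union> T) (p u) (p (oth e))"
  proof
    fix e assume e: "e \<in> I"
    have "p (oth e) \<in> K" using othV[OF e] by (auto simp: K_def)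
    then show "\<exists>w T. w \<in> G e \<and> dist (p u) w = r \<and> T \<subseteq> G e \<and> connected T \<and> w \<in> T \<and> p (oth e) \<in> T \<and>
    T \<inter> ?C = {w} \<and> arcset (closed_segment (p u) w \<union> T) (p u) (p (oth e))"
      using arcset_radial[OF arcI[OF e] r(1) far] by blast
  qed
  then obtain w T where wT: "\<And>e. e \<in> I \<Longrightarrow> w e \<in> G e \<and> dist (p u) (w e) = r \<and> T e \<subseteq> G e \<and> connected (T e) \<and>
      w e \<in> T e \<and> p (oth e) \<in> T e \<and> T e \<inter> ?C = {w e} \<and>
      arcset (closed_segment (p u) (w e) \<union> T e) (p u) (p (oth e))"
    by metis
  obtain x T0 where x: "x \<in> L" "dist (p u) x = r" "T0 \<subseteq> L" "connected T0" "x \<in> T0" "c \<in> T0" "T0 \<inter> ?C = {x}"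
    using arcset_radial[OF L(1) r(1) far, of] by (auto simp: K_def)
  define G' where "G' = (\<lambda>e. if e \<in> I then closed_segment (p u) (w e) \<union> T e else G e)"
  have segC: "closed_segment (p u) y \<subseteq> ?C" if "dist (p u) y = r" for y
    using that r by (intro closed_segment_subset) auto
  have vfar: "p l \<notin> ?C" if "l \<in> V" "l \<noteq> u" for l using far[of "p l"] that by (auto simp: K_def)
  have Gfar: "G e \<inter> ?C = {}" if "e \<in> E" "e \<notin> I" for e using r(2) that by (auto simp: K_def)
  have pu: "p u \<in> ?C" using r by simp
  have pne: "y \<notin> p ` V" if "dist (p u) y = r" for y
  proof
    assume "y \<in> p ` V"
    then obtain l where "l \<in> V" "y = p l" by auto
    then show False using vfar[of l] that r by (cases "l = u") auto
  qed
  have inI: "e \<in> I" if "e \<in> E" "z \<in> G' e" "z \<in> ?C" for e z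
  proof (rule ccontr)
    assume n: "e \<notin> I"
    then have "z \<in> G e" using that by (simp add: G'_def)
    then show False using Gfar[OF that(1) n] that(3) by blast
  qed
  have G'sub: "z \<in> G e \<or> (e \<in> I \<and> z \<in> closed_segment (p u) (w e))" if "e \<in> E" "z \<in> G' e" for e z
    using that wT[of e] by (auto simp: G'_def split: if_splits)
  \<comment> \<open>Distinct edges share only vertices, and no vertex lies on the circle.\<close>
  have wne: "w e \<noteq> w e'" if "e \<in> I" "e' \<in> I" "e \<noteq> e'" for e e'
  proof
    assume "w e = w e'"
    then have "w e \<in> G e" "w e \<in> G e'" using wT that by metis+
    then have "w e \<in> p ` V" using D(6)[of e e' "w e"] D(2,3)[of e] that IE by blast
    then show False using pne wT that by blast
  qed
  have Tseg: "z = w e" if "e \<in> I" "z \<in> T e" "z \<in> ?C" for e z using wT that by blast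
  have dr: "drawing V E a b p G'"
  proof (rule drawingI)
    show "inj_on p V" by (rule D)
    fix e assume e: "e \<in> E"
    show "a e \<in> V" "b e \<in> V" using D e by auto
    show "arcset (G' e) (p (a e)) (p (b e))"
    proof (cases "e \<in> I")
      case True
      then have "arcset (G' e) (p u) (p (oth e))" using wT by (simp add: G'_def)
      then show ?thesis using ends[OF True] arcset_sym by (metis doubleton_eq_iff)
    qed (use D e in \<open>simp add: G'_def\<close>)
    show "l = a e \<or> l = b e" if l: "l \<in> V" "p l \<in> G' e" for l
    proof (cases "p l \<in> G e")
      case True
      then show ?thesis using D e l by blast
    next
      case False
      then have "e \<in> I" "p l \<in> closed_segment (p u) (w e)" using G'sub[OF e l(2)] by auto
      then have "p l \<in> ?C" using segC wT by blast
      then have "l = u" using vfar l by blast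
      then show ?thesis using \<open>e \<in> I\<close> by (auto simp: I_def)
    qed
    fix e' z assume e': "e' \<in> E" "e \<noteq> e'" "z \<in> G' e" "z \<in> G' e'"
    show "z \<in> p ` ({a e, b e} \<inter> {a e', b e'})"
    proof (cases "z \<in> G e \<and> z \<in> G e'")
      case True
      then show ?thesis using D(6)[OF e e'(1,2)] by blast
    next
      case False
      have "z = p u \<and> e \<in> I \<and> e' \<in> I"
      proof -
        have zC: "z \<in> ?C" using False G'sub[OF e e'(3)] G'sub[OF e'(1) e'(4)] segC wT by blast
        have eI: "e \<in> I" "e' \<in> I" using inI[OF _ _ zC] e e' by blast+
        have ww: "z \<in> closed_segment (p u) (w e)" "z \<in> closed_segment (p u) (w e')"
          using e'(3,4) eI Tseg[OF _ _ zC] by (auto simp: G'_def)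
        then show ?thesis using segments_common[OF ww] wT eI wne e'(2) by metis
      qed
      then show ?thesis by (auto simp: I_def)
    qed
  qed
  have drawnsub: "z \<in> drawn V E p G \<or> (\<exists>e\<in>I. z \<in> closed_segment (p u) (w e))" if zd: "z \<in> drawn V E p G'" for z
  proof (cases "z \<in> p ` V")
    case False
    then obtain e where "e \<in> E" "z \<in> G' e" using zd by (auto simp: drawn_def)
    then show ?thesis using G'sub[of e z] by (auto simp: drawn_def)
  qed (simp add: drawn_def)
  have xu: "x \<noteq> p u" using x r by auto
  have xdr: "x \<notin> drawn V E p G" using L(2) x xu by blast
  have hair: "z = p u" if z: "z \<in> closed_segment x (p u)" "z \<in> drawn V E p G'" for z
  proof (rule ccontr)
    assume zu: "z \<noteq> p u"
    have zx: "z \<in> closed_segment (p u) x" using z(1) by (simp add: closed_segment_commute)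
    then have zC: "z \<in> ?C" using segC x by blast
    have "z \<notin> p ` V" using vfar zC zu by auto
    then obtain e where e: "e \<in> E" "z \<in> G' e" using z(2) by (auto simp: drawn_def)
    have eI: "e \<in> I" using inI[OF e zC] .
    then have "z \<in> closed_segment (p u) (w e)" using e Tseg[OF eI _ zC] by (auto simp: G'_def)
    then have "x = w e" using segments_common[OF zx] x wT[OF eI] zu by metis
    then have "x \<in> drawn V E p G" using wT[OF eI] eI IE by (auto simp: drawn_def)
    then show False using xdr by blast
  qed
  have "p u \<in> drawn V E p G'" using u by (auto simp: drawn_def)
  then have h: "closed_segment x (p u) \<inter> drawn V E p G' = {p u}" using hair by auto
  have T0: "T0 \<inter> drawn V E p G' = {}"
  proof (rule ccontr)
    assume "T0 \<inter> drawn V E p G' \<noteq> {}"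
    then obtain z where z: "z \<in> T0" "z \<in> drawn V E p G'" by auto
    have "z \<noteq> p u"
    proof
      assume "z = p u"
      then have "z \<in> T0 \<inter> ?C" using z(1) pu by blast
      then show False using x(7) xu \<open>z = p u\<close> by simp
    qed
    then have "z \<notin> drawn V E p G" using z(1) x(3) L(2) by blast
    then obtain e where e: "e \<in> I" "z \<in> closed_segment (p u) (w e)" using drawnsub[OF z(2)] by auto
    then have "z \<in> ?C" using segC wT by blast
    then have "z = x" using x z by blast
    then have "z = w e" using segment_dist_end[OF e(2)] wT[OF e(1)] x by simp
    then show False using \<open>z \<notin> drawn V E p G\<close> wT[OF e(1)] e(1) IE by (auto simp: drawn_def)
  qed
  have "drawn V E p G' \<inter> Z \<subseteq> drawn V E p G"
  proof
    fix z assume z: "z \<in> drawn V E p G' \<inter> Z"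
    then have "z \<notin> ?C" using r(2) by (auto simp: K_def)
    then show "z \<in> drawn V E p G" using drawnsub[of z] z segC wT by blast
  qed
  then show ?thesis using dr xu h x T0 by blast
qed

text \<open>The arc \<open>L\<close> shows that \<open>u\<close> and \<open>v\<close> lie on a
  common face. Its two halves yield straight hairs at both vertices; the hairs are joined by a
  polygonal arc off the drawing, which is contracted to a segment and opened to a half
  plane.\<close>

lemma drawing_normal_form:
  assumes d: "drawing V E a b p G" and fin: "finite V" "finite E" and u: "u \<in> V" "v \<in> V" "u \<noteq> v"
    and L: "arcset L (p u) (p v)" "L \<inter> drawn V E p G = {p u, p v}"
  shows "\<exists>p' G'. drawing V E a b p' G' \<and> p' u = -1 \<and> p' v = 1 \<and>
    (\<forall>z\<in>drawn V E p' G'. z = -1 \<or> z = 1 \<or> Im z > 0)"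
proof -
  obtain c A B where AB: "A \<subseteq> L" "B \<subseteq> L" "arcset A (p u) c" "arcset B (p v) c" "A \<inter> B = {c}"
    using arcset_split[OF L(1)] by metis
  have ne: "p u \<noteq> p v" using arcset_ends[OF L(1)] by auto
  have e: "p u \<in> A" "p v \<in> B" "c \<in> A" "c \<in> B" "p u \<noteq> c" "p v \<noteq> c"
    using arcset_ends[OF AB(3)] arcset_ends[OF AB(4)] by auto
  have nB: "p u \<notin> B" "p v \<notin> A" using e AB(5) by auto
  have mem: "p u \<in> drawn V E p H" "p v \<in> drawn V E p H" for H
    using u by (auto simp: drawn_def)
  have "A \<inter> drawn V E p G \<subseteq> {p u, p v}" using AB(1) L(2) by auto
  then have A1: "A \<inter> drawn V E p G = {p u}" using nB(2) e(1) mem(1)[of G] by auto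
  have "B \<inter> drawn V E p G \<subseteq> {p u, p v}" using AB(2) L(2) by auto
  then have B1: "B \<inter> drawn V E p G = {p v}" using nB(1) e(2) mem(2)[of G] by auto
  have cl: "closed A" "closed B" using AB arcset_compact compact_imp_closed by blast+
  obtain G1 x1 T1 where g1: "drawing V E a b p G1" "x1 \<noteq> p u"
      "closed_segment x1 (p u) \<inter> drawn V E p G1 = {p u}" "connected T1" "x1 \<in> T1" "c \<in> T1" "T1 \<subseteq> A"
      "T1 \<inter> drawn V E p G1 = {}" "drawn V E p G1 \<inter> B \<subseteq> drawn V E p G"
    using drawing_radialize[OF d fin u(1) AB(3) A1 cl(2) nB(1)] by metis
  have B2: "B \<inter> drawn V E p G1 = {p v}" using g1(9) B1 mem e by blast
  \<comment> \<open>Protects the hair at \<open>p u\<close> and the first half of \<open>L\<close>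
    while the drawing is changed near \<open>p v\<close>.\<close>
  let ?Z = "closed_segment x1 (p u) \<union> A"
  have Z: "closed ?Z" using cl by auto
  have vZ: "p v \<notin> ?Z"
  proof
    assume "p v \<in> ?Z"
    then have "p v \<in> closed_segment x1 (p u) \<inter> drawn V E p G1" using nB(2) mem(2)[of G1] by blast
    then show False using g1(3) ne by simp
  qed
  obtain G2 x2 T2 where g2: "drawing V E a b p G2" "x2 \<noteq> p v"
      "closed_segment x2 (p v) \<inter> drawn V E p G2 = {p v}" "connected T2" "x2 \<in> T2" "c \<in> T2" "T2 \<subseteq> B"
      "T2 \<inter> drawn V E p G2 = {}" "drawn V E p G2 \<inter> ?Z \<subseteq> drawn V E p G1"
    using drawing_radialize[OF g1(1) fin u(2) AB(4) B2 Z vZ] by metis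
  let ?X = "drawn V E p G2"
  have h1: "closed_segment x1 (p u) \<inter> ?X = {p u}" using g2(9) g1(3) mem[of G2] by auto
  have T1: "T1 \<inter> ?X = {}" using g2(9) g1(7,8) by blast
  have T: "connected (T1 \<union> T2)" using g1 g2 by (intro connected_Un) auto
  have TX: "(T1 \<union> T2) \<inter> ?X = {}" using T1 g2(8) by auto
  have cX: "closed ?X" using drawing_compact[OF g2(1) fin] compact_imp_closed by blast
  obtain P where P: "polyarc (p u) (p v) P" "P \<inter> ?X = {p u, p v}"
    using polyarc_hairs[OF cX g1(2) h1 g2(2,3) ne T TX] g1(5) g2(5) by blast
  have "?X \<inter> P = {p v, p u}" using P(2) by auto
  from polyarc_straighten[OF P(1) this]
  obtain k :: "complex \<Rightarrow> complex" where k: "continuous_on UNIV k" "inj_on k ?X"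
      "k ` ?X \<inter> closed_segment (k (p v)) (k (p u)) = {k (p v), k (p u)}" by metis
  have kne: "k (p u) \<noteq> k (p v)" using k(2) ne mem by (metis inj_onD)
  have "k ` ?X \<inter> closed_segment (k (p u)) (k (p v)) = {k (p u), k (p v)}"
    using k(3) by (simp add: closed_segment_commute insert_commute)
  from slit_map[OF kne this]
  obtain f where f: "continuous_on (k ` ?X) f" "inj_on f (k ` ?X)" "f (k (p u)) = -1" "f (k (p v)) = 1"
      "\<forall>z\<in>k ` ?X. z \<noteq> k (p u) \<and> z \<noteq> k (p v) \<longrightarrow> Im (f z) > 0" by metis
  have "continuous_on ?X (f \<circ> k)" using f(1) k(1) continuous_on_compose continuous_on_subset by blast
  moreover have "inj_on (f \<circ> k) ?X" using f(2) k(2) comp_inj_on by blast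
  ultimately have "drawing V E a b ((f \<circ> k) \<circ> p) (\<lambda>e. (f \<circ> k) ` G2 e)" by (rule drawing_map[OF g2(1)])
  moreover have "\<forall>z\<in>drawn V E ((f \<circ> k) \<circ> p) (\<lambda>e. (f \<circ> k) ` G2 e). z = -1 \<or> z = 1 \<or> Im z > 0"
  proof
    fix z assume "z \<in> drawn V E ((f \<circ> k) \<circ> p) (\<lambda>e. (f \<circ> k) ` G2 e)"
    then obtain y where y: "y \<in> k ` ?X" "z = f y" unfolding drawn_map by auto
    then show "z = -1 \<or> z = 1 \<or> Im z > 0" using f(3-5) by metis
  qed
  ultimately show ?thesis using f(3,4) by (intro exI[of _ "(f \<circ> k) \<circ> p"] exI[of _ "\<lambda>e. (f \<circ> k) ` G2 e"]) simp
qed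

text \<open>The second drawing is reflected into the lower half plane, so the two meet only in -1
  and 1. The segment between these points is free and will carry the additional edge.\<close>

lemma drawing_union:
  assumes d1: "drawing V1 E1 a b p1 G1" and d2: "drawing V2 E2 a b p2 G2"
    and V: "V1 \<inter> V2 = {u, v}" and E: "E1 \<inter> E2 = {}"
    and uv: "p1 u = -1" "p1 v = 1" "p2 u = -1" "p2 v = 1"
    and up: "\<forall>z\<in>drawn V1 E1 p1 G1. z = -1 \<or> z = 1 \<or> Im z > 0"
      "\<forall>z\<in>drawn V2 E2 p2 G2. z = -1 \<or> z = 1 \<or> Im z > 0"
  shows "\<exists>p G. drawing (V1 \<union> V2) (E1 \<union> E2) a b p G \<and> p u = -1 \<and> p v = 1 \<and>
    closed_segment (-1) 1 \<inter> drawn (V1 \<union> V2) (E1 \<union> E2) p G = {-1, 1}"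
proof -
  note D1 = drawingD[OF d1]
  define q where "q = cnj \<circ> p2"
  define H where "H = (\<lambda>e. cnj ` G2 e)"
  have injc: "inj_on cnj S" for S by (auto intro: inj_onI)
  have d2': "drawing V2 E2 a b q H" unfolding q_def H_def
    by (rule drawing_map[OF d2]) (auto intro: continuous_intros injc)
  note D2 = drawingD[OF d2']
  have low: "z = -1 \<or> z = 1 \<or> Im z < 0" if zd: "z \<in> drawn V2 E2 q H" for z
  proof -
    obtain w where "w \<in> drawn V2 E2 p2 G2" "z = cnj w"
      using zd unfolding q_def H_def drawn_map by auto
    then show ?thesis using up(2) by fastforce
  qed
  have uq: "q u = -1" "q v = 1" using uv by (auto simp: q_def)
  have mem: "u \<in> V1" "v \<in> V1" "u \<in> V2" "v \<in> V2" using V by auto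
  define p where "p = (\<lambda>x. if x \<in> V1 then p1 x else q x)"
  define G where "G = (\<lambda>e. if e \<in> E1 then G1 e else H e)"
  have p1: "p x = p1 x" if "x \<in> V1" for x using that by (simp add: p_def)
  have p2: "p x = q x" if "x \<in> V2" for x
  proof (cases "x \<in> V1")
    case True
    then have "x = u \<or> x = v" using V that by auto
    then show ?thesis using uv uq True by (auto simp: p_def)
  qed (simp add: p_def)
  have G1': "G e = G1 e" if "e \<in> E1" for e using that by (simp add: G_def)
  have G2': "G e = H e" if "e \<in> E2" for e using that E by (auto simp: G_def)
  have common: "z = -1 \<or> z = 1" if "z \<in> drawn V1 E1 p1 G1" "z \<in> drawn V2 E2 q H" for z
    using up(1) low that by fastforce
  have n11: "(-1::complex) \<noteq> 1" by (simp add: complex_eq_iff)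
  have inj: "inj_on p (V1 \<union> V2)"
  proof (rule inj_onI)
    have cr: "x = y" if x: "x \<in> V1" "y \<in> V2" "p x = p y" for x y
    proof -
      have "p x \<in> drawn V1 E1 p1 G1" using x(1) p1[OF x(1)] by (simp add: drawn_def)
      moreover have "p x \<in> drawn V2 E2 q H" using x(2,3) p2[OF x(2)] by (simp add: drawn_def)
      ultimately have "p x = -1 \<or> p x = 1" using common by blast
      then have "\<exists>w\<in>{u,v}. p x = p1 w \<and> p y = q w" using x uv uq by auto
      then show ?thesis using D1(1) D2(1) x mem p1 p2 by (metis inj_onD insertE singletonD)
    qed
    fix x y assume "x \<in> V1 \<union> V2" "y \<in> V1 \<union> V2" "p x = p y"
    then show "x = y" using cr[of x y] cr[of y x] D1(1) D2(1) p1 p2 by (metis UnE inj_onD)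
  qed
  have ends: "a e \<in> V1 \<and> b e \<in> V1" if "e \<in> E1" for e using D1 that by auto
  have ends2: "a e \<in> V2 \<and> b e \<in> V2" if "e \<in> E2" for e using D2 that by auto
  have vert: "l = a e \<or> l = b e" if l: "l \<in> V1 \<union> V2" and e: "e \<in> E1 \<union> E2" and pl: "p l \<in> G e" for l e
  proof -
    consider "e \<in> E1" "l \<in> V1" | "e \<in> E2" "l \<in> V2" | "e \<in> E1" "l \<in> V2" | "e \<in> E2" "l \<in> V1" using l e by auto
    then show ?thesis
    proof cases
      case 1 then show ?thesis using D1(5) pl p1 G1' by auto
    next
      case 2 then show ?thesis using D2(5) pl p2 G2' by auto
    next
      case 3
      then have "p l \<in> drawn V1 E1 p1 G1" "p l \<in> drawn V2 E2 q H"
        using pl p2 G1' by (auto simp: drawn_def)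
      then have "p l = p u \<or> p l = p v" using common uv p1 mem by metis
      then have "l = u \<or> l = v" using inj l mem by (metis UnI1 inj_onD)
      then show ?thesis using D1(5)[OF 3(1), of l] pl p1 G1' mem 3 by auto
    next
      case 4
      then have "p l \<in> drawn V1 E1 p1 G1" "p l \<in> drawn V2 E2 q H"
        using pl p1 G2' by (auto simp: drawn_def)
      then have "p l = p u \<or> p l = p v" using common uv p1 mem by metis
      then have "l = u \<or> l = v" using inj l mem by (metis UnI1 inj_onD)
      then show ?thesis using D2(5)[OF 4(1), of l] pl p2 G2' mem 4 by auto
    qed
  qed
  have cr: "z \<in> p ` ({a e, b e} \<inter> {a e', b e'})" if e: "e \<in> E1" "e' \<in> E2" "z \<in> G e" "z \<in> G e'" for e e' z
  proof -
    have "z \<in> drawn V1 E1 p1 G1" "z \<in> drawn V2 E2 q H" using e G1' G2' by (auto simp: drawn_def)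
    then have "z = -1 \<or> z = 1" using common by blast
    then obtain w where w: "w \<in> {u, v}" "z = p w" using uv(1,2) p1[OF mem(1)] p1[OF mem(2)] by (metis insertI1 insertI2)
    then have "w = a e \<or> w = b e" "w = a e' \<or> w = b e'" using vert[of w] e mem by blast+
    then show ?thesis using w by blast
  qed
  have dr: "drawing (V1 \<union> V2) (E1 \<union> E2) a b p G"
  proof (rule drawingI)
    show "inj_on p (V1 \<union> V2)" by (rule inj)
    fix e assume e: "e \<in> E1 \<union> E2"
    show "a e \<in> V1 \<union> V2" "b e \<in> V1 \<union> V2" using e ends ends2 by auto
    show "arcset (G e) (p (a e)) (p (b e))"
      using e D1(4)[of e] D2(4)[of e] ends[of e] ends2[of e] p1 p2 G1' G2' by (cases "e \<in> E1") auto
    show "l = a e \<or> l = b e" if "l \<in> V1 \<union> V2" "p l \<in> G e" for l using vert e that by blast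
    fix e' z assume e': "e' \<in> E1 \<union> E2" "e \<noteq> e'" "z \<in> G e" "z \<in> G e'"
    consider "e \<in> E1" "e' \<in> E1" | "e \<in> E2" "e' \<in> E2" | "e \<in> E1" "e' \<in> E2" | "e \<in> E2" "e' \<in> E1" using e e' by auto
    then show "z \<in> p ` ({a e, b e} \<inter> {a e', b e'})"
    proof cases
      case 1
      then have "z \<in> p1 ` ({a e, b e} \<inter> {a e', b e'})" using D1(6) e' G1' by simp
      moreover have "p ` ({a e, b e} \<inter> {a e', b e'}) = p1 ` ({a e, b e} \<inter> {a e', b e'})"
        using ends[OF 1(1)] by (intro image_cong refl p1) auto
      ultimately show ?thesis by simp
    next
      case 2
      then have "z \<in> q ` ({a e, b e} \<inter> {a e', b e'})" using D2(6) e' G2' by simp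
      moreover have "p ` ({a e, b e} \<inter> {a e', b e'}) = q ` ({a e, b e} \<inter> {a e', b e'})"
        using ends2[OF 2(1)] by (intro image_cong refl p2) auto
      ultimately show ?thesis by simp
    next
      case 3 then show ?thesis using cr e' by blast
    next
      case 4 then show ?thesis using cr[OF 4(2,1) e'(4,3)] by (simp add: Int_commute)
    qed
  qed
  have "z = -1 \<or> z = 1" if z: "z \<in> closed_segment (-1) 1" "z \<in> drawn (V1 \<union> V2) (E1 \<union> E2) p G" for z
  proof -
    have "Im z = 0" using z(1) by (auto simp: closed_segment_def)
    moreover have "z \<in> drawn V1 E1 p1 G1 \<or> z \<in> drawn V2 E2 q H"
      using z(2) p1 p2 G1' G2' by (auto simp: drawn_def)
    ultimately show ?thesis using up(1) low by fastforce
  qed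
  moreover have "-1 \<in> drawn (V1 \<union> V2) (E1 \<union> E2) p G" "1 \<in> drawn (V1 \<union> V2) (E1 \<union> E2) p G"
    using p1 uv mem unfolding drawn_def by (metis UnI1 image_eqI)+
  ultimately have "closed_segment (-1) 1 \<inter> drawn (V1 \<union> V2) (E1 \<union> E2) p G = {-1, 1}" by auto
  then show ?thesis using dr p1 uv mem by (intro exI[of _ p] exI[of _ G]) auto
qed

section \<open>The two sides of a 2-separation\<close>

text \<open>Let \<open>R\<close> be the set of vertices in \<open>P\<close> reachable from
  \<open>u\<close>. If \<open>R\<close> is empty, then \<open>v\<close> alone cuts off
  \<open>P\<close>; if \<open>R\<close> is not empty and \<open>v\<close> is unreachable, then
  \<open>u\<close> alone cuts off \<open>R\<close>. Both contradict \<open>nocut\<close>.\<close>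

lemma side_path_component:
  assumes d: "drawing V E a b p G" and E1: "E1 \<subseteq> E"
    and uv: "u \<in> V" "v \<in> V" "u \<noteq> v" and P: "P \<subseteq> V - {u, v}" "P \<noteq> {}"
    and PE: "\<And>e. e \<in> E \<Longrightarrow> a e \<in> P \<or> b e \<in> P \<Longrightarrow> e \<in> E1 \<and> a e \<in> P \<union> {u, v} \<and> b e \<in> P \<union> {u, v}"
    and nocut: "\<And>x S. x \<in> V \<Longrightarrow> S \<subseteq> V - {x} \<Longrightarrow> S \<noteq> {} \<Longrightarrow> S \<noteq> V - {x} \<Longrightarrow>
      \<exists>e\<in>E. (a e \<in> S \<and> b e \<in> V - {x} - S) \<or> (b e \<in> S \<and> a e \<in> V - {x} - S)"
  shows "path_component (drawn (P \<union> {u, v}) E1 p G) (p u) (p v)"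
proof (rule ccontr)
  let ?X = "drawn (P \<union> {u, v}) E1 p G"
  assume no: "\<not> path_component ?X (p u) (p v)"
  define R where "R = {y \<in> P. path_component ?X (p u) (p y)}"
  have edge: "path_component ?X (p (a e)) (p (b e))" "path_component ?X (p (b e)) (p (a e))" if "e \<in> E1" for e
  proof -
    have "arcset (G e) (p (a e)) (p (b e))" using drawingD(4)[OF d] E1 that by blast
    moreover have "G e \<subseteq> ?X" using that by (auto simp: drawn_def)
    ultimately show "path_component ?X (p (a e)) (p (b e))"
      unfolding path_component using arcset_path_connected arcset_ends by blast
    then show "path_component ?X (p (b e)) (p (a e))" by (rule path_component_sym)
  qed
  show False
  proof (cases "R = {}")
    case True
    have "P \<subseteq> V - {v}" "P \<noteq> V - {v}" using P uv by auto
    then obtain e where e: "e \<in> E" "(a e \<in> P \<and> b e \<in> V - {v} - P) \<or> (b e \<in> P \<and> a e \<in> V - {v} - P)"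
      using nocut[OF uv(2) _ P(2)] by blast
    then have e1: "e \<in> E1" using PE by blast
    have "(a e \<in> P \<and> b e = u) \<or> (b e \<in> P \<and> a e = u)" using e PE[OF e(1)] by blast
    then have "\<exists>y\<in>P. path_component ?X (p u) (p y)" using edge[OF e1] by metis
    then show False using True by (auto simp: R_def)
  next
    case False
    have "R \<subseteq> V - {u}" "R \<noteq> V - {u}" using P uv by (auto simp: R_def)
    then obtain e where e: "e \<in> E" "(a e \<in> R \<and> b e \<in> V - {u} - R) \<or> (b e \<in> R \<and> a e \<in> V - {u} - R)"
      using nocut[OF uv(1) _ False] by blast
    have RP: "R \<subseteq> P" by (auto simp: R_def)
    have e1: "e \<in> E1" using e PE RP by blast
    obtain y z where yz: "y \<in> R" "z \<in> V - {u} - R" "z \<in> P \<union> {u, v}" "path_component ?X (p y) (p z)"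
      using e PE[OF e(1)] RP edge[OF e1] by blast
    have "path_component ?X (p u) (p z)" using yz path_component_trans by (auto simp: R_def)
    then show False using yz no by (auto simp: R_def)
  qed
qed

text \<open>The path through the side \<open>Q\<close> contains an arc from \<open>p u\<close> to
  \<open>p v\<close>. The two sides have only \<open>u\<close> and \<open>v\<close> in common, so
  this arc meets the drawing of the side \<open>P\<close> only at its ends, as the normal form
  requires.\<close>

lemma drawing_side_normal_form:
  assumes d: "drawing V E a b p G" and fin: "finite V" "finite E"
    and uv: "u \<in> V" "v \<in> V" "u \<noteq> v" and PQ: "P \<inter> Q = {}" "P \<subseteq> V - {u, v}" "Q \<subseteq> V - {u, v}"
    and E1: "E1 \<subseteq> E" "E2 \<subseteq> E" "E1 \<inter> E2 = {}"
    and ends1: "\<And>e. e \<in> E1 \<Longrightarrow> a e \<in> P \<union> {u, v} \<and> b e \<in> P \<union> {u, v}"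
    and ends2: "\<And>e. e \<in> E2 \<Longrightarrow> a e \<in> Q \<union> {u, v} \<and> b e \<in> Q \<union> {u, v}"
    and pc: "path_component (drawn (Q \<union> {u, v}) E2 p G) (p u) (p v)"
  shows "\<exists>p' G'. drawing (P \<union> {u, v}) E1 a b p' G' \<and> p' u = -1 \<and> p' v = 1 \<and>
    (\<forall>z\<in>drawn (P \<union> {u, v}) E1 p' G'. z = -1 \<or> z = 1 \<or> Im z > 0)"
proof -
  note D = drawingD[OF d]
  have pne: "p u \<noteq> p v" using D(1) uv by (auto dest: inj_onD)
  obtain g where g: "path g" "path_image g \<subseteq> drawn (Q \<union> {u, v}) E2 p G" "pathstart g = p u" "pathfinish g = p v"
    using pc by (auto simp: path_component_def)
  obtain h where h: "arc h" "path_image h \<subseteq> path_image g" "pathstart h = p u" "pathfinish h = p v"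
    using path_contains_arc[OF g(1,3,4) pne] by metis
  define L where "L = path_image h"
  have L: "arcset L (p u) (p v)" "L \<subseteq> drawn (Q \<union> {u, v}) E2 p G"
    using h g by (auto simp: arcset_def L_def)
  have pI: "x = y" if "x \<in> V" "y \<in> V" "p x = p y" for x y using D(1) that by (auto dest: inj_onD)
  have inV: "x \<in> V" if "x \<in> P \<union> {u, v} \<or> x \<in> Q \<union> {u, v}" for x using PQ uv that by auto
  have "z \<in> {p u, p v}" if z1: "z \<in> drawn (P \<union> {u, v}) E1 p G" and z2: "z \<in> drawn (Q \<union> {u, v}) E2 p G" for z
  proof -
    have vertex: "z \<in> {p u, p v}" if "x \<in> P \<union> {u, v}" "x \<in> Q \<union> {u, v}" "z = p x" for x
      using that PQ by auto
    consider x where "x \<in> P \<union> {u, v}" "z = p x" | e where "e \<in> E1" "z \<in> G e"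
      using z1 by (auto simp: drawn_def)
    then show ?thesis
    proof cases
      case 1
      consider y where "y \<in> Q \<union> {u, v}" "z = p y" | e where "e \<in> E2" "z \<in> G e"
        using z2 by (auto simp: drawn_def)
      then show ?thesis
      proof cases
        case one: 1
        have "x = y" using pI[of x y] inV 1 one by metis
        then show ?thesis using vertex 1 one by blast
      next
        case 2
        then have "x = a e \<or> x = b e" using D(5)[of e x] 1 inV E1 by blast
        then have "x \<in> Q \<union> {u, v}" using ends2 2 by blast
        then show ?thesis using vertex 1 by blast
      qed
    next
      case 2
      consider y where "y \<in> Q \<union> {u, v}" "z = p y" | e' where "e' \<in> E2" "z \<in> G e'"
        using z2 by (auto simp: drawn_def)
      then show ?thesis
      proof cases
        case 1
        then have "y = a e \<or> y = b e" using D(5)[of e y] 2 inV E1 by blast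
        then have "y \<in> P \<union> {u, v}" using ends1 2 by blast
        then show ?thesis using vertex 1 by blast
      next
        case two: 2
        then have "z \<in> p ` ({a e, b e} \<inter> {a e', b e'})" using D(6)[of e e' z] 2 E1 by blast
        then obtain x where "z = p x" "x \<in> {a e, b e}" "x \<in> {a e', b e'}" by auto
        moreover have "x \<in> P \<union> {u, v}" using calculation(2) ends1[OF 2(1)] by auto
        moreover have "x \<in> Q \<union> {u, v}" using calculation(3) ends2[OF two(1)] by auto
        ultimately show ?thesis using vertex[of x] by simp
      qed
    qed
  qed
  then have "L \<inter> drawn (P \<union> {u, v}) E1 p G \<subseteq> {p u, p v}" using L(2) by blast
  moreover have "p u \<in> L" "p v \<in> L" using arcset_ends[OF L(1)] by auto
  ultimately have LX: "L \<inter> drawn (P \<union> {u, v}) E1 p G = {p u, p v}" by (auto simp: drawn_def)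
  have sub: "drawing (P \<union> {u, v}) E1 a b p G"
    using drawing_subgraph[OF d _ E1(1) ends1] PQ uv by auto
  show ?thesis
    using drawing_normal_form[OF sub _ _ _ _ uv(3) L(1) LX] fin PQ E1 by (auto intro: finite_subset)
qed

text \<open>One statement for two uses. With \<open>s = id\<close> the graph is unchanged, and the
  free segment can take a new edge; with the transposition the side \<open>P\<close> is placed with
  \<open>u\<close> and \<open>v\<close> exchanged before the halves are glued, which is the Whitney
  twist.\<close>

lemma drawing_two_separation:
  assumes d: "drawing V E a b p G" and fin: "finite V" "finite E"
    and uv: "u \<in> V" "v \<in> V" "u \<noteq> v" and P: "P \<subseteq> V - {u, v}" "P \<noteq> {}" "V - P - {u, v} \<noteq> {}"
    and E1: "E1 = {e \<in> E. a e \<in> P \<or> b e \<in> P}"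
    and sep: "\<And>e. e \<in> E1 \<Longrightarrow> a e \<in> P \<union> {u, v} \<and> b e \<in> P \<union> {u, v}"
    and nocut: "\<And>x S. x \<in> V \<Longrightarrow> S \<subseteq> V - {x} \<Longrightarrow> S \<noteq> {} \<Longrightarrow> S \<noteq> V - {x} \<Longrightarrow>
      \<exists>e\<in>E. (a e \<in> S \<and> b e \<in> V - {x} - S) \<or> (b e \<in> S \<and> a e \<in> V - {x} - S)"
    and s: "s = id \<or> s = Transposition.transpose u v"
  shows "\<exists>p' G'. drawing V E (\<lambda>e. if e \<in> E1 then s (a e) else a e) (\<lambda>e. if e \<in> E1 then s (b e) else b e) p' G' \<and>
    p' u = -1 \<and> p' v = 1 \<and> closed_segment (-1) 1 \<inter> drawn V E p' G' = {-1, 1}"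
proof -
  define Q where "Q = V - P - {u, v}"
  define E2 where "E2 = E - E1"
  note D = drawingD[OF d]
  have PQ: "P \<inter> Q = {}" "Q \<inter> P = {}" "Q \<subseteq> V - {u, v}" by (auto simp: Q_def)
  have sub: "E1 \<subseteq> E" "E2 \<subseteq> E" "E1 \<inter> E2 = {}" "E2 \<inter> E1 = {}" by (auto simp: E1 E2_def)
  have ends2: "a e \<in> Q \<union> {u, v} \<and> b e \<in> Q \<union> {u, v}" if "e \<in> E2" for e
    using that D(2,3)[of e] by (auto simp: E2_def E1 Q_def)
  have pc1: "path_component (drawn (P \<union> {u, v}) E1 p G) (p u) (p v)"
    by (rule side_path_component[OF d sub(1) uv P(1,2) _ nocut]) (use sep in \<open>auto simp: E1\<close>)
  have pc2: "path_component (drawn (Q \<union> {u, v}) E2 p G) (p u) (p v)"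
  proof (rule side_path_component[OF d sub(2) uv PQ(3) _ _ nocut])
    show "Q \<noteq> {}" using P by (simp add: Q_def)
    fix e assume e: "e \<in> E" "a e \<in> Q \<or> b e \<in> Q"
    have "e \<in> E2"
    proof (rule ccontr)
      assume "e \<notin> E2"
      then have "e \<in> E1" using e by (simp add: E2_def)
      from sep[OF this] show False using e(2) by (auto simp: Q_def)
    qed
    then show "e \<in> E2 \<and> a e \<in> Q \<union> {u, v} \<and> b e \<in> Q \<union> {u, v}" using ends2 by blast
  qed
  have suv: "s u \<in> V" "s v \<in> V" "s u \<noteq> s v" "{s u, s v} = {u, v}" using s uv by auto
  have pcs: "path_component (drawn (Q \<union> {s u, s v}) E2 p G) (p (s u)) (p (s v))"
    unfolding suv(4) using s pc2 path_component_sym by auto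
  obtain p1 G1 where n1: "drawing (P \<union> {u, v}) E1 a b p1 G1" "p1 (s u) = -1" "p1 (s v) = 1"
    "\<forall>z\<in>drawn (P \<union> {u, v}) E1 p1 G1. z = -1 \<or> z = 1 \<or> Im z > 0"
    using drawing_side_normal_form[OF d fin suv(1-3) PQ(1) _ _ sub(1-3) _ _ pcs] P(1) PQ(3) sep ends2
    unfolding suv(4) by blast
  obtain p2 G2 where n2: "drawing (Q \<union> {u, v}) E2 a b p2 G2" "p2 u = -1" "p2 v = 1"
    "\<forall>z\<in>drawn (Q \<union> {u, v}) E2 p2 G2. z = -1 \<or> z = 1 \<or> Im z > 0"
    using drawing_side_normal_form[OF d fin uv PQ(2,3) P(1) sub(2,1,4) ends2 sep pc1] by blast
  let ?a = "\<lambda>e. if e \<in> E1 then s (a e) else a e" and ?b = "\<lambda>e. if e \<in> E1 then s (b e) else b e"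
  have ss: "s (s x) = x" for x using s by auto
  have sV: "s x \<in> P \<union> {u, v}" if x: "x \<in> P \<union> {u, v}" for x
    using s
  proof
    assume "s = Transposition.transpose u v"
    then show ?thesis using x by (cases "x = u"; cases "x = v") auto
  qed (use x in simp)
  have r1: "drawing (P \<union> {u, v}) E1 (\<lambda>e. s (a e)) (\<lambda>e. s (b e)) (\<lambda>x. p1 (s x)) G1"
    by (rule drawing_relabel[OF n1(1) ss sV])
  have r1': "drawing (P \<union> {u, v}) E1 ?a ?b (\<lambda>x. p1 (s x)) G1"
    using r1 by (rule drawing_reindex[where r = id, simplified]) auto
  have r2': "drawing (Q \<union> {u, v}) E2 ?a ?b p2 G2"
    using n2(1) by (rule drawing_reindex[where r = id, simplified]) (auto simp: E2_def)
  have dr1: "drawn (P \<union> {u, v}) E1 (\<lambda>x. p1 (s x)) G1 \<subseteq> drawn (P \<union> {u, v}) E1 p1 G1"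
    using sV by (fastforce simp: drawn_def)
  have int: "(P \<union> {u, v}) \<inter> (Q \<union> {u, v}) = {u, v}" using PQ P(1) by auto
  have un: "(P \<union> {u, v}) \<union> (Q \<union> {u, v}) = V" "E1 \<union> E2 = E" using P(1) uv by (auto simp: Q_def E2_def E1)
  show ?thesis
    using drawing_union[OF r1' r2' int sub(3) n1(2,3) n2(2,3) _ n2(4)] dr1 n1(4) unfolding un by blast
qed

section \<open>From drawings to planar multigraphs\<close>

lemma planar_multigraph_iff:
  "planar_multigraph k m \<longleftrightarrow>
    (\<exists>p G. drawing {..k} (mg_edges k m) fst (\<lambda>e. fst (snd e)) p G)" (is "_ \<longleftrightarrow> ?R")
proof
  assume "planar_multigraph k m"
  then obtain p and \<gamma> :: "nat \<times> nat \<times> nat \<Rightarrow> real \<Rightarrow> complex" where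
    p: "inj_on p {..k}" and
    g1: "\<forall>(i, j, t) \<in> mg_edges k m.
            arc (\<gamma> (i, j, t)) \<and> pathstart (\<gamma> (i, j, t)) = p i \<and>
            pathfinish (\<gamma> (i, j, t)) = p j \<and>
            (\<forall>l\<le>k. p l \<in> path_image (\<gamma> (i, j, t)) \<longrightarrow> l = i \<or> l = j)" and
    g2: "\<forall>(i, j, t) \<in> mg_edges k m. \<forall>(i', j', t') \<in> mg_edges k m.
            (i, j, t) \<noteq> (i', j', t') \<longrightarrow>
            path_image (\<gamma> (i, j, t)) \<inter> path_image (\<gamma> (i', j', t'))
              \<subseteq> p ` ({i, j} \<inter> {i', j'})"
    unfolding planar_multigraph_def by (elim exE conjE) rule
  have "drawing {..k} (mg_edges k m) fst (\<lambda>e. fst (snd e)) p (\<lambda>e. path_image (\<gamma> e))"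
  proof (rule drawingI)
    fix e assume e: "e \<in> mg_edges k m"
    obtain i j t where ij: "e = (i, j, t)" by (metis prod_cases3)
    show "fst e \<in> {..k}" "fst (snd e) \<in> {..k}" using e by (auto simp: mg_edges_def)
    show "arcset (path_image (\<gamma> e)) (p (fst e)) (p (fst (snd e)))"
      unfolding arcset_def using g1 e ij by (intro exI[of _ "\<gamma> e"]) auto
    show "l = fst e \<or> l = fst (snd e)" if "l \<in> {..k}" "p l \<in> path_image (\<gamma> e)" for l
      using g1 e ij that by fastforce
    fix e' z assume e': "e' \<in> mg_edges k m" "e \<noteq> e'" "z \<in> path_image (\<gamma> e)" "z \<in> path_image (\<gamma> e')"
    obtain i' j' t' where ij': "e' = (i', j', t')" by (metis prod_cases3)
    have "path_image (\<gamma> (i, j, t)) \<inter> path_image (\<gamma> (i', j', t')) \<subseteq> p ` ({i, j} \<inter> {i', j'})"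
      using bspec[OF g2 e[unfolded ij]] e' ij ij' by auto
    then show "z \<in> p ` ({fst e, fst (snd e)} \<inter> {fst e', fst (snd e')})" using e' ij ij' by auto
  qed (rule p)
  then show ?R by blast
next
  assume ?R
  then obtain p G where d: "drawing {..k} (mg_edges k m) fst (\<lambda>e. fst (snd e)) p G" by blast
  note D = drawingD[OF d]
  have "\<forall>e\<in>mg_edges k m. \<exists>g. arc g \<and> path_image g = G e \<and> pathstart g = p (fst e) \<and> pathfinish g = p (fst (snd e))"
    using D(4) by (auto simp: arcset_def)
  then obtain \<gamma> where g: "\<And>e. e \<in> mg_edges k m \<Longrightarrow> arc (\<gamma> e) \<and> path_image (\<gamma> e) = G e \<and>
      pathstart (\<gamma> e) = p (fst e) \<and> pathfinish (\<gamma> e) = p (fst (snd e))" by metis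
  show "planar_multigraph k m" unfolding planar_multigraph_def
  proof (intro exI[of _ p] exI[of _ \<gamma>] conjI)
    show "inj_on p {..k}" by (rule D)
    show "\<forall>(i, j, t) \<in> mg_edges k m.
            arc (\<gamma> (i, j, t)) \<and> pathstart (\<gamma> (i, j, t)) = p i \<and>
            pathfinish (\<gamma> (i, j, t)) = p j \<and>
            (\<forall>l\<le>k. p l \<in> path_image (\<gamma> (i, j, t)) \<longrightarrow> l = i \<or> l = j)"
    proof (clarify, intro conjI allI impI)
      fix i j t assume e: "(i, j, t) \<in> mg_edges k m"
      show "arc (\<gamma> (i, j, t))" "pathstart (\<gamma> (i, j, t)) = p i" "pathfinish (\<gamma> (i, j, t)) = p j"
        using g[OF e] by auto
      fix l assume "l \<le> k" "p l \<in> path_image (\<gamma> (i, j, t))"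
      then show "l = i \<or> l = j" using D(5)[OF e, of l] g[OF e] by auto
    qed
    show "\<forall>(i, j, t) \<in> mg_edges k m. \<forall>(i', j', t') \<in> mg_edges k m.
            (i, j, t) \<noteq> (i', j', t') \<longrightarrow>
            path_image (\<gamma> (i, j, t)) \<inter> path_image (\<gamma> (i', j', t'))
              \<subseteq> p ` ({i, j} \<inter> {i', j'})"
    proof (intro ballI, clarsimp split del: if_split, goal_cases)
      case (1 i j t i' j' t' x)
      then show ?case using D(6)[OF 1(1,2), of x] g[OF 1(1)] g[OF 1(2)] by auto
    qed
  qed
qed

lemma finite_mg_edges: "finite (mg_edges k m)"
proof -
  have "mg_edges k m \<subseteq> (\<Union>i\<in>{..k}. \<Union>j\<in>{..k}. {i} \<times> {j} \<times> {..<m i j})"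
    by (auto simp: mg_edges_def)
  then show ?thesis by (rule finite_subset) auto
qed

lemma planar_two_separation:
  fixes m :: "nat \<Rightarrow> nat \<Rightarrow> nat"
  assumes pl: "planar_multigraph k m" and sym: "\<And>i j. m i j = m j i"
    and nocut: "\<And>x S. x \<le> k \<Longrightarrow> S \<subseteq> {..k} - {x} \<Longrightarrow> S \<noteq> {} \<Longrightarrow> S \<noteq> {..k} - {x} \<Longrightarrow>
      \<exists>y\<in>S. \<exists>z\<in>{..k} - {x} - S. m y z > 0"
    and uv: "u \<le> k" "v \<le> k" "u \<noteq> v" and P: "P \<subseteq> {..k} - {u, v}" "P \<noteq> {}" "{..k} - P - {u, v} \<noteq> {}"
    and sep: "\<And>y z. y \<in> P \<Longrightarrow> z \<in> {..k} - P - {u, v} \<Longrightarrow> m y z = 0"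
  shows planar_twist: "(\<And>i j. i \<le> k \<Longrightarrow> j \<le> k \<Longrightarrow> i \<noteq> j \<Longrightarrow>
      m' i j = (if i \<in> P \<or> j \<in> P then m (Transposition.transpose u v i) (Transposition.transpose u v j) else m i j)) \<Longrightarrow>
      planar_multigraph k m'"
    and planar_add: "(\<And>i j. i \<le> k \<Longrightarrow> j \<le> k \<Longrightarrow> i \<noteq> j \<Longrightarrow>
      m' i j = (if {i, j} = {u, v} then m i j + 1 else m i j)) \<Longrightarrow> planar_multigraph k m'"
proof -
  let ?E = "mg_edges k m" and ?b = "\<lambda>e. fst (snd e) :: nat"
  obtain p G where d: "drawing {..k} ?E fst ?b p G" using pl planar_multigraph_iff by blast
  define E1 where "E1 = {e \<in> ?E. fst e \<in> P \<or> ?b e \<in> P}"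
  have sepE: "fst e \<in> P \<union> {u, v} \<and> ?b e \<in> P \<union> {u, v}" if e: "e \<in> E1" for e
  proof -
    obtain i j t where ij: "e = (i, j, t)" "i < j" "j \<le> k" "t < m i j"
      using e by (auto simp: E1_def mg_edges_def)
    then have "m i j \<noteq> 0" "m j i \<noteq> 0" using sym by auto
    then show ?thesis using e sep[of i j] sep[of j i] ij by (auto simp: E1_def)
  qed
  have mgI: "(min y z, max y z, 0) \<in> ?E" if "y \<le> k" "z \<le> k" "y \<noteq> z" "m y z > 0" for y z
    using that sym[of y z] by (auto simp: mg_edges_def min_def max_def)
  have nocutE: "\<exists>e\<in>?E. (fst e \<in> S \<and> ?b e \<in> {..k} - {x} - S) \<or> (?b e \<in> S \<and> fst e \<in> {..k} - {x} - S)"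
    if S: "x \<in> {..k}" "S \<subseteq> {..k} - {x}" "S \<noteq> {}" "S \<noteq> {..k} - {x}" for x S
  proof -
    obtain y z where yz: "y \<in> S" "z \<in> {..k} - {x} - S" "m y z > 0" using nocut[of x S] S by auto
    then have "(min y z, max y z, 0) \<in> ?E" using S by (intro mgI) auto
    then show ?thesis using yz by (intro bexI[of _ "(min y z, max y z, 0)"]) (auto simp: min_def max_def)
  qed
  have sepr: "\<exists>p' G'. drawing {..k} ?E (\<lambda>e. if e \<in> E1 then s (fst e) else fst e) (\<lambda>e. if e \<in> E1 then s (?b e) else ?b e) p' G' \<and>
    p' u = -1 \<and> p' v = 1 \<and> closed_segment (-1) 1 \<inter> drawn {..k} ?E p' G' = {-1, 1}"
    if "s = id \<or> s = Transposition.transpose u v" for s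
    by (rule drawing_two_separation[OF d _ finite_mg_edges _ _ uv(3) P E1_def sepE nocutE that]) (use uv in auto)
  {
    assume m': "\<And>i j. i \<le> k \<Longrightarrow> j \<le> k \<Longrightarrow> i \<noteq> j \<Longrightarrow>
      m' i j = (if i \<in> P \<or> j \<in> P then m (Transposition.transpose u v i) (Transposition.transpose u v j) else m i j)"
    let ?s = "Transposition.transpose u v"
    \<comment> \<open>An edge of the twisted graph is drawn along the arc of the edge of
      \<open>m\<close> with exchanged ends; \<open>min\<close> and \<open>max\<close> restore the
      order in which \<open>mg_edges\<close> stores the ends.\<close>
    define r where "r = (\<lambda>(i, j, t). if i \<in> P \<or> j \<in> P
      then (min (?s i) (?s j), max (?s i) (?s j), t) else (i, j, t :: nat))"
    have sk: "?s i \<le> k" if "i \<le> k" for i using uv that by (auto simp: Transposition.transpose_def)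
    have sP: "?s i \<in> P \<longleftrightarrow> i \<in> P" for i using P(1) by (auto simp: Transposition.transpose_def)
    obtain p' G' where d': "drawing {..k} ?E (\<lambda>e. if e \<in> E1 then ?s (fst e) else fst e) (\<lambda>e. if e \<in> E1 then ?s (?b e) else ?b e) p' G'"
      using sepr by blast
    have rE: "r e \<in> ?E" if e: "e \<in> mg_edges k m'" for e
    proof -
      obtain i j t where ij: "e = (i, j, t)" "i < j" "j \<le> k" "t < m' i j"
        using e by (auto simp: mg_edges_def)
      have ne: "?s i \<noteq> ?s j" using ij by (metis nat_neq_iff Transposition.transpose_involutory)
      show ?thesis
      proof (cases "i \<in> P \<or> j \<in> P")
        case True
        then have "t < m (?s i) (?s j)" using m'[of i j] ij by simp
        then show ?thesis using True ij ne sk[of i] sk[of j] sym[of "?s i" "?s j"]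
          by (auto simp: r_def mg_edges_def min_def max_def)
      next
        case False
        then show ?thesis using m'[of i j] ij by (simp add: r_def mg_edges_def)
      qed
    qed
    have rinj: "inj_on r (mg_edges k m')"
    proof (rule inj_onI)
      fix e e' assume e: "e \<in> mg_edges k m'" "e' \<in> mg_edges k m'" "r e = r e'"
      obtain i j t where ij: "e = (i, j, t)" "i < j" using e by (auto simp: mg_edges_def)
      obtain i' j' t' where ij': "e' = (i', j', t')" "i' < j'" using e by (auto simp: mg_edges_def)
      have mm: "min x y = min x' y' \<and> max x y = max x' y' \<longleftrightarrow> {x, y} = {x', y'}" for x y x' y' :: nat
        by (auto simp: min_def max_def doubleton_eq_iff)
      have P1: "(fst (r e) \<in> P \<or> fst (snd (r e)) \<in> P) \<longleftrightarrow> (i \<in> P \<or> j \<in> P)"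
        unfolding ij r_def by (auto simp: min_def max_def sP)
      have P2: "(fst (r e') \<in> P \<or> fst (snd (r e')) \<in> P) \<longleftrightarrow> (i' \<in> P \<or> j' \<in> P)"
        unfolding ij' r_def by (auto simp: min_def max_def sP)
      show "e = e'"
      proof (cases "i \<in> P \<or> j \<in> P")
        case True
        then have T': "i' \<in> P \<or> j' \<in> P" using P1 P2 e(3) by simp
        then have "{?s i, ?s j} = {?s i', ?s j'}" "t = t'"
          using True e(3) mm[of "?s i" "?s j" "?s i'" "?s j'"] by (auto simp: ij ij' r_def)
        then have "{i, j} = {i', j'}" unfolding doubleton_eq_iff by (metis Transposition.transpose_involutory)
        then show ?thesis using ij ij' \<open>t = t'\<close> by (auto simp: doubleton_eq_iff)
      next
        case False
        then have "\<not> (i' \<in> P \<or> j' \<in> P)" using P1 P2 e(3) by simp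
        then show ?thesis using False e(3) by (auto simp: ij ij' r_def)
      qed
    qed
    have "{if r e \<in> E1 then ?s (fst (r e)) else fst (r e), if r e \<in> E1 then ?s (?b (r e)) else ?b (r e)} = {fst e, ?b e}"
      if e: "e \<in> mg_edges k m'" for e
    proof -
      obtain i j t where ij: "e = (i, j, t)" using e by (auto simp: mg_edges_def)
      show ?thesis
      proof (cases "i \<in> P \<or> j \<in> P")
        case True
        then have "r e \<in> E1" using rE[OF e] by (auto simp: E1_def r_def ij min_def max_def sP)
        then show ?thesis using True by (auto simp: r_def ij min_def max_def)
      next
        case False
        then have "r e \<notin> E1" by (auto simp: E1_def r_def ij)
        then show ?thesis using False by (auto simp: r_def ij)
      qed
    qed
    then have "drawing {..k} (mg_edges k m') fst ?b p' (\<lambda>e. G' (r e))"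
      using rE by (intro drawing_reindex[OF d' rinj]) auto
    then show "planar_multigraph k m'" using planar_multigraph_iff by blast
  next
    assume m': "\<And>i j. i \<le> k \<Longrightarrow> j \<le> k \<Longrightarrow> i \<noteq> j \<Longrightarrow>
      m' i j = (if {i, j} = {u, v} then m i j + 1 else m i j)"
    have "\<exists>p' G'. drawing {..k} ?E fst ?b p' G' \<and> p' u = -1 \<and> p' v = 1 \<and>
      closed_segment (-1) 1 \<inter> drawn {..k} ?E p' G' = {-1, 1}"
      using sepr[of id] unfolding id_apply if_cancel by blast
    then obtain p' G' where d': "drawing {..k} ?E fst ?b p' G'" and pp: "p' u = -1" "p' v = 1"
      "closed_segment (-1) 1 \<inter> drawn {..k} ?E p' G' = {-1, 1}"
      by (elim exE conjE) rule
    \<comment> \<open>Copies of the edge between \<open>u\<close> and \<open>v\<close> are numbered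
      below \<open>m u v\<close>, so this triple is a new edge.\<close>
    define e0 where "e0 = (min u v, max u v, m u v)"
    have "e0 \<notin> ?E" using sym[of u v] by (auto simp: e0_def mg_edges_def min_def max_def)
    have "{fst e0, ?b e0} = {u, v}" by (auto simp: e0_def min_def max_def)
    have "drawing {..k} (insert e0 ?E) fst ?b p' (G'(e0 := closed_segment (-1) 1))"
    proof (rule drawing_add_edge[OF d' _ _ \<open>e0 \<notin> ?E\<close> \<open>{fst e0, ?b e0} = {u, v}\<close>])
      show "arcset (closed_segment (-1) 1) (p' u) (p' v)"
        unfolding pp(1,2) by (rule arcset_segment) (simp add: complex_eq_iff)
      show "closed_segment (-1) 1 \<inter> drawn {..k} ?E p' G' = {p' u, p' v}" using pp by simp
    qed (use uv in auto)
    moreover have "mg_edges k m' \<subseteq> insert e0 ?E"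
    proof
      fix e assume "e \<in> mg_edges k m'"
      then obtain i j t where ij: "e = (i, j, t)" "i < j" "j \<le> k" "t < m' i j"
        by (auto simp: mg_edges_def)
      show "e \<in> insert e0 ?E"
      proof (cases "{i, j} = {u, v}")
        case True
        then have "min u v = i" "max u v = j" "m i j = m u v"
          using ij(2) sym[of u v] by (auto simp: doubleton_eq_iff)
        then show ?thesis using ij m'[of i j] True by (auto simp: e0_def mg_edges_def)
      next
        case False
        then show ?thesis using ij m'[of i j] by (auto simp: mg_edges_def)
      qed
    qed
    ultimately have "drawing {..k} (mg_edges k m') fst ?b p' (G'(e0 := closed_segment (-1) 1))"
      by (rule drawing_subgraph[OF _ order_refl]) (auto simp: mg_edges_def)
    then show "planar_multigraph k m'" using planar_multigraph_iff by blast
  }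
qed

subsection \<open>Superbases and irreducible vectors\<close>

lemma sum_fun_apply: "(\<Sum>i\<in>A. f i) x = (\<Sum>i\<in>A. f i x)"
  by (induction A rule: infinite_finite_induct) auto

lemma zspan_altdef: "zspan k b = {(\<lambda>j. \<Sum>i<k. c i * b i j) | c. True}"
proof -
  have "(\<Sum>i<k. zsmult (c i) (b i)) = (\<lambda>j. \<Sum>i<k. c i * b i j)" for c
    by (rule ext) (simp add: sum_fun_apply zsmult_def)
  then show ?thesis unfolding zspan_def by simp
qed

lemma dot_commute: "dot N x y = dot N y x"
  by (simp add: dot_def mult.commute)

lemma dot_add: "dot N (x + y) z = dot N x z + dot N y z" "dot N z (x + y) = dot N z x + dot N z y"
  by (simp_all add: dot_def sum.distrib algebra_simps)

lemma dot_diff: "dot N (x - y) z = dot N x z - dot N y z" "dot N z (x - y) = dot N z x - dot N z y"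
  by (simp_all add: dot_def sum_subtractf algebra_simps)

lemma dot_minus: "dot N (- x) z = - dot N x z" "dot N z (- x) = - dot N z x"
  by (simp_all add: dot_def sum_negf)

lemma dot_zero: "dot N 0 z = 0" "dot N z 0 = 0"
  by (simp_all add: dot_def)

lemma dot_sum_left: "dot N (\<lambda>i. \<Sum>x\<in>S. c x * v x i) z = (\<Sum>x\<in>S. c x * dot N (v x) z)"
proof -
  have "dot N (\<lambda>i. \<Sum>x\<in>S. c x * v x i) z = (\<Sum>i<N. \<Sum>x\<in>S. c x * v x i * z i)"
    by (simp add: dot_def sum_distrib_right)
  also have "\<dots> = (\<Sum>x\<in>S. \<Sum>i<N. c x * v x i * z i)" by (rule sum.swap)
  finally show ?thesis by (simp add: dot_def sum_distrib_left mult.assoc)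
qed

lemma dot_self_eq_0:
  assumes "z \<in> zvec N" "dot N z z = 0"
  shows "z = 0"
proof -
  have "z i * z i = 0" if "i < N" for i
    using assms(2) that unfolding dot_def by (subst (asm) sum_nonneg_eq_0_iff) auto
  then have "z i = 0" if "i < N" for i using that by simp
  moreover have "z i = 0" if "\<not> i < N" for i using assms(1) that by (simp add: zvec_def)
  ultimately show ?thesis by (intro ext) (metis zero_fun_apply)
qed

lemma dot_self_nonneg: "dot N z z \<ge> 0"
  unfolding dot_def by (intro sum_nonneg) auto

text \<open>Elimination without division: one equation is solved for the unknown \<open>i\<close>,
  and multiplication by the pivot \<open>M i x\<close> keeps the others integral.\<close>

lemma integer_kernel:
  fixes M :: "'b \<Rightarrow> 'a \<Rightarrow> int"
  assumes "finite A" "finite J" "card A < card J"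
  shows "\<exists>c. (\<exists>j\<in>J. c j \<noteq> 0) \<and> (\<forall>x\<in>A. (\<Sum>j\<in>J. c j * M j x) = 0)"
  using assms
proof (induction A arbitrary: J M rule: finite_induct)
  case empty
  then have "J \<noteq> {}" by auto
  then show ?case by (intro exI[of _ "\<lambda>_. 1"]) auto
next
  case (insert x A)
  show ?case
  proof (cases "\<forall>j\<in>J. M j x = 0")
    case True
    have "card A < card J" using insert by simp
    from insert.IH[OF insert.prems(1) this, of M] True show ?thesis by auto
  next
    case False
    then obtain i where i: "i \<in> J" "M i x \<noteq> 0" by blast
    let ?J = "J - {i}"
    have J: "finite ?J" "card A < card ?J" using insert i by auto
    obtain c where c: "\<exists>j\<in>?J. c j \<noteq> 0"
      "\<And>y. y \<in> A \<Longrightarrow> (\<Sum>j\<in>?J. c j * (M i x * M j y - M j x * M i y)) = 0"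
      using insert.IH[OF J, of "\<lambda>j y. M i x * M j y - M j x * M i y"] by blast
    define d where "d = (\<lambda>j. if j = i then - (\<Sum>l\<in>?J. M l x * c l) else M i x * c j)"
    have "(\<Sum>j\<in>J. d j * M j y) = (\<Sum>j\<in>?J. c j * (M i x * M j y - M j x * M i y))" for y
    proof -
      have "(\<Sum>j\<in>J. d j * M j y) = d i * M i y + (\<Sum>j\<in>?J. d j * M j y)"
        using i insert.prems(1) by (simp add: sum.remove)
      also have "(\<Sum>j\<in>?J. d j * M j y) = (\<Sum>j\<in>?J. M i x * c j * M j y)"
        by (intro sum.cong) (auto simp: d_def)
      also have "d i * M i y = (\<Sum>j\<in>?J. - (M j x * c j * M i y))"
        by (simp add: d_def sum_distrib_right sum_negf)
      finally show ?thesis by (simp add: algebra_simps sum.distrib sum_subtractf sum_negf)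
    qed
    note eq = this
    have "(\<Sum>j\<in>J. d j * M j y) = 0" if "y \<in> insert x A" for y
      unfolding eq using that c(2) by (cases "y = x") auto
    moreover have "\<exists>j\<in>J. d j \<noteq> 0" using c(1) i by (auto simp: d_def)
    ultimately show ?thesis by blast
  qed
qed

definition irreducible_in :: "nat \<Rightarrow> (nat \<Rightarrow> int) set \<Rightarrow> (nat \<Rightarrow> int) \<Rightarrow> bool" where
  "irreducible_in N L z \<longleftrightarrow> z \<in> L \<and> z \<noteq> 0 \<and>
    (\<forall>y\<in>L. \<forall>y'\<in>L. z = y + y' \<longrightarrow> dot N y y' \<ge> 0 \<longrightarrow> y = 0 \<or> y' = 0)"

lemma irrD: "irreducible_in N L z \<Longrightarrow> y \<in> L \<Longrightarrow> y' \<in> L \<Longrightarrow> z = y + y' \<Longrightarrow> dot N y y' \<ge> 0 \<Longrightarrow> y = 0 \<or> y' = 0"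
  unfolding irreducible_in_def by blast

section \<open>Cuts of an obtuse superbase\<close>

locale superbase_lattice =
  fixes N K :: nat and L :: "(nat \<Rightarrow> int) set" and v :: "nat \<Rightarrow> nat \<Rightarrow> int"
  assumes sb: "obtuse_superbase N L K v" and Lsub: "L \<subseteq> zvec N"
begin

definition V :: "nat set" where "V = {..K}"

lemma finite_V [simp]: "finite V" by (simp add: V_def)

lemma finite_subV: "S \<subseteq> V \<Longrightarrow> finite S" using finite_V finite_subset by blast

text \<open>For distinct \<open>x\<close> and \<open>y\<close>, \<open>- a x y\<close> is the number
  of edges between them in the graph of the superbase. For disjoint \<open>S\<close> and
  \<open>T\<close> the pairing of \<open>cutv S\<close> with \<open>cutv T\<close> is therefore
  minus the number of edges between \<open>S\<close> and \<open>T\<close>.\<close>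

definition a :: "nat \<Rightarrow> nat \<Rightarrow> int" where "a x y = dot N (v x) (v y)"
definition cmb :: "(nat \<Rightarrow> int) \<Rightarrow> nat \<Rightarrow> int" where "cmb c = (\<lambda>i. \<Sum>x\<in>V. c x * v x i)"
definition cutv :: "nat set \<Rightarrow> nat \<Rightarrow> int" where "cutv S = (\<lambda>i. \<Sum>x\<in>S. v x i)"

lemma a_sym: "a x y = a y x" by (simp add: a_def dot_commute)

lemma a_nonpos: "x \<in> V \<Longrightarrow> y \<in> V \<Longrightarrow> x \<noteq> y \<Longrightarrow> a x y \<le> 0"
  using sb by (simp add: obtuse_superbase_def a_def V_def)

lemma v_in_L: "x \<in> V \<Longrightarrow> v x \<in> L"
  using sb unfolding obtuse_superbase_def V_def atMost_iff by blast

lemma L_eq: "L = range cmb"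
proof -
  have "L = zspan (Suc K) v" using sb by (simp add: obtuse_superbase_def)
  also have "\<dots> = range cmb" unfolding zspan_altdef cmb_def lessThan_Suc_atMost V_def by auto
  finally show ?thesis .
qed

lemma cmb_in_L: "cmb c \<in> L" using L_eq by auto

lemma cmbE: assumes "z \<in> L" obtains c where "z = cmb c" using assms L_eq by auto

lemma cmb_add: "cmb c + cmb d = cmb (\<lambda>x. c x + d x)"
  by (rule ext) (simp add: cmb_def sum.distrib algebra_simps)

lemma cmb_diff: "cmb c - cmb d = cmb (\<lambda>x. c x - d x)"
  by (rule ext) (simp add: cmb_def sum_subtractf algebra_simps)

lemma cmb_uminus: "- cmb c = cmb (\<lambda>x. - c x)"
  by (rule ext) (simp add: cmb_def sum_negf)

lemma L_add: "x \<in> L \<Longrightarrow> y \<in> L \<Longrightarrow> x + y \<in> L"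
  by (metis cmbE cmb_add cmb_in_L)

lemma L_diff: "x \<in> L \<Longrightarrow> y \<in> L \<Longrightarrow> x - y \<in> L"
  by (metis cmbE cmb_diff cmb_in_L)

lemma L_uminus: "x \<in> L \<Longrightarrow> - x \<in> L"
  by (metis cmbE cmb_uminus cmb_in_L)

lemma cut_cmb: "S \<subseteq> V \<Longrightarrow> cutv S = cmb (\<lambda>x. of_bool (x \<in> S))"
  unfolding cutv_def cmb_def
  by (rule ext, rule sum.mono_neutral_cong_left) auto

lemma cut_in_L: "S \<subseteq> V \<Longrightarrow> cutv S \<in> L"
  by (simp add: cut_cmb cmb_in_L)

lemma cut_empty [simp]: "cutv {} = 0" by (rule ext) (simp add: cutv_def)

lemma cut_singleton [simp]: "cutv {x} = v x" by (rule ext) (simp add: cutv_def)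

lemma cut_all: "cutv V = 0"
proof -
  have "(\<Sum>i\<le>K. v i) = 0" using sb unfolding obtuse_superbase_def by blast
  then have "(\<Sum>i\<le>K. v i j) = 0" for j by (metis sum_fun_apply zero_fun_apply)
  then show ?thesis by (intro ext) (simp add: cutv_def V_def)
qed

lemma cut_union: "finite S \<Longrightarrow> finite T \<Longrightarrow> S \<inter> T = {} \<Longrightarrow> cutv (S \<union> T) = cutv S + cutv T"
  by (rule ext) (simp add: cutv_def sum.union_disjoint)

lemma cut_compl: assumes "S \<subseteq> V" shows "cutv (V - S) = - cutv S"
proof -
  have "cutv (S \<union> (V - S)) = cutv S + cutv (V - S)"
    using assms finite_subV by (intro cut_union) auto
  moreover have "S \<union> (V - S) = V" using assms by auto
  ultimately show ?thesis using cut_all by (simp add: eq_neg_iff_add_eq_0 add.commute)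
qed

lemma dot_cmb: "dot N (cmb c) z = (\<Sum>x\<in>V. c x * dot N (v x) z)"
  unfolding cmb_def by (rule dot_sum_left)

lemma dot_cut: "dot N (cutv S) z = (\<Sum>x\<in>S. dot N (v x) z)"
  using dot_sum_left[of N "\<lambda>_. 1" v S z] by (simp add: cutv_def)

lemma dot_cut_cut: "dot N (cutv S) (cutv T) = (\<Sum>x\<in>S. \<Sum>y\<in>T. a x y)"
proof -
  have "dot N (v x) (cutv T) = (\<Sum>y\<in>T. a x y)" for x
    unfolding dot_commute[of N "v x"] dot_cut a_def by (simp add: dot_commute)
  then show ?thesis unfolding dot_cut by simp
qed

lemma dot_cut_disjoint:
  assumes "S \<subseteq> V" "T \<subseteq> V" "S \<inter> T = {}"
  shows "dot N (cutv S) (cutv T) \<le> 0"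
    and "dot N (cutv S) (cutv T) = 0 \<Longrightarrow> x \<in> S \<Longrightarrow> y \<in> T \<Longrightarrow> a x y = 0"
proof -
  have nn: "a x y \<le> 0" if "x \<in> S" "y \<in> T" for x y using assms that by (intro a_nonpos) auto
  then show "dot N (cutv S) (cutv T) \<le> 0" unfolding dot_cut_cut by (intro sum_nonpos)
  have fin: "finite S" "finite T" using assms finite_subV by auto
  assume "dot N (cutv S) (cutv T) = 0" "x \<in> S" "y \<in> T"
  then have "(\<Sum>x\<in>S. \<Sum>y\<in>T. - a x y) = 0" by (simp add: dot_cut_cut sum_negf)
  then have "(\<Sum>y\<in>T. - a x y) = 0" using fin nn \<open>x \<in> S\<close>
    by (subst (asm) sum_nonneg_eq_0_iff) (auto intro!: sum_nonneg)
  then show "a x y = 0" using fin nn \<open>x \<in> S\<close> \<open>y \<in> T\<close>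
    by (subst (asm) sum_nonneg_eq_0_iff) auto
qed

lemma dot_cut_zeroI:
  assumes "\<And>x y. x \<in> S \<Longrightarrow> y \<in> T \<Longrightarrow> a x y = 0"
  shows "dot N (cutv S) (cutv T) = 0"
  unfolding dot_cut_cut using assms by simp

text \<open>This says that the graph is connected, and it is where the rank enters. If
  \<open>cutv S\<close> vanished for a nonempty proper \<open>S\<close>, so would
  \<open>cutv (V - S)\<close>; one element of each set could be eliminated, and \<open>K - 1\<close>
  vectors would generate a lattice with \<open>K\<close> independent ones.\<close>

lemma cut_eq_0:
  assumes S: "S \<subseteq> V" and S0: "cutv S = 0"
  shows "S = {} \<or> S = V"
proof (rule ccontr)
  assume "\<not> ?thesis"
  then obtain p q where pq: "p \<in> S" "q \<in> V - S" using S by blast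
  let ?A = "V - {p, q}"
  have S0': "cutv (V - S) = 0" using cut_compl[OF S] S0 by simp
  have red: "\<exists>d. z = (\<lambda>i. \<Sum>x\<in>?A. d x * v x i)" if z: "z \<in> L" for z
  proof -
    obtain c where c: "z = cmb c" using z cmbE by blast
    \<comment> \<open>Subtracting one constant on \<open>S\<close> and another on
      \<open>V - S\<close> does not change \<open>z\<close> and kills the coefficients at
      \<open>p\<close> and \<open>q\<close>.\<close>
    define d where "d = (\<lambda>x. c x - (if x \<in> S then c p else c q))"
    have "z i = (\<Sum>x\<in>?A. d x * v x i)" for i
    proof -
      have "(\<Sum>x\<in>V. d x * v x i) = z i - (\<Sum>x\<in>V. (if x \<in> S then c p else c q) * v x i)"
        unfolding c cmb_def d_def by (simp add: algebra_simps sum_subtractf)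
      also have "(\<Sum>x\<in>V. (if x \<in> S then c p else c q) * v x i) =
          (\<Sum>x\<in>S. (if x \<in> S then c p else c q) * v x i) + (\<Sum>x\<in>V - S. (if x \<in> S then c p else c q) * v x i)"
        using S by (subst sum.subset_diff[of S V]) auto
      also have "(\<Sum>x\<in>S. (if x \<in> S then c p else c q) * v x i) = c p * cutv S i"
        by (simp add: cutv_def sum_distrib_left)
      also have "(\<Sum>x\<in>V - S. (if x \<in> S then c p else c q) * v x i) = c q * cutv (V - S) i"
        by (simp add: cutv_def sum_distrib_left)
      finally have "(\<Sum>x\<in>V. d x * v x i) = z i" using S0 S0' by simp
      moreover have "(\<Sum>x\<in>?A. d x * v x i) = (\<Sum>x\<in>V. d x * v x i)"
        using pq by (intro sum.mono_neutral_left) (auto simp: d_def)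
      ultimately show ?thesis by simp
    qed
    then show ?thesis by auto
  qed
  obtain b where b: "\<And>i. i < K \<Longrightarrow> b i \<in> L" "zlin_indep K b"
    using sb by (auto simp: obtuse_superbase_def has_rank_def)
  have "\<forall>j\<in>{..<K}. \<exists>d. b j = (\<lambda>i. \<Sum>x\<in>?A. d x * v x i)" using red b by auto
  then obtain M where M: "\<And>j. j < K \<Longrightarrow> b j = (\<lambda>i. \<Sum>x\<in>?A. M j x * v x i)"
    by (metis lessThan_iff)
  have pqV: "p \<in> V" "q \<in> V" "p \<noteq> q" using pq S by auto
  have "card ?A = card V - 2" using pqV by (subst card_Diff_subset) auto
  moreover have "card V \<ge> 2" using pqV card_mono[of V "{p, q}"] by auto
  ultimately have "card ?A < card {..<K}" by (simp add: V_def)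
  then obtain c where c: "\<exists>j\<in>{..<K}. c j \<noteq> 0" "\<And>x. x \<in> ?A \<Longrightarrow> (\<Sum>j\<in>{..<K}. c j * M j x) = 0"
    using integer_kernel[of ?A "{..<K}" M] by auto
  have "(\<Sum>j<K. zsmult (c j) (b j)) = 0"
  proof
    fix i
    have "(\<Sum>j<K. zsmult (c j) (b j)) i = (\<Sum>j<K. \<Sum>x\<in>?A. c j * M j x * v x i)"
      by (auto simp: sum_fun_apply zsmult_def M sum_distrib_left mult.assoc intro!: sum.cong)
    also have "\<dots> = (\<Sum>x\<in>?A. (\<Sum>j<K. c j * M j x) * v x i)"
      by (subst sum.swap) (simp add: sum_distrib_right)
    also have "\<dots> = 0" using c(2) by (intro sum.neutral) auto
    finally show "(\<Sum>j<K. zsmult (c j) (b j)) i = 0 i" by simp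
  qed
  then show False using b(2) c(1) by (auto simp: zlin_indep_def)
qed

lemma dot_cut_self_pos:
  assumes "S \<subseteq> V" "S \<noteq> {}" "S \<noteq> V"
  shows "dot N (cutv S) (cutv S) > 0"
proof -
  have "cutv S \<noteq> 0" using cut_eq_0 assms by blast
  then have "dot N (cutv S) (cutv S) \<noteq> 0"
    using dot_self_eq_0 cut_in_L[OF assms(1)] Lsub by blast
  then show ?thesis using dot_self_nonneg[of N "cutv S"] by simp
qed

text \<open>The pairing counts the edges from \<open>x\<close> to the complement of
  \<open>S\<close>.\<close>

lemma dot_cut_v:
  assumes "S \<subseteq> V" "x \<in> S"
  shows "dot N (cutv S) (v x) \<ge> 0"
proof -
  have "dot N (cutv S) (v x) = - dot N (cutv (V - S)) (cutv {x})"
    using cut_compl[OF assms(1)] by (simp add: dot_minus)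
  moreover have "dot N (cutv (V - S)) (cutv {x}) \<le> 0"
    using assms by (intro dot_cut_disjoint) auto
  ultimately show ?thesis by simp
qed

lemma cmb_pos_part:
  assumes c: "\<And>x. x \<in> V \<Longrightarrow> c x \<ge> 0" and R: "R = {x \<in> V. c x > 0}"
  shows "dot N (cutv R) (cmb c) = (\<Sum>y\<in>R. c y * dot N (cutv R) (v y))"
proof -
  have "dot N (cutv R) (cmb c) = (\<Sum>y\<in>V. c y * dot N (cutv R) (v y))"
    by (simp add: dot_commute[of N "cutv R"] dot_cmb)
  also have "\<dots> = (\<Sum>y\<in>R. c y * dot N (cutv R) (v y))"
    using c by (intro sum.mono_neutral_right) (auto simp: R order.antisym not_less)
  finally show ?thesis .
qed

lemma cmb_shift: "cmb (\<lambda>x. c x - t) = cmb c"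
proof -
  have "cmb (\<lambda>x. c x - t) i = cmb c i - t * cutv V i" for i
    by (simp add: cmb_def cutv_def algebra_simps sum_subtractf sum_distrib_left)
  then show ?thesis using cut_all by auto
qed

lemma cmb_shift_min:
  "\<exists>c'. cmb c' = cmb c \<and> (\<forall>x\<in>V. c' x \<ge> 0) \<and> (\<exists>x\<in>V. c' x = 0) \<and> (\<forall>x y. c' x - c' y = c x - c y)"
proof -
  let ?t = "Min (c ` V)"
  have "?t \<in> c ` V" by (intro Min_in) (auto simp: V_def)
  then obtain x where "x \<in> V" "c x = ?t" by auto
  then show ?thesis
    by (intro exI[of _ "\<lambda>x. c x - ?t"] conjI bexI[of _ x]) (auto simp: cmb_shift)
qed

text \<open>Shift the coefficients to minimum 0 and pair with the cut of their support
  \<open>R\<close>. All terms are nonnegative, so \<open>cutv R\<close> is orthogonal to every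
  element of \<open>R\<close>, hence to itself, and \<open>R\<close> is empty.\<close>

lemma cmb_eq_0:
  assumes "cmb c = 0" "x \<in> V" "y \<in> V"
  shows "c x = c y"
proof -
  obtain c' where c': "cmb c' = cmb c" "\<And>x. x \<in> V \<Longrightarrow> c' x \<ge> 0" "\<exists>x\<in>V. c' x = 0"
    "\<And>x y. c' x - c' y = c x - c y" using cmb_shift_min[of c] by blast
  define R where "R = {x \<in> V. c' x > 0}"
  have RV: "R \<subseteq> V" "finite R" by (auto simp: R_def)
  have "(\<Sum>y\<in>R. c' y * dot N (cutv R) (v y)) = 0"
    using cmb_pos_part[OF c'(2) R_def] c'(1) assms(1) by (simp add: dot_zero)
  moreover have "c' y * dot N (cutv R) (v y) \<ge> 0" if "y \<in> R" for y
    using that dot_cut_v[OF RV(1) that] by (simp add: R_def)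
  ultimately have z: "c' y * dot N (cutv R) (v y) = 0" if "y \<in> R" for y
    using RV that by (subst (asm) sum_nonneg_eq_0_iff) auto
  have "dot N (cutv R) (v y) = 0" if "y \<in> R" for y using z[OF that] that by (simp add: R_def)
  then have "dot N (cutv R) (cutv R) = 0" unfolding dot_cut[of R "cutv R"] by (simp add: dot_commute[of N "v _"])
  then have "cutv R = 0" using dot_self_eq_0 cut_in_L[OF RV(1)] Lsub by blast
  then have "R = {}" using cut_eq_0[OF RV(1)] c'(3) unfolding R_def by (metis (no_types, lifting) less_irrefl mem_Collect_eq)
  then have "c' z = 0" if "z \<in> V" for z using c'(2)[OF that] that by (auto simp: R_def)
  then show ?thesis using c'(4)[of x y] assms by simp
qed

lemma cmb_eq:
  assumes "cmb c = cmb d" "x \<in> V" "y \<in> V"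
  shows "c x - c y = d x - d y"
proof -
  have "cmb (\<lambda>x. c x - d x) = 0" using assms(1) cmb_diff[of c d] by simp
  from cmb_eq_0[OF this assms(2,3)] show ?thesis by simp
qed

text \<open>Take coefficients with minimum 0 and support \<open>R\<close>, and split off
  \<open>cutv R\<close>. What remains has coefficients \<open>c' - 1 \<ge> 0\<close> on
  \<open>R\<close> and 0 elsewhere, so it pairs nonnegatively with \<open>cutv R\<close>;
  irreducibility makes it 0.\<close>

lemma irr_cut:
  assumes z: "irreducible_in N L z"
  obtains R where "R \<subseteq> V" "R \<noteq> {}" "R \<noteq> V" "z = cutv R"
proof -
  obtain c where c: "z = cmb c" using z cmbE by (auto simp: irreducible_in_def)
  obtain c' where c': "cmb c' = cmb c" "\<And>x. x \<in> V \<Longrightarrow> c' x \<ge> 0" "\<exists>x\<in>V. c' x = 0"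
    using cmb_shift_min[of c] by blast
  define R where "R = {x \<in> V. c' x > 0}"
  have RV: "R \<subseteq> V" "finite R" by (auto simp: R_def)
  have RV3: "R \<noteq> V" using c'(3) unfolding R_def by (metis (no_types, lifting) less_irrefl mem_Collect_eq)
  have zc: "z = cmb c'" using c c' by simp
  have "R \<noteq> {}"
  proof
    assume "R = {}"
    then have "c' x = 0" if "x \<in> V" for x using c'(2)[OF that] that by (auto simp: R_def)
    then have "z = 0" unfolding zc cmb_def by auto
    then show False using z by (simp add: irreducible_in_def)
  qed
  have "dot N (cutv R) (cmb c' - cutv R) \<ge> 0"
  proof -
    have "dot N (cutv R) (cutv R) = (\<Sum>y\<in>R. dot N (cutv R) (v y))"
      unfolding dot_cut[of R "cutv R"] by (simp add: dot_commute[of N "v _"])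
    then have "dot N (cutv R) (cmb c' - cutv R) = (\<Sum>y\<in>R. (c' y - 1) * dot N (cutv R) (v y))"
      using cmb_pos_part[OF c'(2) R_def] by (simp add: dot_diff algebra_simps sum_subtractf)
    also have "\<dots> \<ge> 0" using dot_cut_v[OF RV(1)] by (intro sum_nonneg mult_nonneg_nonneg) (auto simp: R_def)
    finally show ?thesis .
  qed
  then have "cutv R = 0 \<or> cmb c' - cutv R = 0"
    using irrD[OF z cut_in_L[OF RV(1)] L_diff[OF cmb_in_L cut_in_L[OF RV(1)]]] zc by simp
  moreover have "cutv R \<noteq> 0" using cut_eq_0[OF RV(1)] RV3 \<open>R \<noteq> {}\<close> by blast
  ultimately have "z = cutv R" using zc by simp
  then show ?thesis using that RV RV3 \<open>R \<noteq> {}\<close> by blast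
qed

text \<open>Otherwise the cut would be a sum of two orthogonal nonzero cuts.\<close>

lemma irr_cut_connected:
  assumes "irreducible_in N L (cutv X)" "X \<subseteq> V" "S \<subseteq> X" "S \<noteq> {}" "S \<noteq> X" "X \<noteq> V"
  shows "\<exists>y\<in>S. \<exists>z\<in>X - S. a y z \<noteq> 0"
proof (rule ccontr)
  assume "\<not> ?thesis"
  then have "dot N (cutv S) (cutv (X - S)) = 0" by (intro dot_cut_zeroI) auto
  moreover have "cutv X = cutv S + cutv (X - S)"
  proof -
    have "cutv (S \<union> (X - S)) = cutv S + cutv (X - S)"
      using assms finite_subV by (intro cut_union) auto
    moreover have "S \<union> (X - S) = X" using assms by auto
    ultimately show ?thesis by simp
  qed
  ultimately have "cutv S = 0 \<or> cutv (X - S) = 0"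
    using assms by (intro irrD[OF assms(1)] cut_in_L) auto
  then show False using cut_eq_0[of S] cut_eq_0[of "X - S"] assms by blast
qed

text \<open>The cuts of the four regions sum to 0; eliminating one of them leaves the two diagonal
  pairs. The first pair counts edges that cross both cuts in the same direction, the second those
  that cross them in opposite directions.\<close>

lemma cut_cross:
  assumes "X \<subseteq> V" "Z \<subseteq> V"
  shows "dot N (cutv X) (cutv Z) = - dot N (cutv (X \<inter> Z)) (cutv (V - (X \<union> Z))) + dot N (cutv (X - Z)) (cutv (Z - X))"
proof -
  let ?P = "X \<inter> Z" let ?a = "X - Z" let ?b = "Z - X"
  have fin: "finite X" "finite Z" using assms finite_subV by auto
  have X: "cutv X = cutv ?P + cutv ?a"
  proof -
    have "?P \<union> ?a = X" "?P \<inter> ?a = {}" by auto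
    then show ?thesis using cut_union[of ?P ?a] fin by simp
  qed
  have Z: "cutv Z = cutv ?P + cutv ?b"
  proof -
    have "?P \<union> ?b = Z" "?P \<inter> ?b = {}" by auto
    then show ?thesis using cut_union[of ?P ?b] fin by simp
  qed
  have D: "cutv (V - (X \<union> Z)) = - (cutv ?P + cutv ?a + cutv ?b)"
  proof -
    have "cutv (V - (X \<union> Z)) = - cutv (X \<union> Z)" using assms by (intro cut_compl) auto
    moreover have "X \<union> Z = X \<union> ?b" by auto
    moreover have "cutv (X \<union> ?b) = cutv X + cutv ?b" using fin by (intro cut_union) auto
    ultimately show ?thesis by (simp only: X)
  qed
  show ?thesis unfolding D unfolding X Z
    by (simp add: dot_add dot_minus dot_diff dot_commute[of N "cutv ?a" "cutv ?P"])
qed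

text \<open>The coefficients of a lattice vector with respect to the superbase are only unique up to a common
  constant, which cancels here.\<close>

definition coeff_diff :: "nat \<Rightarrow> nat \<Rightarrow> (nat \<Rightarrow> int) \<Rightarrow> int" where
  "coeff_diff h t z = (let c = (SOME c. z = cmb c) in c h - c t)"

lemma coeff_diff_cmb: assumes "h \<in> V" "t \<in> V" shows "coeff_diff h t (cmb c) = c h - c t"
proof -
  have "cmb c = cmb (SOME d. cmb c = cmb d)" by (rule someI[of "\<lambda>d. cmb c = cmb d"]) simp
  from cmb_eq[OF this assms] show ?thesis by (simp add: coeff_diff_def Let_def)
qed

lemma coeff_diff_cut: assumes "h \<in> V" "t \<in> V" "S \<subseteq> V"
  shows "coeff_diff h t (cutv S) = of_bool (h \<in> S) - of_bool (t \<in> S)"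
  using assms by (simp add: cut_cmb coeff_diff_cmb)

lemma coeff_diff_add: "h \<in> V \<Longrightarrow> t \<in> V \<Longrightarrow> x \<in> L \<Longrightarrow> y \<in> L \<Longrightarrow> coeff_diff h t (x + y) = coeff_diff h t x + coeff_diff h t y"
  by (elim cmbE) (simp add: cmb_add coeff_diff_cmb)

lemma coeff_diff_diff: "h \<in> V \<Longrightarrow> t \<in> V \<Longrightarrow> x \<in> L \<Longrightarrow> y \<in> L \<Longrightarrow> coeff_diff h t (x - y) = coeff_diff h t x - coeff_diff h t y"
  by (elim cmbE) (simp add: cmb_diff coeff_diff_cmb)

text \<open>The edges leaving \<open>X\<close> are exactly the two simple edges \<open>p1 p2\<close>
  and \<open>q1 q2\<close>, each written with its inner end in front. They may share an end.\<close>

definition piece :: "nat set \<Rightarrow> nat \<Rightarrow> nat \<Rightarrow> nat \<Rightarrow> nat \<Rightarrow> bool" where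
  "piece X p1 p2 q1 q2 \<longleftrightarrow> X \<subseteq> V \<and> p1 \<in> X \<and> q1 \<in> X \<and> p2 \<in> V - X \<and> q2 \<in> V - X \<and> (p1, p2) \<noteq> (q1, q2) \<and>
    (\<forall>x\<in>X. \<forall>y\<in>V - X. a x y = - (of_bool (x = p1 \<and> y = p2) + of_bool (x = q1 \<and> y = q2)))"

lemma piece_swap: "piece X p1 p2 q1 q2 \<Longrightarrow> piece X q1 q2 p1 p2"
  unfolding piece_def by auto

text \<open>\<open>R\<close> contains just one end of each of the two edges leaving
  \<open>X\<close>, so no edge joins \<open>R \<inter> X\<close> to \<open>R - X\<close>. An
  irreducible cut does not fall apart in this way.\<close>

lemma piece_no_return:
  assumes X: "piece X p1 p2 q1 q2" and R: "R \<subseteq> V" "irreducible_in N L (cutv R)"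
    and p: "p1 \<in> R" "p2 \<notin> R" "q1 \<notin> R" "q2 \<in> R"
  shows False
proof -
  have "a x y = 0" if "x \<in> R \<inter> X" "y \<in> R - X" for x y
    using that X p R(1) unfolding piece_def by (auto dest!: bspec[of X _ x])
  then have "dot N (cutv (R \<inter> X)) (cutv (R - X)) = 0" by (intro dot_cut_zeroI) auto
  moreover have "cutv R = cutv (R \<inter> X) + cutv (R - X)"
  proof -
    have "(R \<inter> X) \<union> (R - X) = R" "(R \<inter> X) \<inter> (R - X) = {}" by auto
    then show ?thesis using cut_union[of "R \<inter> X" "R - X"] R finite_subV[OF R(1)] by simp
  qed
  ultimately have "cutv (R \<inter> X) = 0 \<or> cutv (R - X) = 0"
    using R by (intro irrD[OF R(2)] cut_in_L) auto
  then show False using cut_eq_0[of "R \<inter> X"] cut_eq_0[of "R - X"] R(1) X p unfolding piece_def by blast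
qed

text \<open>Pairing with a cut adds up the drops of the coefficients along the edges that leave
  it.\<close>

lemma dot_cmb_piece:
  assumes X: "piece X p1 p2 q1 q2"
  shows "dot N (cmb c) (cutv X) = c p1 + c q1 - c p2 - c q2"
proof -
  have mem: "X \<subseteq> V" "p1 \<in> X" "q1 \<in> X" "p2 \<in> V - X" "q2 \<in> V - X" using X by (auto simp: piece_def)
  have axy: "a x y = - (of_bool (x = p1 \<and> y = p2) + of_bool (x = q1 \<and> y = q2))" if "x \<in> X" "y \<in> V - X" for x y
    using X that unfolding piece_def by blast
  have fin: "finite X" using mem finite_subV by auto
  have ob: "(\<Sum>y\<in>T. of_bool (P \<and> y = q)) = (of_bool P :: int)" if "finite T" "q \<in> T" for T P and q :: nat
    using that by (cases P) (simp_all add: of_bool_def)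
  have ob': "(\<Sum>y\<in>V. c y * of_bool (y = q)) = c q" if "q \<in> V" for q
    using that by (simp add: of_bool_def if_distrib cong: if_cong)
  have vx: "dot N (v x) (cutv X) = of_bool (x = p1) + of_bool (x = q1) - of_bool (x = p2) - of_bool (x = q2)"
    if x: "x \<in> V" for x
  proof (cases "x \<in> X")
    case True
    have "dot N (v x) (cutv X) = - dot N (cutv {x}) (cutv (V - X))"
      using cut_compl[OF mem(1)] by (simp add: dot_minus)
    also have "\<dots> = (\<Sum>y\<in>V - X. of_bool (x = p1 \<and> y = p2) + of_bool (x = q1 \<and> y = q2))"
      unfolding dot_cut_cut using axy True by (simp add: sum_negf[symmetric] sum.distrib)
    also have "\<dots> = of_bool (x = p1) + of_bool (x = q1)"
      using mem by (simp add: sum.distrib ob)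
    finally show ?thesis using True mem by auto
  next
    case False
    have "dot N (v x) (cutv X) = dot N (cutv X) (cutv {x})" by (simp add: dot_commute)
    also have "\<dots> = (\<Sum>y\<in>X. - (of_bool (y = p1 \<and> x = p2) + of_bool (y = q1 \<and> x = q2)))"
      unfolding dot_cut_cut using axy False x by simp
    also have "\<dots> = - of_bool (x = p2) - of_bool (x = q2)"
      using mem fin ob[of X p1 "x = p2"] ob[of X q1 "x = q2"]
      by (simp add: sum.distrib sum_negf sum_subtractf conj_commute)
    finally show ?thesis using False mem by auto
  qed
  have "dot N (cmb c) (cutv X) = (\<Sum>x\<in>V. c x * (of_bool (x = p1) + of_bool (x = q1) - of_bool (x = p2) - of_bool (x = q2)))"
    unfolding dot_cmb using vx by (intro sum.cong) auto
  also have "\<dots> = c p1 + c q1 - c p2 - c q2"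
    using mem ob'[of p1] ob'[of q1] ob'[of p2] ob'[of q2]
    by (simp add: distrib_left right_diff_distrib sum.distrib sum_subtractf subset_iff)
  finally show ?thesis .
qed

text \<open>The Dirichlet form of the graph: the rows of \<open>a\<close> sum to 0, so only
  differences of coefficients count. The double sum takes every edge in both orders, whence the
  factor 2.\<close>

lemma dot_cmb_cmb:
  "2 * dot N (cmb c) (cmb d) = - (\<Sum>x\<in>V. \<Sum>y\<in>V. a x y * ((c x - c y) * (d x - d y)))"
proof -
  have row: "(\<Sum>y\<in>V. a x y) = 0" for x
  proof -
    have "(\<Sum>y\<in>V. a x y) = dot N (cutv {x}) (cutv V)" unfolding dot_cut_cut by simp
    then show ?thesis by (simp add: cut_all dot_zero)
  qed
  have col: "(\<Sum>x\<in>V. a x y) = 0" for y using row[of y] by (simp add: a_sym)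
  have cd: "dot N (cmb c) (cmb d) = (\<Sum>x\<in>V. \<Sum>y\<in>V. a x y * (c x * d y))" for c d
  proof -
    have "dot N (v x) (cmb d) = (\<Sum>y\<in>V. d y * a x y)" for x
      unfolding dot_commute[of N "v x"] dot_cmb a_def by (simp add: dot_commute)
    then show ?thesis unfolding dot_cmb by (simp add: sum_distrib_left mult_ac)
  qed
  have "(\<Sum>x\<in>V. \<Sum>y\<in>V. a x y * ((c x - c y) * (d x - d y))) =
      (\<Sum>x\<in>V. \<Sum>y\<in>V. a x y * (c x * d x)) - (\<Sum>x\<in>V. \<Sum>y\<in>V. a x y * (c x * d y))
      - (\<Sum>x\<in>V. \<Sum>y\<in>V. a x y * (d x * c y)) + (\<Sum>x\<in>V. \<Sum>y\<in>V. a x y * (c y * d y))"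
    by (simp add: algebra_simps sum.distrib sum_subtractf)
  also have "(\<Sum>x\<in>V. \<Sum>y\<in>V. a x y * (c x * d x)) = 0"
    using row by (simp add: sum_distrib_right[symmetric])
  also have "(\<Sum>x\<in>V. \<Sum>y\<in>V. a x y * (c y * d y)) = 0"
    by (subst sum.swap) (simp add: sum_distrib_right[symmetric] col)
  also have "(\<Sum>x\<in>V. \<Sum>y\<in>V. a x y * (d x * c y)) = dot N (cmb d) (cmb c)" by (simp add: cd)
  finally show ?thesis by (simp add: cd[of c d, symmetric] dot_commute)
qed

end

subsection \<open>The two types of large coefficients\<close>

definition xv :: "nat set \<Rightarrow> nat \<Rightarrow> nat \<Rightarrow> int" where
  "xv A k = (\<lambda>j. of_bool (j \<in> A) - of_bool (j = k))"

definition perp :: "(nat \<Rightarrow> int) \<Rightarrow> nat \<Rightarrow> (nat \<Rightarrow> int) set" where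
  "perp s N = {x \<in> zvec N. dot N x s = 0}"

lemma dot_xv:
  assumes "A \<subseteq> {..<N}" "k < N"
  shows "dot N (xv A k) z = (\<Sum>i\<in>A. z i) - z k"
proof -
  have "(\<Sum>j<N. of_bool (j \<in> A) * z j) = (\<Sum>j\<in>A. z j)"
    using assms by (intro sum.mono_neutral_cong_right) auto
  moreover have "(\<Sum>j<N. of_bool (j = k) * z j) = z k"
    using assms by (simp add: of_bool_def if_distrib[of "\<lambda>x. x * _"] cong: if_cong)
  ultimately show ?thesis by (simp add: dot_def xv_def left_diff_distrib sum_subtractf)
qed

lemma perp_add: "x \<in> perp s N \<Longrightarrow> y \<in> perp s N \<Longrightarrow> x + y \<in> perp s N"
  by (simp add: perp_def zvec_def dot_add)

lemma perp_diff: "x \<in> perp s N \<Longrightarrow> y \<in> perp s N \<Longrightarrow> x - y \<in> perp s N"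
  by (simp add: perp_def zvec_def dot_diff)

lemma perp_zero: "0 \<in> perp s N"
  by (simp add: perp_def zvec_def dot_zero)

lemma sum_eq_1_int:
  fixes f :: "'a \<Rightarrow> int"
  assumes "finite S" "\<And>x. x \<in> S \<Longrightarrow> f x \<ge> 0" "sum f S = 1"
  shows "\<exists>p\<in>S. \<forall>x\<in>S. f x = of_bool (x = p)"
proof -
  obtain p where p: "p \<in> S" "f p \<noteq> 0" using assms(3) by (metis sum.neutral zero_neq_one)
  have "sum f S = f p + sum f (S - {p})" using p assms(1) by (simp add: sum.remove)
  moreover have nn: "sum f (S - {p}) \<ge> 0" using assms(2) by (intro sum_nonneg) auto
  moreover have "f p \<ge> 1" using assms(2)[OF p(1)] p(2) by simp
  ultimately have fp: "f p = 1" and z: "sum f (S - {p}) = 0" using assms(3) by linarith+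
  have "f x = 0" if "x \<in> S - {p}" for x
    using z that assms(1,2) by (subst (asm) sum_nonneg_eq_0_iff) auto
  then show ?thesis using p fp by (intro bexI[of _ p]) auto
qed

section \<open>Very slack coefficient vectors\<close>

locale slack_vector =
  fixes s :: "nat \<Rightarrow> int" and N m :: nat
  assumes m3: "3 \<le> m" and mN: "m < N"
    and ones: "\<And>i. i < m \<Longrightarrow> s i = 1" and big: "\<And>i. m \<le> i \<Longrightarrow> i < N \<Longrightarrow> s i \<ge> 2"
    and slack: "\<And>k. m \<le> k \<Longrightarrow> k < N \<Longrightarrow> s k \<le> (\<Sum>i<k. s i) - 1"
begin

lemma s_pos: "i < N \<Longrightarrow> s i \<ge> 1"
  using ones[of i] big[of i] by (cases "i < m") auto

lemma xv_in_perp: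
  assumes "A \<subseteq> {..<N}" "k < N" "(\<Sum>i\<in>A. s i) = s k"
  shows "xv A k \<in> perp s N"
  unfolding perp_def using dot_xv[OF assms(1,2)] assms by (auto simp: zvec_def xv_def)

lemma nonneg_zero:
  assumes z: "z \<in> perp s N" and nn: "\<And>i. i < N \<Longrightarrow> z i \<ge> 0"
  shows "z = 0"
proof -
  have "(\<Sum>i<N. z i * s i) = 0" using z by (simp add: perp_def dot_def)
  moreover have "z i * s i \<ge> 0" if "i < N" for i using nn[OF that] s_pos[OF that] by simp
  ultimately have 0: "z i * s i = 0" if "i < N" for i using that by (subst (asm) sum_nonneg_eq_0_iff) auto
  have "z i = 0" for i
    using 0[of i] s_pos[of i] z by (cases "i < N") (auto simp: perp_def zvec_def)
  then show ?thesis by auto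
qed

text \<open>All entries are -1, 0 or 1, so two summands have a product of at most 0 in every
  coordinate. A nonnegative pairing then makes all products vanish, and every entry belongs entirely
  to one summand.\<close>

lemma xv_irr:
  assumes A: "A \<subseteq> {..<N}" "k < N" "k \<notin> A" "(\<Sum>i\<in>A. s i) = s k"
  shows "irreducible_in N (perp s N) (xv A k)"
  unfolding irreducible_in_def
proof (intro conjI ballI impI)
  show "xv A k \<in> perp s N" using A xv_in_perp by simp
  have "xv A k k = -1" using A by (simp add: xv_def)
  then show "xv A k \<noteq> 0" by auto
  fix y y' assume y: "y \<in> perp s N" "y' \<in> perp s N" and eq: "xv A k = y + y'" and dp: "dot N y y' \<ge> 0"
  have e: "y i + y' i = of_bool (i \<in> A) - of_bool (i = k)" for i
    using eq by (metis plus_fun_apply xv_def)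
  have np: "y i * y' i \<le> 0" for i
  proof (rule ccontr)
    assume "\<not> y i * y' i \<le> 0"
    then have "(y i > 0 \<and> y' i > 0) \<or> (y i < 0 \<and> y' i < 0)"
      by (metis linorder_not_le zero_less_mult_iff)
    then have "y i + y' i \<ge> 2 \<or> y i + y' i \<le> -2" by auto
    then show False using e[of i] by (auto simp: of_bool_def split: if_splits)
  qed
  have "(\<Sum>i<N. - (y i * y' i)) \<le> 0" using dp by (simp add: dot_def sum_negf)
  then have "(\<Sum>i<N. - (y i * y' i)) = 0" using np by (intro antisym sum_nonneg) auto
  then have p0: "y i * y' i = 0" if "i < N" for i
    using that np by (subst (asm) sum_nonneg_eq_0_iff) auto
  \<comment> \<open>Coordinate \<open>k\<close> holds the only negative entry, so a summand that
    vanishes there is nonnegative.\<close>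
  have nnz: "z = 0" if z: "z \<in> perp s N" "z k = 0" "\<And>i. i < N \<Longrightarrow> z i = 0 \<or> z i = of_bool (i \<in> A) - of_bool (i = k)" for z
  proof (rule nonneg_zero[OF z(1)])
    fix i assume "i < N"
    then show "z i \<ge> 0" using z(2) z(3)[of i] by (cases "i = k") auto
  qed
  have c: "y i = 0 \<or> y i = of_bool (i \<in> A) - of_bool (i = k)" "y' i = 0 \<or> y' i = of_bool (i \<in> A) - of_bool (i = k)" if "i < N" for i
    using p0[OF that] e[of i] by auto
  have "y k = 0 \<or> y' k = 0" using p0[OF A(2)] by simp
  then show "y = 0 \<or> y' = 0" using nnz[OF y(1)] nnz[OF y(2)] c by blast
qed

text \<open>A vector of norm 1 is a signed basis vector, and \<open>s\<close> has no zero
  coefficient. The bound will show that the edge \<open>h0 t0\<close> is not a bridge.\<close>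

lemma norm_ge_2:
  assumes z: "z \<in> perp s N" "z \<noteq> 0"
  shows "dot N z z \<ge> 2"
proof (rule ccontr)
  assume "\<not> ?thesis"
  moreover have "dot N z z \<noteq> 0" using dot_self_eq_0[of z N] z by (auto simp: perp_def)
  ultimately have "(\<Sum>i<N. z i * z i) = 1" using dot_self_nonneg[of N z] by (simp add: dot_def)
  then obtain p where p: "p < N" "\<And>i. i < N \<Longrightarrow> z i * z i = of_bool (i = p)"
    using sum_eq_1_int[of "{..<N}" "\<lambda>i. z i * z i"] by auto
  have z0: "z i = 0" if "i < N" "i \<noteq> p" for i using p(2)[OF that(1)] that by simp
  have "dot N z s = z p * s p"
    unfolding dot_def using p(1) z0 by (subst sum.remove[of _ p]) (auto intro!: sum.neutral)
  then have "z p * s p = 0" using z by (simp add: perp_def)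
  then show False using p(2)[OF p(1)] s_pos[OF p(1)] by auto
qed

text \<open>The slack pays for two coordinates: without the ones at 0 and 1 the bound
  \<open>s k \<le> (\<Sum>i<k. s i) - 1\<close> still is the changemaker inequality for the
  remaining coefficients.\<close>

lemma step_bound:
  assumes "2 \<le> k" "k < N"
  shows "s k \<le> 1 + (\<Sum>i\<in>{2..<k}. s i)"
proof (cases "k < m")
  case True
  have "(\<Sum>i\<in>{2..<k}. s i) \<ge> 0"
  proof (rule sum_nonneg)
    fix i assume "i \<in> {2..<k}"
    then show "0 \<le> s i" using s_pos[of i] assms by simp
  qed
  then show ?thesis using ones[OF True] by simp
next
  case False
  have "{..<k} = insert 0 (insert 1 {2..<k})" using assms by auto
  then have "(\<Sum>i<k. s i) = s 0 + (s 1 + (\<Sum>i\<in>{2..<k}. s i))" by simp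
  then show ?thesis using slack[of k] False assms ones[of 0] ones[of 1] m3 by simp
qed

lemma subset_sum:
  "k \<le> N \<Longrightarrow> 0 \<le> t \<Longrightarrow> t \<le> (\<Sum>i\<in>{2..<k}. s i) \<Longrightarrow> \<exists>D\<subseteq>{2..<k}. (\<Sum>i\<in>D. s i) = t"
proof (induction k arbitrary: t)
  case 0
  then show ?case by auto
next
  case (Suc k)
  show ?case
  proof (cases "2 \<le> k")
    case False
    then have "{2..<Suc k} = {}" by auto
    then show ?thesis using Suc.prems by (intro exI[of _ "{}"]) auto
  next
    case True
    have split: "(\<Sum>i\<in>{2..<Suc k}. s i) = (\<Sum>i\<in>{2..<k}. s i) + s k" using True by simp
    show ?thesis
    proof (cases "t \<le> (\<Sum>i\<in>{2..<k}. s i)")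
      case True
      then obtain D where "D \<subseteq> {2..<k}" "(\<Sum>i\<in>D. s i) = t" using Suc by (metis Suc_leD)
      then show ?thesis by (intro exI[of _ D]) auto
    next
      case False
      then have "0 \<le> t - s k" "t - s k \<le> (\<Sum>i\<in>{2..<k}. s i)"
        using step_bound[OF True] Suc.prems split by auto
      then obtain D where D: "D \<subseteq> {2..<k}" "(\<Sum>i\<in>D. s i) = t - s k" using Suc by (metis Suc_leD)
      have "finite D" "k \<notin> D" using D finite_subset by auto
      then have "(\<Sum>i\<in>insert k D. s i) = t" using D by simp
      then show ?thesis using D True by (intro exI[of _ "insert k D"]) auto
    qed
  qed
qed

text \<open>\<open>s k - 1\<close> is a subset sum over the coordinates from 2 on, and the missing 1
  is supplied by one more coordinate with coefficient one. Hence at least one and at most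
  \<open>m - 1\<close> ones are used, and coordinate 0 can always be left out.\<close>

lemma changemaker_representation:
  assumes k: "m \<le> k" "k < N"
  obtains D j where "D \<subseteq> {m..<k}" "1 \<le> j" "j \<le> m - 1" "int j + (\<Sum>i\<in>D. s i) = s k"
proof -
  have "s k - 1 \<ge> 0" "s k - 1 \<le> (\<Sum>i\<in>{2..<k}. s i)"
    using big[OF k] step_bound[of k] k m3 by auto
  then obtain E where E: "E \<subseteq> {2..<k}" "(\<Sum>i\<in>E. s i) = s k - 1"
    using subset_sum[of k] k by (metis less_imp_le)
  define E1 where "E1 = E \<inter> {2..<m}"
  define D where "D = E \<inter> {m..<k}"
  have fin: "finite E1" "finite D" by (auto simp: E1_def D_def)
  have "E = E1 \<union> D" using E(1) by (auto simp: E1_def D_def)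
  moreover have "E1 \<inter> D = {}" by (auto simp: E1_def D_def)
  ultimately have "(\<Sum>i\<in>E. s i) = (\<Sum>i\<in>E1. s i) + (\<Sum>i\<in>D. s i)" using fin sum.union_disjoint by metis
  moreover have "(\<Sum>i\<in>E1. s i) = (\<Sum>i\<in>E1. 1)" using ones by (intro sum.cong) (auto simp: E1_def)
  ultimately have "int (card E1 + 1) + (\<Sum>i\<in>D. s i) = s k" using E(2) by simp
  moreover have "card E1 \<le> card {2..<m}" by (intro card_mono) (auto simp: E1_def)
  then have "card E1 + 1 \<le> m - 1" using m3 by simp
  ultimately show ?thesis using that[of D "card E1 + 1"] by (auto simp: D_def)
qed

lemma ones_sum: "T \<subseteq> {..<m} \<Longrightarrow> (\<Sum>i\<in>T. s i) = int (card T)"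
  using ones by (subst sum.cong[of T T s "\<lambda>_. 1"]) auto

text \<open>Coordinates below \<^term>\<open>m\<close> all carry coefficient one, so only their number matters.\<close>

lemma xv_irr_ones:
  assumes T: "T \<subseteq> {..<m}" and D: "D \<subseteq> {m..<k}" and k: "m \<le> k" "k < N"
    and sum: "int (card T) + (\<Sum>i\<in>D. s i) = s k"
  shows "irreducible_in N (perp s N) (xv (T \<union> D) k)"
proof (rule xv_irr)
  have fin: "finite T" "finite D" using T D finite_subset by auto
  have "T \<inter> D = {}" using T D by fastforce
  then show "(\<Sum>i\<in>T \<union> D. s i) = s k" using fin ones_sum[OF T] sum by (simp add: sum.union_disjoint)
  show "T \<union> D \<subseteq> {..<N}" "k < N" "k \<notin> T \<union> D" using T D k by auto
qed

lemma xv_irr_pair: "i < m \<Longrightarrow> j < m \<Longrightarrow> i \<noteq> j \<Longrightarrow> irreducible_in N (perp s N) (xv {i} j)"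
  using ones mN by (intro xv_irr) auto

end

section \<open>The three pieces of the graph\<close>

locale slack_superbase = slack_vector s N m + superbase_lattice N K "perp s N" v
  for s N m K v
begin

lemma pieceI:
  assumes U: "X \<union> Y \<union> Z = V" "X \<inter> Y = {}" "X \<inter> Z = {}" "Y \<inter> Z = {}"
    and m: "p1 \<in> X" "p2 \<in> Y" "q1 \<in> X" "q2 \<in> Z"
    and aY: "\<And>x y. x \<in> X \<Longrightarrow> y \<in> Y \<Longrightarrow> a x y = - of_bool (x = p1 \<and> y = p2)"
    and aZ: "\<And>x y. x \<in> X \<Longrightarrow> y \<in> Z \<Longrightarrow> a x y = - of_bool (x = q1 \<and> y = q2)"
  shows "piece X p1 p2 q1 q2"
proof -
  have VX: "V - X = Y \<union> Z" using U by blast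
  have "a x y = - (of_bool (x = p1 \<and> y = p2) + of_bool (x = q1 \<and> y = q2))" if x: "x \<in> X" and y: "y \<in> Y \<union> Z" for x y
  proof (cases "y \<in> Y")
    case True
    then have "y \<noteq> q2" using U m by auto
    then show ?thesis using aY[OF x True] by simp
  next
    case False
    then have "y \<noteq> p2" "y \<in> Z" using y m by auto
    then show ?thesis using aZ[OF x] by simp
  qed
  moreover have "p2 \<noteq> q2" using U m by auto
  ultimately show ?thesis unfolding piece_def VX using U m by auto
qed

text \<open>Every edge between the two sets contributes -1 to the pairing.\<close>

lemma unit_edge:
  assumes "X \<subseteq> V" "Y \<subseteq> V" "X \<inter> Y = {}" "dot N (cutv X) (cutv Y) = -1"
  obtains p q where "p \<in> X" "q \<in> Y" "\<And>x y. x \<in> X \<Longrightarrow> y \<in> Y \<Longrightarrow> a x y = - of_bool (x = p \<and> y = q)"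
proof -
  have fin: "finite (X \<times> Y)" using assms finite_subV by simp
  have nn: "- a (fst z) (snd z) \<ge> 0" if "z \<in> X \<times> Y" for z
  proof -
    have "fst z \<in> X" "snd z \<in> Y" using that by auto
    then have "fst z \<in> V" "snd z \<in> V" "fst z \<noteq> snd z" using assms(1-3) by auto
    then show ?thesis using a_nonpos by simp
  qed
  have "(\<Sum>z\<in>X \<times> Y. - a (fst z) (snd z)) = 1"
    using assms(4) unfolding dot_cut_cut by (simp add: sum.cartesian_product case_prod_beta sum_negf)
  from sum_eq_1_int[OF fin nn this] obtain z where z: "z \<in> X \<times> Y"
    "\<And>w. w \<in> X \<times> Y \<Longrightarrow> - a (fst w) (snd w) = of_bool (w = z)" by blast
  show ?thesis
  proof (rule that[of "fst z" "snd z"])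
    fix x y assume "x \<in> X" "y \<in> Y"
    then have "- a x y = of_bool ((x, y) = z)" using z(2)[of "(x, y)"] by simp
    then show "a x y = - of_bool (x = fst z \<and> y = snd z)" by (auto simp: prod_eq_iff)
  qed (use z in auto)
qed

end

text \<open>The single edges between the three pieces are \<open>h0 t0\<close>, \<open>hi ti\<close> and \<open>hj tj\<close>; the subscript is the
  basis vector of positive sign in the cut containing the head.\<close>

locale unit_triangle = slack_superbase s N m K v for s N m K v +
  fixes i j h0 t0 hi ti hj tj :: nat and A B C :: "nat set"
  assumes ij: "(i = 1 \<and> j = 2) \<or> (i = 2 \<and> j = 1)"
    and parts: "A \<union> B \<union> C = V" "A \<inter> B = {}" "A \<inter> C = {}" "B \<inter> C = {}"
    and cuts: "cutv C = xv {i} 0" "cutv A = xv {j} i" "cutv B = xv {0} j"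
    and pieces: "piece C hi ti t0 h0" "piece A hj tj ti hi" "piece B h0 t0 tj hj"

context slack_superbase begin

text \<open>The cuts \<open>R1\<close> and \<open>R2\<close> of \<open>xv {1} 0\<close> and
  \<open>xv {2} 0\<close> are nested: the difference of these vectors is again a cut, but for
  crossing sets its coefficients would differ by 2 somewhere. The smaller set, the difference and
  the outside are the three pieces, and pairings of -1 give single edges between them. Which of the
  two cuts is smaller is not determined, hence \<open>i\<close> and \<open>j\<close>.\<close>

lemma unit_triangle_exists: "\<exists>i j h0 t0 hi ti hj tj A B C. unit_triangle s N m K v i j h0 t0 hi ti hj tj A B C"
proof -
  have lt: "0 < m" "1 < m" "2 < m" using m3 by auto
  obtain R1 where R1: "R1 \<subseteq> V" "R1 \<noteq> {}" "R1 \<noteq> V" "xv {1} 0 = cutv R1"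
    using irr_cut[OF xv_irr_pair[OF lt(2,1)]] by auto
  obtain R2 where R2: "R2 \<subseteq> V" "R2 \<noteq> {}" "R2 \<noteq> V" "xv {2} 0 = cutv R2"
    using irr_cut[OF xv_irr_pair[OF lt(3,1)]] by auto
  obtain T where T: "T \<subseteq> V" "T \<noteq> {}" "T \<noteq> V" "xv {2} 1 = cutv T"
    using irr_cut[OF xv_irr_pair[OF lt(3,2)]] by auto
  have "xv {2} 0 - xv {1} 0 = (xv {2} 1 :: nat \<Rightarrow> int)" by (rule ext) (simp add: xv_def)
  then have "cmb (\<lambda>x. of_bool (x \<in> R2) - of_bool (x \<in> R1)) = cmb (\<lambda>x. of_bool (x \<in> T))"
    using R1 R2 T by (simp add: cut_cmb cmb_diff[symmetric])
  then have d: "(of_bool (x \<in> R2) - of_bool (x \<in> R1)) - (of_bool (y \<in> R2) - of_bool (y \<in> R1)) =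
      (of_bool (x \<in> T) - of_bool (y \<in> T) :: int)" if "x \<in> V" "y \<in> V" for x y
    using cmb_eq that by blast
  have nest: "R1 \<subseteq> R2 \<or> R2 \<subseteq> R1"
  proof (rule ccontr)
    assume "\<not> ?thesis"
    then obtain x y where "x \<in> R1 - R2" "y \<in> R2 - R1" by blast
    moreover from this have "x \<in> V" "y \<in> V" using R1(1) R2(1) by auto
    ultimately show False using d[of x y] by (auto simp: of_bool_def split: if_splits)
  qed
  have "\<exists>i j Ri Rj. ((i = 1 \<and> j = 2) \<or> (i = 2 \<and> j = 1)) \<and> Ri \<subseteq> Rj \<and> Rj \<subseteq> V \<and>
      cutv Ri = xv {i} 0 \<and> cutv Rj = xv {j} 0"
    using nest
  proof
    assume "R1 \<subseteq> R2" then show ?thesis using R1 R2 by (intro exI[of _ 1] exI[of _ 2] exI[of _ R1] exI[of _ R2]) auto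
  next
    assume "R2 \<subseteq> R1" then show ?thesis using R1 R2 by (intro exI[of _ 2] exI[of _ 1] exI[of _ R2] exI[of _ R1]) auto
  qed
  then obtain i j Ri Rj where ij: "(i = 1 \<and> j = 2) \<or> (i = 2 \<and> j = (1::nat))" and R: "Ri \<subseteq> Rj" "Rj \<subseteq> V"
      "cutv Ri = xv {i} 0" "cutv Rj = xv {j} 0" by blast
  define A B where "A = Rj - Ri" "B = V - Rj"
  have sub: "Ri \<subseteq> V" "A \<subseteq> V" "B \<subseteq> V" using R by (auto simp: A_B_def)
  have parts: "A \<union> B \<union> Ri = V" "A \<inter> B = {}" "A \<inter> Ri = {}" "B \<inter> Ri = {}" using R by (auto simp: A_B_def)
  have cB: "cutv B = xv {0} j" unfolding A_B_def using cut_compl[OF R(2)] R(4) ij by (auto simp: xv_def fun_eq_iff)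
  have "cutv (Ri \<union> A) = cutv Ri + cutv A" using finite_subV[OF sub(1)] finite_subV[OF sub(2)] parts by (intro cut_union) auto
  moreover have "Ri \<union> A = Rj" using R by (auto simp: A_B_def)
  ultimately have "cutv A = cutv Rj - cutv Ri" by simp
  then have cA: "cutv A = xv {j} i" unfolding R using ij by (auto simp: xv_def fun_eq_iff)
  have N3: "3 < N" using m3 mN by simp
  have "dot N (xv {i} 0) (xv {j} i) = -1" using dot_xv[of "{i}" N 0 "xv {j} i"] N3 ij by (auto simp: xv_def)
  then obtain hi ti where i: "hi \<in> Ri" "ti \<in> A" "\<And>x y. x \<in> Ri \<Longrightarrow> y \<in> A \<Longrightarrow> a x y = - of_bool (x = hi \<and> y = ti)"
    using unit_edge[OF sub(1,2)] parts R(3) cA by (metis inf_commute)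
  have "dot N (xv {j} i) (xv {0} j) = -1" using dot_xv[of "{j}" N i "xv {0} j"] N3 ij by (auto simp: xv_def)
  then obtain hj tj where j: "hj \<in> A" "tj \<in> B" "\<And>x y. x \<in> A \<Longrightarrow> y \<in> B \<Longrightarrow> a x y = - of_bool (x = hj \<and> y = tj)"
    using unit_edge[OF sub(2,3)] parts cA cB by metis
  have "dot N (xv {0} j) (xv {i} 0) = -1" using dot_xv[of "{0}" N j "xv {i} 0"] N3 ij by (auto simp: xv_def)
  then obtain h0 t0 where o: "h0 \<in> B" "t0 \<in> Ri" "\<And>x y. x \<in> B \<Longrightarrow> y \<in> Ri \<Longrightarrow> a x y = - of_bool (x = h0 \<and> y = t0)"
    using unit_edge[OF sub(3,1)] parts cB R(3) by metis
  have i': "a x y = - of_bool (x = ti \<and> y = hi)" if "x \<in> A" "y \<in> Ri" for x y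
    using i(3)[OF that(2,1)] a_sym[of x y] by (simp add: conj_commute)
  have j': "a x y = - of_bool (x = tj \<and> y = hj)" if "x \<in> B" "y \<in> A" for x y
    using j(3)[OF that(2,1)] a_sym[of x y] by (simp add: conj_commute)
  have o': "a x y = - of_bool (x = t0 \<and> y = h0)" if "x \<in> Ri" "y \<in> B" for x y
    using o(3)[OF that(2,1)] a_sym[of x y] by (simp add: conj_commute)
  have "piece Ri hi ti t0 h0"
    by (rule pieceI[of Ri A B]) (use parts i o o' in auto)
  moreover have "piece A hj tj ti hi"
    by (rule pieceI[of A B Ri]) (use parts i j i' in auto)
  moreover have "piece B h0 t0 tj hj"
    by (rule pieceI[of B Ri A]) (use parts o j j' in auto)
  ultimately have "unit_triangle_axioms N K v i j h0 t0 hi ti hj tj A B Ri"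
    using ij parts R(3) cA cB by (intro unit_triangle_axioms.intro) auto
  then have "unit_triangle s N m K v i j h0 t0 hi ti hj tj A B Ri"
    using slack_superbase_axioms by (intro unit_triangle.intro)
  then show ?thesis by blast
qed

end

section \<open>Coefficient differences along the three edges\<close>

context unit_triangle begin

definition f0 where "f0 = coeff_diff h0 t0"
definition fi where "fi = coeff_diff hi ti"
definition fj where "fj = coeff_diff hj tj"
text \<open>The choice of coordinate 0 is immaterial: by \<open>coord\<close>, coordinates
  \<open>i\<close> and \<open>j\<close> with \<open>fi\<close> and \<open>fj\<close> give the same
  number.\<close>

definition g where "g z = z 0 - f0 z"

lemma memV: "h0 \<in> V" "t0 \<in> V" "hi \<in> V" "ti \<in> V" "hj \<in> V" "tj \<in> V"
  and memP: "h0 \<in> B" "t0 \<in> C" "hi \<in> C" "ti \<in> A" "hj \<in> A" "tj \<in> B"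
  and subV: "A \<subseteq> V" "B \<subseteq> V" "C \<subseteq> V"
  using pieces parts unfolding piece_def by auto

lemma N3: "3 < N" using m3 mN by simp

text \<open>The pairing with the cut of a piece is computed twice: as a difference of two
  coordinates, and as the sum of the coefficient drops along the two edges leaving the
  piece.\<close>

lemma coord:
  assumes z: "z \<in> perp s N"
  shows "z i - fi z = g z" "z j - fj z = g z" "z 0 - f0 z = g z"
proof -
  obtain c where c: "z = cmb c" using z cmbE by blast
  have f: "fi z = c hi - c ti" "fj z = c hj - c tj" "f0 z = c h0 - c t0"
    unfolding c fi_def fj_def f0_def using memV by (simp_all add: coeff_diff_cmb)
  have "dot N z (xv {i} 0) = c hi + c t0 - c ti - c h0"
    using dot_cmb_piece[OF pieces(1), of c] c cuts by simp
  moreover have "dot N z (xv {i} 0) = z i - z 0"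
    using dot_xv[of "{i}" N 0 z] N3 ij by (auto simp: dot_commute)
  ultimately show "z i - fi z = g z" using f by (simp add: g_def)
  have "dot N z (xv {0} j) = c h0 + c tj - c t0 - c hj"
    using dot_cmb_piece[OF pieces(3), of c] c cuts by simp
  moreover have "dot N z (xv {0} j) = z 0 - z j"
    using dot_xv[of "{0}" N j z] N3 ij by (auto simp: dot_commute)
  ultimately show "z j - fj z = g z" using f by (simp add: g_def)
  show "z 0 - f0 z = g z" by (simp add: g_def)
qed

lemma f_add:
  assumes "x \<in> perp s N" "y \<in> perp s N"
  shows "f0 (x + y) = f0 x + f0 y" "fi (x + y) = fi x + fi y" "fj (x + y) = fj x + fj y" "g (x + y) = g x + g y"
  unfolding g_def f0_def fi_def fj_def using assms memV by (simp_all add: coeff_diff_add)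

lemma f_diff:
  assumes "x \<in> perp s N" "y \<in> perp s N"
  shows "f0 (x - y) = f0 x - f0 y" "fi (x - y) = fi x - fi y" "fj (x - y) = fj x - fj y" "g (x - y) = g x - g y"
  unfolding g_def f0_def fi_def fj_def using assms memV by (simp_all add: coeff_diff_diff)

lemma f_zero: "f0 0 = 0" "fi 0 = 0" "fj 0 = 0" "g 0 = 0"
  using f_diff[OF perp_zero perp_zero] by simp_all

lemma f_cut:
  assumes "S \<subseteq> V"
  shows "f0 (cutv S) = of_bool (h0 \<in> S) - of_bool (t0 \<in> S)"
    "fi (cutv S) = of_bool (hi \<in> S) - of_bool (ti \<in> S)"
    "fj (cutv S) = of_bool (hj \<in> S) - of_bool (tj \<in> S)"
  unfolding f0_def fi_def fj_def using assms memV by (simp_all add: coeff_diff_cut)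

text \<open>Equal coordinates mean equal coefficient differences along two of the edges, and some
  piece has exactly these two as its outgoing edges. If the differences were nonzero, the cut of
  \<open>z\<close> would leave this piece along one edge and return along the other. So they are 0,
  and \<open>g\<close> is the coordinate itself.\<close>

lemma irr_equal_coords:
  assumes z: "irreducible_in N (perp s N) z"
  shows "z 0 = z i \<Longrightarrow> g z = z 0" "z 0 = z j \<Longrightarrow> g z = z 0" "z i = z j \<Longrightarrow> g z = z i"
proof -
  obtain R where R: "R \<subseteq> V" "z = cutv R" using irr_cut[OF z] by metis
  have zL: "z \<in> perp s N" using z by (simp add: irreducible_in_def)
  have iR: "irreducible_in N (perp s N) (cutv R)" using z R by simp
  have key: "of_bool (p1 \<in> R) - of_bool (p2 \<in> R) = (0::int)"
    if X: "piece X p1 p2 q1 q2" and eq: "of_bool (p1 \<in> R) - of_bool (p2 \<in> R) = (of_bool (q2 \<in> R) - of_bool (q1 \<in> R) :: int)"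
    for X p1 p2 q1 q2
    using piece_no_return[OF X R(1) iR] piece_no_return[OF piece_swap[OF X] R(1) iR] eq
    by (auto simp: of_bool_def split: if_splits)
  note F = f_cut[OF R(1), folded R(2)] coord[OF zL]
  show "g z = z 0" if "z 0 = z i"
    using key[OF pieces(1)] F that by simp
  show "g z = z 0" if "z 0 = z j"
    using key[OF pieces(3)] F that by simp
  show "g z = z i" if "z i = z j"
    using key[OF pieces(2)] F that by simp
qed

lemma irr_coords_012:
  assumes z: "irreducible_in N (perp s N) z"
  shows "z 0 = z 1 \<Longrightarrow> g z = z 0" "z 0 = z 2 \<Longrightarrow> g z = z 0" "z 1 = z 2 \<Longrightarrow> g z = z 1"
  using irr_equal_coords[OF z] ij by auto

text \<open>With \<open>2 \<le> l \<le> m - 2\<close> the ones can be placed in two ways. Using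
  coordinates 1 and 2 gives \<open>g = 1\<close>, leaving out 0 and 1 gives \<open>g = 0\<close>.
  The two vectors differ by \<open>xv {Suc l} 1\<close>, which vanishes at 0 and 2 and so has
  \<open>g = 0\<close>; this contradicts additivity.\<close>

lemma number_of_ones:
  assumes k: "m \<le> k" "k < N" and D: "D \<subseteq> {m..<k}" and l: "1 \<le> l" "l \<le> m - 1" "int l + (\<Sum>i\<in>D. s i) = s k"
  shows "l = 1 \<or> l = m - 1"
proof (rule ccontr)
  assume "\<not> ?thesis"
  then have l2: "2 \<le> l" "l + 1 < m" using l by auto
  let ?z = "xv ({1..l} \<union> D) k" and ?z' = "xv ({2..Suc l} \<union> D) k" and ?e = "xv {Suc l} 1"
  have D': "x \<ge> m" if "x \<in> D" for x using D that by auto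
  have z: "irreducible_in N (perp s N) ?z" "irreducible_in N (perp s N) ?z'"
    by (rule xv_irr_ones; use l2 D k l in auto)+
  have e: "irreducible_in N (perp s N) ?e" using xv_irr_pair[of "Suc l" 1] l2 by simp
  have gz: "g ?z = 1" using irr_coords_012(3)[OF z(1)] l2 k m3 D' by (auto simp: xv_def)
  have "0 \<notin> D" "1 \<notin> D" "k \<noteq> 0" "k \<noteq> 1" using D'[of 0] D'[of 1] m3 k by auto
  then have gz': "g ?z' = 0" using irr_coords_012(1)[OF z(2)] by (simp add: xv_def)
  have ge: "g ?e = 0" using irr_coords_012(2)[OF e] l2 by (auto simp: xv_def)
  have "?z' = ?z + ?e" using l2 D' by (fastforce simp: xv_def fun_eq_iff)
  then have "g ?z' = g ?z + g ?e" using f_add(4) z e by (simp add: irreducible_in_def)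
  then show False using gz gz' ge by simp
qed

end

context slack_superbase begin

lemma ones_type_cases:
  assumes k: "m \<le> k" "k < N"
  shows "\<exists>D\<subseteq>{m..<k}. 1 + (\<Sum>i\<in>D. s i) = s k \<or> int (m - 1) + (\<Sum>i\<in>D. s i) = s k"
proof -
  obtain i j h0 t0 hi ti hj tj A B C where "unit_triangle s N m K v i j h0 t0 hi ti hj tj A B C"
    using unit_triangle_exists by blast
  then interpret unit_triangle s N m K v i j h0 t0 hi ti hj tj A B C .
  obtain D l where Dl: "D \<subseteq> {m..<k}" "1 \<le> l" "l \<le> m - 1" "int l + (\<Sum>i\<in>D. s i) = s k"
    using changemaker_representation[OF k] by blast
  show ?thesis
    using number_of_ones[OF k Dl]
  proof
    assume "l = 1"
    then show ?thesis using Dl by (intro exI[of _ D]) simp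
  next
    assume "l = m - 1"
    then show ?thesis using Dl by (intro exI[of _ D]) simp
  qed
qed

end

subsection \<open>Orthogonality of the two types\<close>

inductive zgenp :: "(nat \<Rightarrow> int) set \<Rightarrow> (nat \<Rightarrow> int) \<Rightarrow> bool" for X where
  zero: "zgenp X 0"
| add: "zgenp X z \<Longrightarrow> x \<in> X \<Longrightarrow> zgenp X (z + x)"
| sub: "zgenp X z \<Longrightarrow> x \<in> X \<Longrightarrow> zgenp X (z - x)"

definition zgen :: "(nat \<Rightarrow> int) set \<Rightarrow> (nat \<Rightarrow> int) set" where
  "zgen X = Collect (zgenp X)"

lemma zgen_zero: "0 \<in> zgen X"
  and zgen_add: "z \<in> zgen X \<Longrightarrow> x \<in> X \<Longrightarrow> z + x \<in> zgen X"
  and zgen_sub: "z \<in> zgen X \<Longrightarrow> x \<in> X \<Longrightarrow> z - x \<in> zgen X"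
  by (simp_all add: zgen_def zgenp.intros)

lemma zgen_induct [consumes 1, case_names zero add sub]:
  assumes "z \<in> zgen X" "P 0" "\<And>z x. z \<in> zgen X \<Longrightarrow> P z \<Longrightarrow> x \<in> X \<Longrightarrow> P (z + x)"
    "\<And>z x. z \<in> zgen X \<Longrightarrow> P z \<Longrightarrow> x \<in> X \<Longrightarrow> P (z - x)"
  shows "P z"
  using assms unfolding zgen_def mem_Collect_eq by (rule zgenp.induct)

lemma zgen_plus: assumes "y \<in> zgen X" "z \<in> zgen X" shows "z + y \<in> zgen X"
  using assms(1)
proof (rule zgen_induct)
  show "z + 0 \<in> zgen X" using assms(2) by simp
  fix y x assume "z + y \<in> zgen X" "x \<in> X"
  then have "(z + y) + x \<in> zgen X" "(z + y) - x \<in> zgen X" using zgen_add zgen_sub by blast+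
  then show "z + (y + x) \<in> zgen X" "z + (y - x) \<in> zgen X" by (simp_all add: algebra_simps)
qed

lemma zgen_minus: assumes "y \<in> zgen X" "z \<in> zgen X" shows "z - y \<in> zgen X"
  using assms(1)
proof (rule zgen_induct)
  show "z - 0 \<in> zgen X" using assms(2) by simp
  fix y x assume "z - y \<in> zgen X" "x \<in> X"
  then have "(z - y) - x \<in> zgen X" "(z - y) + x \<in> zgen X" using zgen_add zgen_sub by blast+
  then show "z - (y + x) \<in> zgen X" "z - (y - x) \<in> zgen X" by (simp_all add: algebra_simps)
qed

lemma zgen_base: "x \<in> X \<Longrightarrow> x \<in> zgen X"
  using zgen_add[OF zgen_zero] by fastforce

lemma zgen_scale: assumes "x \<in> zgen X" shows "zsmult c x \<in> zgen X"
proof -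
  have n: "zsmult (int n) x \<in> zgen X" for n
  proof (induction n)
    case 0
    have "zsmult (int 0) x = 0" by (rule ext) (simp add: zsmult_def)
    then show ?case using zgen_zero by metis
  next
    case (Suc n)
    have "zsmult (int (Suc n)) x = zsmult (int n) x + x" by (rule ext) (simp add: zsmult_def algebra_simps)
    then show ?case using zgen_plus[OF assms Suc] by metis
  qed
  show ?thesis
  proof (cases "c \<ge> 0")
    case True
    then show ?thesis using n[of "nat c"] by simp
  next
    case False
    have "zsmult c x = 0 - zsmult (- c) x" by (rule ext) (simp add: zsmult_def)
    then show ?thesis using zgen_minus[OF n[of "nat (- c)"] zgen_zero] False by simp
  qed
qed

lemma zgen_mono: assumes "X \<subseteq> Y" shows "zgen X \<subseteq> zgen Y"
proof
  fix z assume "z \<in> zgen X"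
  then show "z \<in> zgen Y" using assms by (induction rule: zgen_induct) (auto intro: zgen_zero zgen_add zgen_sub)
qed

lemma zgen_perp: assumes "z \<in> zgen X" "X \<subseteq> perp s N" shows "z \<in> perp s N"
  using assms by (induction rule: zgen_induct) (auto intro: perp_zero perp_add perp_diff)

lemma zgen_orth:
  assumes "\<And>x y. x \<in> X \<Longrightarrow> y \<in> Y \<Longrightarrow> dot N x y = 0" "z \<in> zgen X" "w \<in> zgen Y"
  shows "dot N z w = 0"
proof -
  have 1: "dot N x w = 0" if x: "x \<in> X" for x
    using assms(3)
  proof (rule zgen_induct)
    show "dot N x 0 = 0" by (rule dot_zero)
    fix z y assume "dot N x z = 0" "y \<in> Y"
    then show "dot N x (z + y) = 0" "dot N x (z - y) = 0"
      using assms(1)[OF x] by (simp_all add: dot_add dot_diff)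
  qed
  show ?thesis
    using assms(2)
  proof (rule zgen_induct)
    show "dot N 0 w = 0" by (rule dot_zero)
    fix z y assume "dot N z w = 0" "y \<in> X"
    then show "dot N (z + y) w = 0" "dot N (z - y) w = 0"
      using 1 by (simp_all add: dot_add dot_diff)
  qed
qed

text \<open>\<open>ty k\<close> tells whether \<open>m - 1\<close> ones or a single one are used to represent \<open>s k\<close>. In both cases
  coordinate 0 is left out.\<close>

locale ones_types = slack_vector s N m for s N m +
  fixes D :: "nat \<Rightarrow> nat set" and ty :: "nat \<Rightarrow> bool"
  assumes D_sub: "\<And>k. m \<le> k \<Longrightarrow> k < N \<Longrightarrow> D k \<subseteq> {m..<k}"
    and D_sum: "\<And>k. m \<le> k \<Longrightarrow> k < N \<Longrightarrow> int (if ty k then m - 1 else 1) + (\<Sum>i\<in>D k. s i) = s k"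
begin

definition x :: "nat \<Rightarrow> nat \<Rightarrow> int" where
  "x k = xv ((if ty k then {1..<m} else {1}) \<union> D k) k"

lemma D_lt: "m \<le> k \<Longrightarrow> k < N \<Longrightarrow> n \<in> D k \<Longrightarrow> m \<le> n \<and> n < k"
  using D_sub[of k] by auto

lemma x_irr: "m \<le> k \<Longrightarrow> k < N \<Longrightarrow> irreducible_in N (perp s N) (x k)"
  unfolding x_def using m3 D_sum[of k] by (intro xv_irr_ones D_sub) auto

lemma x_coords:
  assumes "m \<le> k" "k < N"
  shows "x k 0 = 0" "x k (Suc 0) = 1" "\<And>a. 2 \<le> a \<Longrightarrow> a < m \<Longrightarrow> x k a = of_bool (ty k)"
    "\<And>n. m \<le> n \<Longrightarrow> x k n = of_bool (n \<in> D k) - of_bool (n = k)"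
proof -
  have nD: "n \<notin> D k" if "n < m" for n using D_lt[OF assms, of n] that by auto
  show "x k 0 = 0" using nD[of 0] assms m3 by (simp add: x_def xv_def)
  show "x k (Suc 0) = 1" using nD[of 1] assms m3 by (simp add: x_def xv_def)
  show "x k a = of_bool (ty k)" if "2 \<le> a" "a < m" for a
    using nD[of a] assms that by (simp add: x_def xv_def)
  show "x k n = of_bool (n \<in> D k) - of_bool (n = k)" if "m \<le> n" for n
    using assms that m3 by (simp add: x_def xv_def)
qed

text \<open>\<open>D m\<close> is empty, and a single one does not reach a coefficient of at least
  2. So \<open>G1\<close> contains a vector.\<close>

lemma ty_m: "ty m"
proof (rule ccontr)
  assume "\<not> ty m"
  moreover have "D m = {}" using D_sub[of m] mN by auto
  ultimately show False using D_sum[of m] big[of m] mN by simp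
qed

definition "G1 = {x k | k. m \<le> k \<and> k < N \<and> ty k}"
definition "G0 = {x k | k. m \<le> k \<and> k < N \<and> \<not> ty k} \<union> {xv {a} 1 | a. 2 \<le> a \<and> a < m}"

lemma G_perp: "G1 \<subseteq> perp s N" "G0 \<subseteq> perp s N"
  using x_irr xv_irr_pair[of _ 1] m3 unfolding G1_def G0_def irreducible_in_def by auto

text \<open>Every \<open>k \<ge> 2\<close> has a generator that vanishes at 0 and whose last nonzero
  entry, at \<open>k\<close>, is 1 or -1. Elimination from the top leaves coordinate 1, which
  \<open>s 1 = 1\<close> forces to be 0.\<close>

lemma perp_decomp:
  assumes "z \<in> perp s N" "z 0 = 0"
  shows "\<exists>m1\<in>zgen G1. \<exists>m0\<in>zgen G0. z = m1 + m0"
proof -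
  have "\<And>z. 2 \<le> k \<Longrightarrow> k \<le> N \<Longrightarrow> z \<in> perp s N \<Longrightarrow> z 0 = 0 \<Longrightarrow> (\<forall>n\<ge>k. z n = 0) \<Longrightarrow>
      \<exists>m1\<in>zgen G1. \<exists>m0\<in>zgen G0. z = m1 + m0" for k
  proof (induction k)
    case (Suc k)
    show ?case
    proof (cases "k < 2")
      case True
      then have k: "Suc k = 2" using Suc.prems by simp
      have "dot N z s = (\<Sum>i<N. z i * s i)" by (simp add: dot_def)
      also have "\<dots> = (\<Sum>i\<in>{1}. z i * s i)"
      proof (rule sum.mono_neutral_right)
        show "\<forall>i\<in>{..<N} - {1}. z i * s i = 0"
        proof
          fix i assume "i \<in> {..<N} - {1}"
          then have "i = 0 \<or> i \<ge> 2" by auto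
          then show "z i * s i = 0" using Suc.prems k by auto
        qed
      qed (use Suc.prems k in auto)
      finally have "z 1 = 0" using Suc.prems(3) ones[of 1] m3 by (simp add: perp_def)
      then have "z n = 0" for n
      proof -
        have "n = 0 \<or> n = 1 \<or> n \<ge> 2" by auto
        then show ?thesis using \<open>z 1 = 0\<close> Suc.prems k by auto
      qed
      then have "z = 0 + 0" by auto
      then show ?thesis using zgen_zero by blast
    next
      case False
      then have k: "2 \<le> k" "k < N" using Suc.prems by auto
      define y where "y = (if k < m then xv {k} 1 else - x k)"
      have y: "y 0 = 0" "y k = 1" "\<And>n. n > k \<Longrightarrow> y n = 0"
      proof -
        show "y 0 = 0" using k x_coords(1)[of k] by (auto simp: y_def xv_def)
        have "k \<notin> D k" if "m \<le> k" using D_lt[OF that k(2), of k] by auto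
        then show "y k = 1" using k x_coords(4)[of k k] by (auto simp: y_def xv_def)
        fix n assume n: "n > k"
        have "n \<notin> D k" if "m \<le> k" using D_lt[OF that k(2), of n] n by auto
        then show "y n = 0" using n k x_coords(4)[of k n] by (auto simp: y_def xv_def)
      qed
      have yG: "zsmult (z k) y \<in> zgen G1 \<or> zsmult (z k) y \<in> zgen G0"
      proof (cases "k < m")
        case True
        then have "y \<in> G0" using k by (auto simp: y_def G0_def)
        then show ?thesis using zgen_base zgen_scale by blast
      next
        case False
        then have "- y \<in> G1 \<or> - y \<in> G0" using k by (auto simp: y_def G0_def G1_def)
        moreover have "zsmult (z k) y = zsmult (- z k) (- y)" by (rule ext) (simp add: zsmult_def)
        ultimately show ?thesis using zgen_base zgen_scale by metis
      qed
      then have yp: "zsmult (z k) y \<in> perp s N" using zgen_perp G_perp by metis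
      define w where "w = z - zsmult (z k) y"
      have "w \<in> perp s N" using Suc.prems yp perp_diff by (simp add: w_def)
      moreover have "w 0 = 0" using Suc.prems y by (simp add: w_def zsmult_def)
      moreover have "\<forall>n\<ge>k. w n = 0"
      proof (intro allI impI)
        fix n assume "n \<ge> k"
        then show "w n = 0" using Suc.prems(5) y by (cases "n = k") (auto simp: w_def zsmult_def)
      qed
      ultimately obtain m1 m0 where m: "m1 \<in> zgen G1" "m0 \<in> zgen G0" "w = m1 + m0"
        using Suc.IH[of w] k by (metis less_imp_le)
      have z: "z = m1 + m0 + zsmult (z k) y" using m(3) by (simp add: w_def algebra_simps)
      show ?thesis
        using yG
      proof
        assume "zsmult (z k) y \<in> zgen G1"
        then have "m1 + zsmult (z k) y \<in> zgen G1" using zgen_plus m by blast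
        moreover have "z = (m1 + zsmult (z k) y) + m0" using z by (simp add: algebra_simps)
        ultimately show ?thesis using m by blast
      next
        assume "zsmult (z k) y \<in> zgen G0"
        then have "m0 + zsmult (z k) y \<in> zgen G0" using zgen_plus m by blast
        moreover have "z = m1 + (m0 + zsmult (z k) y)" using z by (simp add: algebra_simps)
        ultimately show ?thesis using m by blast
      qed
    qed
  qed simp
  from this[of N z] show ?thesis using assms m3 mN by (auto simp: perp_def zvec_def)
qed

lemma G_coord0: "z \<in> zgen G1 \<Longrightarrow> z 0 = 0" "z \<in> zgen G0 \<Longrightarrow> z 0 = 0"
proof -
  have "y 0 = 0" if "y \<in> G1 \<union> G0" for y
    using that x_coords(1) by (auto simp: G1_def G0_def xv_def)
  note y0 = this
  have "z 0 = 0" if "z \<in> zgen (G1 \<union> G0)" for z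
    using that by (induction rule: zgen_induct) (simp_all add: y0 del: Un_iff)
  then show "z \<in> zgen G1 \<Longrightarrow> z 0 = 0" "z \<in> zgen G0 \<Longrightarrow> z 0 = 0"
    using zgen_mono[of G1 "G1 \<union> G0"] zgen_mono[of G0 "G1 \<union> G0"] by auto
qed

end

locale typed_triangle = ones_types s N m D ty + unit_triangle s N m K v i j h0 t0 hi ti hj tj A B C
  for s N m D ty K v i j h0 t0 hi ti hj tj A B C
begin

lemma a_h0_t0: "a h0 t0 = -1"
proof -
  have "a h0 t0 = - (of_bool (h0 = h0 \<and> t0 = t0) + of_bool (h0 = tj \<and> t0 = hj))"
    and "(h0, t0) \<noteq> (tj, hj)"
    using pieces(3) memP memV parts unfolding piece_def by blast+
  then show ?thesis by auto
qed

lemma dot_cut_le: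
  assumes "S \<subseteq> V" "T \<subseteq> V" "S \<inter> T = {}" "p \<in> S" "q \<in> T"
  shows "dot N (cutv S) (cutv T) \<le> a p q"
proof -
  have fin: "finite S" "finite T" using assms finite_subV by auto
  have np: "a y z \<le> 0" if "y \<in> S" "z \<in> T" for y z using assms that by (intro a_nonpos) auto
  have "(\<Sum>y\<in>S. \<Sum>z\<in>T. a y z) = (\<Sum>z\<in>T. a p z) + (\<Sum>y\<in>S - {p}. \<Sum>z\<in>T. a y z)"
    using fin assms by (simp add: sum.remove)
  moreover have "(\<Sum>y\<in>S - {p}. \<Sum>z\<in>T. a y z) \<le> 0" using np by (intro sum_nonpos) auto
  moreover have "(\<Sum>z\<in>T. a p z) = a p q + (\<Sum>z\<in>T - {q}. a p z)" using fin assms by (simp add: sum.remove)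
  moreover have "(\<Sum>z\<in>T - {q}. a p z) \<le> 0" using np assms by (intro sum_nonpos) auto
  ultimately show ?thesis unfolding dot_cut_cut by linarith
qed

text \<open>Coordinates 1 and 2 agree if \<open>ty k\<close> holds, coordinates 0 and 2 if it does
  not; this gives \<open>g\<close>. Hence the cut of \<open>x k\<close> crosses the edge
  \<open>h0 t0\<close> exactly if \<open>ty k\<close> holds.\<close>

lemma x_values:
  assumes k: "m \<le> k" "k < N"
  shows "g (x k) = of_bool (ty k)" "f0 (x k) = - of_bool (ty k)"
proof -
  note ir = x_irr[OF k]
  have xL: "x k \<in> perp s N" using ir by (simp add: irreducible_in_def)
  have c: "x k 0 = 0" "x k 1 = 1" "x k 2 = of_bool (ty k)" using x_coords[OF k] m3 by auto
  show gx: "g (x k) = of_bool (ty k)"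
    using irr_coords_012[OF ir] c by (cases "ty k") auto
  then show "f0 (x k) = - of_bool (ty k)" using coord(3)[OF xL] c by simp
qed

text \<open>The cuts of \<open>x k\<close> and of a variant \<open>z\<close> of \<open>x l\<close>
  both cross \<open>h0 t0\<close>, and this common edge makes uncrossing profitable: the vectors
  \<open>y1\<close> and \<open>y2\<close> have the same sum as \<open>z\<close> and
  \<open>x k\<close> but a larger pairing. Entry by entry the gain is at most 1 in total, so
  equality holds everywhere, and a sign argument makes \<open>y1\<close> or \<open>y2\<close>
  vanish.\<close>

lemma x_orth:
  assumes k: "m \<le> k" "k < N" "ty k" and l: "m \<le> l" "l < N" "\<not> ty l"
  shows "dot N (x k) (x l) = 0"
proof -
  have kl: "k \<noteq> l" using k l by auto
  \<comment> \<open>\<open>x l\<close> with its single one moved from coordinate 1 to coordinate 0.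
    This keeps \<open>g = 0\<close> but makes the coefficient difference along \<open>h0 t0\<close>
    equal to 1.\<close>
  define z where "z = xv ({0} \<union> D l) l"
  have zir: "irreducible_in N (perp s N) z" unfolding z_def
    using l m3 D_sum[of l] by (intro xv_irr_ones D_sub) auto
  have nD: "n \<notin> D l" if "n < m" for n using D_lt[OF l(1,2), of n] that by auto
  have zx: "z + xv {1} 0 = x l"
    unfolding z_def x_def xv_def using l(3) nD[of 0] nD[of 1] m3 by (intro ext) auto
  have z_low: "z 0 = 1" "\<And>n. 0 < n \<Longrightarrow> n < m \<Longrightarrow> z n = 0" "\<And>n. m \<le> n \<Longrightarrow> z n = of_bool (n \<in> D l) - of_bool (n = l)"
    using l nD m3 unfolding z_def xv_def by auto
  have zL: "z \<in> perp s N" using zir by (simp add: irreducible_in_def)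
  have "g z = 0" using irr_coords_012(3)[OF zir] z_low m3 by auto
  then have f0z: "f0 z = 1" using coord(3)[OF zL] z_low by simp
  obtain R where R: "R \<subseteq> V" "x k = cutv R" using irr_cut[OF x_irr[OF k(1,2)]] by metis
  obtain Z where Z: "Z \<subseteq> V" "z = cutv Z" using irr_cut[OF zir] by metis
  \<comment> \<open>Passing to the complement reverses the sign, so that both \<open>X\<close> and
    \<open>Z\<close> contain \<open>h0\<close> but not \<open>t0\<close>.\<close>
  define X where "X = V - R"
  have X: "X \<subseteq> V" "cutv X = - x k" using R cut_compl by (auto simp: X_def)
  have hX: "h0 \<in> X" "t0 \<notin> X"
    using f_cut(1)[OF R(1)] x_values(2)[OF k(1,2)] k(3) R memV by (auto simp: X_def of_bool_def split: if_splits)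
  have hZ: "h0 \<in> Z" "t0 \<notin> Z"
    using f_cut(1)[OF Z(1)] f0z Z by (auto simp: of_bool_def split: if_splits)
  have "dot N (cutv (X \<inter> Z)) (cutv (V - (X \<union> Z))) \<le> -1"
    using dot_cut_le[of "X \<inter> Z" "V - (X \<union> Z)" h0 t0] a_h0_t0 hX hZ memV X Z by auto
  then have cross: "dot N (cutv (X - Z)) (cutv (Z - X)) \<le> - dot N (x k) z - 1"
    using cut_cross[OF X(1) Z(1)] X(2) Z(2) by (simp add: dot_minus)
  define y1 y2 where "y1 = cutv (Z - X)" and "y2 = - cutv (X - Z)"
  have "Z - X \<subseteq> V" "X - Z \<subseteq> V" using X Z by auto
  then have yL: "y1 \<in> perp s N" "y2 \<in> perp s N" unfolding y1_def y2_def by (auto intro: cut_in_L L_uminus)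
  have sum_y: "y1 n + y2 n = z n + x k n" for n
  proof -
    have fin: "finite X" "finite Z" using X Z finite_subV by auto
    have "(X \<inter> Z) \<union> (X - Z) = X" "(X \<inter> Z) \<inter> (X - Z) = {}" "(X \<inter> Z) \<union> (Z - X) = Z" "(X \<inter> Z) \<inter> (Z - X) = {}" by auto
    then have "cutv X = cutv (X \<inter> Z) + cutv (X - Z)" "cutv Z = cutv (X \<inter> Z) + cutv (Z - X)"
      using cut_union[of "X \<inter> Z" "X - Z"] cut_union[of "X \<inter> Z" "Z - X"] fin by auto
    then have "cutv Z - cutv X = y1 + y2" by (simp add: y1_def y2_def)
    then have "y1 + y2 = z + x k" using X(2) Z(2) by simp
    then show ?thesis by (metis plus_fun_apply)
  qed
  have dy: "dot N y1 y2 \<ge> dot N (x k) z + 1"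
    using cross by (simp add: y1_def y2_def dot_minus dot_commute)
  \<comment> \<open>The greatest product of two integers whose sum is the entry of
    \<open>z + x k\<close> at \<open>n\<close>: it is 1 where both vectors have entry 1, and 0
    elsewhere.\<close>
  define be where "be = (\<lambda>n. of_bool (n \<in> D k \<and> n \<in> D l) :: int)"
  have xk: "x k n = (if n < m then of_bool (n > 0) else of_bool (n \<in> D k) - of_bool (n = k))" for n
  proof -
    consider "n = 0" | "n = Suc 0" | "2 \<le> n" "n < m" | "m \<le> n" by linarith
    then show ?thesis using x_coords[OF k(1,2)] k(3) m3 by cases auto
  qed
  have zn: "z n = (if n < m then of_bool (n = 0) else of_bool (n \<in> D l) - of_bool (n = l))" for n
    using z_low m3 by (cases "n = 0") (auto simp: not_less)
  have Dk: "n \<in> D k \<Longrightarrow> m \<le> n \<and> n < k" for n using D_lt[OF k(1,2)] .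
  have Dl: "n \<in> D l \<Longrightarrow> m \<le> n \<and> n < l" for n using D_lt[OF l(1,2)] .
  have prodxz: "x k n * z n = be n - (of_bool (l \<in> D k) * of_bool (n = l) + of_bool (k \<in> D l) * of_bool (n = k))" for n
    using Dk[of n] Dl[of n] kl k(1) l(1) unfolding xk zn be_def by (auto simp: of_bool_def)
  have delta: "(\<Sum>n<N. c * of_bool (n = q)) = (c::int)" if "q < N" for c q
    using that by (simp add: of_bool_def if_distrib[of "\<lambda>t. _ * t"] cong: if_cong)
  have dxz: "dot N (x k) z = (\<Sum>n<N. be n) - of_bool (l \<in> D k) - of_bool (k \<in> D l)"
    unfolding dot_def prodxz
    unfolding sum_subtractf sum.distrib delta[OF k(2)] delta[OF l(2)] by simp
  have bound: "y1 n * y2 n \<le> be n" for n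
  proof -
    let ?y = "y1 n + y2 n"
    have "?y = 2 \<and> be n = 1 \<or> (-1 \<le> ?y \<and> ?y \<le> 1 \<and> be n = 0)"
    proof (cases "n < m")
      case True
      then have "n \<notin> D k" using Dk by force
      then show ?thesis unfolding sum_y xk zn be_def using True by simp
    next
      case False
      have "\<not> (n = k \<and> n = l)" "\<not> (n \<in> D k \<and> n = k)" "\<not> (n \<in> D l \<and> n = l)" using kl Dk[of n] Dl[of n] by auto
      moreover have "\<not> (n \<in> D k \<and> n \<in> D l \<and> (n = k \<or> n = l))" using Dk[of n] Dl[of n] by auto
      ultimately show ?thesis unfolding sum_y xk zn be_def using False
        by (cases "n \<in> D k"; cases "n \<in> D l"; cases "n = k"; cases "n = l") auto
    qed
    then show ?thesis
    proof
      assume y: "?y = 2 \<and> be n = 1"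
      then have "y2 n = 2 - y1 n" by simp
      then have "1 - y1 n * y2 n = (y1 n - 1) * (y1 n - 1)" by (simp only:) (simp add: algebra_simps)
      moreover have "(y1 n - 1) * (y1 n - 1) \<ge> 0" by simp
      ultimately show ?thesis using y by linarith
    next
      assume y: "-1 \<le> ?y \<and> ?y \<le> 1 \<and> be n = 0"
      have "y1 n * y2 n \<le> 0"
      proof (rule ccontr)
        assume "\<not> y1 n * y2 n \<le> 0"
        then have "(y1 n > 0 \<and> y2 n > 0) \<or> (y1 n < 0 \<and> y2 n < 0)"
          by (metis linorder_not_le zero_less_mult_iff)
        then show False using y by auto
      qed
      then show ?thesis using y by simp
    qed
  qed
  have excl: "\<not> (l \<in> D k \<and> k \<in> D l)" using Dk[of l] Dl[of k] by auto
  have le: "dot N y1 y2 \<le> (\<Sum>n<N. be n)" unfolding dot_def using bound by (intro sum_mono)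
  \<comment> \<open>\<open>D k\<close> lies below \<open>k\<close> and \<open>D l\<close> below
    \<open>l\<close>, so at most one of the memberships holds, and the strict gain needs one of
    them.\<close>
  have one: "of_bool (l \<in> D k) + of_bool (k \<in> D l) = (1::int)"
    using excl le dy dxz by (auto simp: of_bool_def split: if_splits)
  have tight: "y1 n * y2 n = be n" if "n < N" for n
  proof -
    have "(\<Sum>n<N. be n - y1 n * y2 n) = 0"
      using le dy dxz one by (simp add: sum_subtractf dot_def)
    then have "be n - y1 n * y2 n = 0" using that bound by (subst (asm) sum_nonneg_eq_0_iff) auto
    then show ?thesis by simp
  qed
  \<comment> \<open>The negative entry of one vector is cancelled by the other, so the sum can be
    negative only at one coordinate \<open>q\<close>.\<close>
  obtain q where q: "q < N" "be q = 0" "\<And>n. n \<noteq> q \<Longrightarrow> y1 n + y2 n \<ge> 0"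
  proof (cases "l \<in> D k")
    case True
    show ?thesis
    proof (rule that[of k])
      show "k < N" "be k = 0" using k Dk[of k] by (auto simp: be_def)
      show "y1 n + y2 n \<ge> 0" if "n \<noteq> k" for n
        unfolding sum_y xk zn using that True by (auto simp: of_bool_def)
    qed
  next
    case False
    then have "k \<in> D l" using one by (auto simp: of_bool_def split: if_splits)
    show ?thesis
    proof (rule that[of l])
      show "l < N" "be l = 0" using l Dl[of l] by (auto simp: be_def)
      show "y1 n + y2 n \<ge> 0" if "n \<noteq> l" for n
        unfolding sum_y xk zn using that \<open>k \<in> D l\<close> by (auto simp: of_bool_def)
    qed
  qed
  have be01: "be n = 0 \<or> (be n = 1 \<and> y1 n + y2 n = 2)" for n
    unfolding sum_y xk zn be_def using Dk[of n] Dl[of n] kl by (auto simp: of_bool_def)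
  have nonneg: "w1 = 0" if w: "w1 \<in> perp s N" "w1 q = 0" "\<And>n. w1 n + w2 n = y1 n + y2 n" "\<And>n. n < N \<Longrightarrow> w1 n * w2 n = be n" for w1 w2
  proof (rule nonneg_zero[OF w(1)])
    fix n assume n: "n < N"
    show "w1 n \<ge> 0"
    proof (cases "n = q")
      case False
      from be01[of n] show ?thesis
      proof
        assume "be n = 0"
        then have "w1 n = 0 \<or> w2 n = 0" using w(4)[OF n] by simp
        then show ?thesis using w(3)[of n] q(3)[OF False] by auto
      next
        assume b: "be n = 1 \<and> y1 n + y2 n = 2"
        then have "w2 n = 2 - w1 n" using w(3)[of n] by simp
        then have "(w1 n - 1) * (w1 n - 1) = 0"
        proof -
          have "(w1 n - 1) * (w1 n - 1) = 1 - w1 n * (2 - w1 n)" by (simp add: algebra_simps)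
          then show ?thesis using w(4)[OF n] b \<open>w2 n = 2 - w1 n\<close> by simp
        qed
        then show ?thesis by simp
      qed
    qed (use w in simp)
  qed
  have "y1 q = 0 \<or> y2 q = 0" using tight[OF q(1)] q(2) by simp
  then have "y1 = 0 \<or> y2 = 0"
    using nonneg[OF yL(1), of y2] nonneg[OF yL(2), of y1] tight by (auto simp: add.commute mult.commute)
  \<comment> \<open>With \<open>y1\<close> or \<open>y2\<close> equal to 0 all products vanish, so
    there is no common index; the pairing of \<open>x k\<close> and \<open>z\<close> consists of the
    one cancelled entry.\<close>
  then have "be n = 0" if "n < N" for n using tight[OF that] by auto
  then have "dot N (x k) z = -1" using dxz one by simp
  moreover have "dot N (x k) (xv {1} 0) = 1"
    using dot_xv[of "{1}" N 0 "x k"] x_coords[OF k(1,2)] m3 mN by (simp add: dot_commute)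
  ultimately show ?thesis using zx dot_add(2)[of N "x k" z "xv {1} 0"] by simp
qed

lemma G_orth: "y \<in> G1 \<Longrightarrow> z \<in> G0 \<Longrightarrow> dot N y z = 0"
proof -
  assume "y \<in> G1" "z \<in> G0"
  then obtain k where k: "y = x k" "m \<le> k" "k < N" "ty k" by (auto simp: G1_def)
  from \<open>z \<in> G0\<close> consider l where "z = x l" "m \<le> l" "l < N" "\<not> ty l"
    | b where "z = xv {b} 1" "2 \<le> b" "b < m" by (auto simp: G0_def)
  then show ?thesis
  proof cases
    case 1
    then show ?thesis using x_orth k by simp
  next
    case 2
    then have "dot N z y = y b - y 1" using dot_xv[of "{b}" N 1 y] mN m3 by simp
    then show ?thesis using x_coords[OF k(2,3)] k 2 by (simp add: dot_commute)
  qed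
qed

lemma M_orth: "y \<in> zgen G1 \<Longrightarrow> z \<in> zgen G0 \<Longrightarrow> dot N y z = 0"
  using zgen_orth[of G1 G0 N] G_orth by blast

lemma M_nonzero: "\<exists>y\<in>zgen G1. y \<noteq> 0" "\<exists>y\<in>zgen G0. y \<noteq> 0"
proof -
  have "x m \<in> zgen G1" using ty_m mN by (intro zgen_base) (auto simp: G1_def)
  then show "\<exists>y\<in>zgen G1. y \<noteq> 0" using x_irr[of m] mN by (auto simp: irreducible_in_def)
  have "xv {2} 1 \<in> zgen G0" using m3 by (intro zgen_base) (auto simp: G0_def)
  moreover have "xv {2} 1 \<noteq> 0" using xv_irr_pair[of 2 1] m3 by (auto simp: irreducible_in_def)
  ultimately show "\<exists>y\<in>zgen G0. y \<noteq> 0" by blast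
qed

end

section \<open>Splitting the elements of the superbase by type\<close>

context typed_triangle begin

abbreviation (input) "e10 \<equiv> xv {1} 0 :: nat \<Rightarrow> int"

lemma e10_perp: "e10 \<in> perp s N"
  using xv_irr_pair[of 1 0] m3 by (simp add: irreducible_in_def)

lemma dot_e10: "dot N z e10 = z 1 - z 0"
  using dot_xv[of "{1}" N 0 z] m3 mN by (simp add: dot_commute)

lemma f_pieces: "f0 (cutv A) = 0" "f0 (cutv B) = 1" "f0 (cutv C) = -1"
proof -
  have "h0 \<notin> A" "t0 \<notin> A" "h0 \<notin> C" "t0 \<notin> B" using memP parts by auto
  then show "f0 (cutv A) = 0" "f0 (cutv B) = 1" "f0 (cutv C) = -1"
    using f_cut(1)[OF subV(1)] f_cut(1)[OF subV(2)] f_cut(1)[OF subV(3)] memP by auto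
qed

lemma f0_e10: "f0 e10 = -1"
proof (cases "i = 1")
  case True
  then show ?thesis using f_pieces cuts by simp
next
  case False
  then have "e10 = 0 - cutv B" using ij cuts by (auto simp: xv_def fun_eq_iff)
  then show ?thesis using f_diff(1)[OF perp_zero, of "cutv B"] f_zero f_pieces cut_in_L[OF subV(2)] by simp
qed

lemma perp_decomp':
  assumes z: "z \<in> perp s N"
  shows "\<exists>m1\<in>zgen G1. \<exists>m0\<in>zgen G0. z = m1 + m0 + zsmult (- z 0) e10"
proof -
  let ?w = "z - zsmult (- z 0) e10"
  have "zsmult (- z 0) e10 \<in> zgen {e10}" by (intro zgen_scale zgen_base) simp
  then have "zsmult (- z 0) e10 \<in> perp s N" using zgen_perp e10_perp by blast
  then have "?w \<in> perp s N" using z perp_diff by blast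
  moreover have "?w 0 = 0" by (simp add: zsmult_def xv_def)
  ultimately obtain m1 m0 where "m1 \<in> zgen G1" "m0 \<in> zgen G0" "?w = m1 + m0" using perp_decomp by blast
  then show ?thesis by (intro bexI[of _ m1] bexI[of _ m0]) (auto simp: algebra_simps)
qed

lemma perp_generated: "perp s N \<subseteq> zgen (insert e10 (G1 \<union> G0))"
proof
  fix z assume "z \<in> perp s N"
  then obtain m1 m0 where m: "m1 \<in> zgen G1" "m0 \<in> zgen G0" "z = m1 + m0 + zsmult (- z 0) e10"
    using perp_decomp' by blast
  let ?X = "insert e10 (G1 \<union> G0)"
  have "m1 \<in> zgen ?X" "m0 \<in> zgen ?X" using m zgen_mono[of G1 ?X] zgen_mono[of G0 ?X] by auto
  moreover have "zsmult (- z 0) e10 \<in> zgen ?X" by (intro zgen_scale zgen_base) simp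
  ultimately show "z \<in> zgen ?X" using m(3) zgen_plus by metis
qed

text \<open>Each generator has entry 1 in coordinates 1 and 2 and \<open>g = 1\<close>, so its
  coefficients jump only along \<open>h0 t0\<close>.\<close>

lemma f_G1: assumes "z \<in> zgen G1" shows "fi z = 0 \<and> fj z = 0 \<and> f0 z = - g z \<and> z \<in> perp s N"
  using assms
proof (rule zgen_induct)
  show "fi 0 = 0 \<and> fj 0 = 0 \<and> f0 0 = - g 0 \<and> 0 \<in> perp s N" using f_zero perp_zero by simp
  fix z y assume z: "fi z = 0 \<and> fj z = 0 \<and> f0 z = - g z \<and> z \<in> perp s N" and y: "y \<in> G1"
  then obtain k where k: "y = x k" "m \<le> k" "k < N" "ty k" by (auto simp: G1_def)
  have yL: "y \<in> perp s N" using G_perp y by blast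
  have "y 1 = 1" "y 2 = 1" using x_coords[OF k(2,3)] k m3 by auto
  then have "y i = 1" "y j = 1" using ij by auto
  then have "fi y = 0" "fj y = 0" "f0 y = - g y"
    using coord[OF yL] x_values[OF k(2,3)] k by auto
  then show "fi (z + y) = 0 \<and> fj (z + y) = 0 \<and> f0 (z + y) = - g (z + y) \<and> z + y \<in> perp s N"
    "fi (z - y) = 0 \<and> fj (z - y) = 0 \<and> f0 (z - y) = - g (z - y) \<and> z - y \<in> perp s N"
    using z yL perp_add perp_diff by (simp_all add: f_add f_diff)
qed

lemma f_G0: assumes "z \<in> zgen G0" shows "f0 z = 0 \<and> g z = 0 \<and> z \<in> perp s N"
  using assms
proof (rule zgen_induct)
  show "f0 0 = 0 \<and> g 0 = 0 \<and> 0 \<in> perp s N" using f_zero perp_zero by simp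
  fix z y assume z: "f0 z = 0 \<and> g z = 0 \<and> z \<in> perp s N" and y: "y \<in> G0"
  have yL: "y \<in> perp s N" using G_perp y by blast
  have y0: "y 0 = 0" using G_coord0(2)[OF zgen_base[OF y]] .
  from y consider k where "y = x k" "m \<le> k" "k < N" "\<not> ty k" | b where "y = xv {b} 1" "2 \<le> b" "b < m"
    by (auto simp: G0_def)
  then have "g y = 0"
  proof cases
    case 1
    then show ?thesis using x_values[of k] by simp
  next
    case 2
    show ?thesis
    proof (cases "b = 2")
      case False
      have "irreducible_in N (perp s N) y" using 2 xv_irr_pair[of b 1] m3 by simp
      moreover have "y 0 = y 2" using 2 False by (simp add: xv_def)
      ultimately show ?thesis using irr_coords_012(2) y0 by metis
    next
      case True
      have "f0 y = 0"
      proof (cases "i = 1")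
        case True': True
        then have "y = cutv A" using cuts ij 2 True by auto
        then show ?thesis using f_pieces by simp
      next
        case False
        then have "y = 0 - cutv A" using cuts ij 2 True by (auto simp: xv_def fun_eq_iff)
        then show ?thesis using f_diff(1)[OF perp_zero cut_in_L[OF subV(1)]] f_zero f_pieces by simp
      qed
      then show ?thesis using y0 by (simp add: g_def)
    qed
  qed
  then have "f0 y = 0" "g y = 0" using y0 by (auto simp: g_def)
  then show "f0 (z + y) = 0 \<and> g (z + y) = 0 \<and> z + y \<in> perp s N"
    "f0 (z - y) = 0 \<and> g (z - y) = 0 \<and> z - y \<in> perp s N"
    using z yL perp_add perp_diff by (simp_all add: f_add f_diff)
qed

lemma f_scale_e10: "f0 (zsmult c e10) = - c" "g (zsmult c e10) = 0" "zsmult c e10 \<in> perp s N"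
proof -
  obtain d where d: "e10 = cmb d" using e10_perp cmbE by blast
  have e: "zsmult c e10 = cmb (\<lambda>x. c * d x)"
    unfolding d by (rule ext) (simp add: zsmult_def cmb_def sum_distrib_left mult.assoc)
  have "f0 (zsmult c e10) = c * f0 e10" unfolding e unfolding d f0_def using memV by (simp add: coeff_diff_cmb right_diff_distrib)
  then show f: "f0 (zsmult c e10) = - c" using f0_e10 by simp
  then show "g (zsmult c e10) = 0" by (simp add: g_def zsmult_def xv_def)
  show "zsmult c e10 \<in> perp s N" unfolding e by (rule cmb_in_L)
qed

lemma piece_sum:
  assumes X: "piece X p1 p2 q1 q2"
  shows "(\<Sum>y\<in>X. \<Sum>z\<in>V - X. a y z * F y z) = - (F p1 p2 + F q1 q2)"
proof -
  have mem: "X \<subseteq> V" "p1 \<in> X" "q1 \<in> X" "p2 \<in> V - X" "q2 \<in> V - X" using X by (auto simp: piece_def)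
  have fin: "finite X" using mem finite_subV by auto
  have pq: "(p1, p2) \<noteq> (q1, q2)" using X by (simp add: piece_def)
  have axy: "a y z = - (of_bool (y = p1 \<and> z = p2) + of_bool (y = q1 \<and> z = q2))" if "y \<in> X" "z \<in> V - X" for y z
    using X that unfolding piece_def by blast
  have "(\<Sum>y\<in>X. \<Sum>z\<in>V - X. a y z * F y z) = (\<Sum>w\<in>X \<times> (V - X). a (fst w) (snd w) * F (fst w) (snd w))"
    by (simp add: sum.cartesian_product case_prod_beta)
  also have "\<dots> = (\<Sum>w\<in>{(p1, p2), (q1, q2)}. a (fst w) (snd w) * F (fst w) (snd w))"
  proof (rule sum.mono_neutral_right)
    show "\<forall>w\<in>X \<times> (V - X) - {(p1, p2), (q1, q2)}. a (fst w) (snd w) * F (fst w) (snd w) = 0"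
    proof
      fix w assume w: "w \<in> X \<times> (V - X) - {(p1, p2), (q1, q2)}"
      then have "a (fst w) (snd w) = 0" using axy[of "fst w" "snd w"] by (cases w) auto
      then show "a (fst w) (snd w) * F (fst w) (snd w) = 0" by simp
    qed
  qed (use mem fin in auto)
  also have "\<dots> = - (F p1 p2 + F q1 q2)"
    using pq axy[of p1 p2] axy[of q1 q2] mem by auto
  finally show ?thesis .
qed

text \<open>This is \<open>dot_cmb_cmb\<close> with the three joining edges moved to the left; only
  edges inside a piece remain on the right.\<close>

lemma dot_pieces:
  "2 * (dot N (cmb c) (cmb d) - (c h0 - c t0) * (d h0 - d t0) - (c hi - c ti) * (d hi - d ti) - (c hj - c tj) * (d hj - d tj)) =
    - ((\<Sum>y\<in>A. \<Sum>z\<in>A. a y z * ((c y - c z) * (d y - d z))) + (\<Sum>y\<in>B. \<Sum>z\<in>B. a y z * ((c y - c z) * (d y - d z)))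
     + (\<Sum>y\<in>C. \<Sum>z\<in>C. a y z * ((c y - c z) * (d y - d z))))"
proof -
  define F where "F = (\<lambda>y z. (c y - c z) * (d y - d z))"
  have fin: "finite A" "finite B" "finite C" using subV finite_subV by auto
  have inner: "(\<Sum>y\<in>X. \<Sum>z\<in>V. a y z * F y z) = (\<Sum>y\<in>X. \<Sum>z\<in>X. a y z * F y z) + (\<Sum>y\<in>X. \<Sum>z\<in>V - X. a y z * F y z)"
    if "X \<subseteq> V" for X
  proof -
    have "(\<Sum>z\<in>V. a y z * F y z) = (\<Sum>z\<in>X. a y z * F y z) + (\<Sum>z\<in>V - X. a y z * F y z)" for y
      using sum.subset_diff[OF that finite_V, of "\<lambda>z. a y z * F y z"] by simp
    then show ?thesis by (simp only: sum.distrib)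
  qed
  have "(\<Sum>y\<in>V. \<Sum>z\<in>V. a y z * F y z) =
      (\<Sum>y\<in>A. \<Sum>z\<in>V. a y z * F y z) + (\<Sum>y\<in>B. \<Sum>z\<in>V. a y z * F y z) + (\<Sum>y\<in>C. \<Sum>z\<in>V. a y z * F y z)"
  proof -
    have "(\<Sum>y\<in>A \<union> B \<union> C. G y) = sum G A + sum G B + sum G C" for G :: "nat \<Rightarrow> int"
      using fin parts by (subst sum.union_disjoint; simp add: sum.union_disjoint Int_Un_distrib2)
    then show ?thesis using parts(1) by metis
  qed
  also have "\<dots> = (\<Sum>y\<in>A. \<Sum>z\<in>A. a y z * F y z) + (\<Sum>y\<in>B. \<Sum>z\<in>B. a y z * F y z) + (\<Sum>y\<in>C. \<Sum>z\<in>C. a y z * F y z)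
      - (F hi ti + F t0 h0) - (F hj tj + F ti hi) - (F h0 t0 + F tj hj)"
    unfolding inner[OF subV(1)] inner[OF subV(2)] inner[OF subV(3)] piece_sum[OF pieces(1)] piece_sum[OF pieces(2)] piece_sum[OF pieces(3)]
    by simp
  finally have total: "(\<Sum>y\<in>V. \<Sum>z\<in>V. a y z * F y z) = (\<Sum>y\<in>A. \<Sum>z\<in>A. a y z * F y z) + (\<Sum>y\<in>B. \<Sum>z\<in>B. a y z * F y z)
      + (\<Sum>y\<in>C. \<Sum>z\<in>C. a y z * F y z) - (F hi ti + F t0 h0) - (F hj tj + F ti hi) - (F h0 t0 + F tj hj)" .
  have sym: "F t0 h0 = F h0 t0" "F ti hi = F hi ti" "F tj hj = F hj tj" by (simp_all add: F_def algebra_simps)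
  have "2 * dot N (cmb c) (cmb d) = - (\<Sum>y\<in>V. \<Sum>z\<in>V. a y z * F y z)"
    unfolding F_def by (rule dot_cmb_cmb)
  then have "2 * dot N (cmb c) (cmb d) - 2 * F h0 t0 - 2 * F hi ti - 2 * F hj tj =
     - ((\<Sum>y\<in>A. \<Sum>z\<in>A. a y z * F y z) + (\<Sum>y\<in>B. \<Sum>z\<in>B. a y z * F y z) + (\<Sum>y\<in>C. \<Sum>z\<in>C. a y z * F y z))"
    unfolding total sym by simp
  then show ?thesis unfolding F_def by (simp add: right_diff_distrib)
qed

lemma piece_connected:
  assumes "X = A \<or> X = B \<or> X = C" "S \<subseteq> X" "S \<noteq> {}" "S \<noteq> X"
  shows "\<exists>y\<in>S. \<exists>z\<in>X - S. a y z \<noteq> 0"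
proof (rule irr_cut_connected)
  show "irreducible_in N (perp s N) (cutv X)" using assms(1) cuts ij m3 xv_irr_pair by auto
  show "X \<subseteq> V" "X \<noteq> V" using assms(1) subV memP memV parts by auto
qed (use assms in auto)

text \<open>The first summand of a star \<^term>\<open>v q\<close> in the splitting by types is, up to the three
  pieces, minus the cut of a union of components of its piece with \<^term>\<open>q\<close> removed.\<close>

lemma star_splits:
  assumes q: "q \<in> V"
  shows "\<exists>c. (\<forall>X\<in>{A, B, C}. \<forall>y\<in>X. \<forall>z\<in>X. a y z \<noteq> 0 \<longrightarrow>
      (y \<noteq> q \<longrightarrow> z \<noteq> q \<longrightarrow> c y = c z) \<and> (y \<noteq> q \<longrightarrow> z = q \<longrightarrow> c y = c q \<or> c y = c q - 1)) \<and>
    g (v q) = g (cmb c) \<and> g (cmb c) = - ((c hi - c t0) + (c hj - c ti) + (c h0 - c tj))"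
proof -
  obtain m1 m0 where m: "m1 \<in> zgen G1" "m0 \<in> zgen G0" "v q = m1 + m0 + zsmult (- v q 0) e10"
    using perp_decomp'[OF v_in_L[OF q]] by blast
  let ?e = "zsmult (- v q 0) e10"
  have p: "m1 \<in> perp s N" "m0 \<in> perp s N" "?e \<in> perp s N" using f_G1[OF m(1)] f_G0[OF m(2)] f_scale_e10 by auto
  have n0: "m0 + ?e \<in> perp s N" using p perp_add by blast
  have f0n: "f0 (m0 + ?e) = v q 0" "g (m0 + ?e) = 0"
    using f_add(1,4)[OF p(2,3)] f_G0[OF m(2)] f_scale_e10 by auto
  have m11: "m1 1 = g m1"
    using coord(1,2)[OF p(1)] f_G1[OF m(1)] ij by auto
  have "dot N m1 ?e = - v q 0 * dot N m1 e10"
    by (simp add: dot_def zsmult_def sum_distrib_left mult_ac)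
  then have "dot N m1 (m0 + ?e) = - v q 0 * g m1"
    unfolding dot_add(2) dot_e10 m11 G_coord0(1)[OF m(1)] M_orth[OF m(1,2)] by simp
  \<comment> \<open>By orthogonality of the types the pairing reduces to its \<open>e10\<close>
    part, which is exactly the contribution of the edge \<open>h0 t0\<close>. Nothing is left for
    the edges inside the pieces.\<close>
  then have H: "dot N m1 (m0 + ?e) - f0 m1 * f0 (m0 + ?e) - fi m1 * fi (m0 + ?e) - fj m1 * fj (m0 + ?e) = 0"
    using f0n f_G1[OF m(1)] by simp
  obtain c where c: "m1 = cmb c" using p(1) cmbE by blast
  define d where "d = (\<lambda>y. of_bool (y = q) - c y)"
  have vq: "v q = cmb (\<lambda>y. of_bool (y = q))" using cut_cmb[of "{q}"] q by simp
  have d: "m0 + ?e = cmb d"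
  proof -
    have "m0 + ?e = v q - m1" using m(3) by (simp add: algebra_simps)
    also have "\<dots> = cmb d" unfolding vq c cmb_diff d_def ..
    finally show ?thesis .
  qed
  define F where "F = (\<lambda>y z. a y z * ((c y - c z) * (d y - d z)))"
  \<comment> \<open>For an integer \<open>t\<close> none of \<open>t * (1 - t)\<close>,
    \<open>t * (- 1 - t)\<close> and \<open>t * (- t)\<close> is positive, and neither is
    \<open>a\<close> off the diagonal. Terms with sum 0 must then all vanish.\<close>
  have Fnn: "F y z \<ge> 0" if "y \<in> V" "z \<in> V" for y z
  proof (cases "y = z")
    case False
    have sq: "t * (1 - t) \<le> 0" "t * (- 1 - t) \<le> 0" "t * (- t) \<le> 0" for t :: int
    proof -
      show "t * (1 - t) \<le> 0" by (cases "t \<ge> 1") (auto simp: mult_le_0_iff)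
      show "t * (- 1 - t) \<le> 0" by (cases "t \<ge> 0") (auto simp: mult_le_0_iff)
      show "t * (- t) \<le> 0" by simp
    qed
    have "(c y - c z) * (d y - d z) \<le> 0"
    proof -
      consider "y = q" "z \<noteq> q" | "y \<noteq> q" "z = q" | "y \<noteq> q" "z \<noteq> q" using False by auto
      then show ?thesis
      proof cases
        case 1 then show ?thesis using sq(1)[of "c y - c z"] by (simp add: d_def algebra_simps)
      next
        case 2 then show ?thesis using sq(2)[of "c y - c z"] by (simp add: d_def algebra_simps)
      next
        case 3 then show ?thesis using sq(3)[of "c y - c z"] by (simp add: d_def algebra_simps)
      qed
    qed
    then show ?thesis using a_nonpos[OF that False] unfolding F_def by (simp add: mult_nonpos_nonpos)
  qed (simp add: F_def)
  have XV: "X \<subseteq> V" "finite X" if "X = A \<or> X = B \<or> X = C" for X using that subV finite_subV by auto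
  have "f0 m1 = c h0 - c t0" "fi m1 = c hi - c ti" "fj m1 = c hj - c tj"
    "f0 (m0 + ?e) = d h0 - d t0" "fi (m0 + ?e) = d hi - d ti" "fj (m0 + ?e) = d hj - d tj"
    unfolding d unfolding c f0_def fi_def fj_def using memV by (simp_all add: coeff_diff_cmb)
  then have tot: "(\<Sum>y\<in>A. \<Sum>z\<in>A. F y z) + (\<Sum>y\<in>B. \<Sum>z\<in>B. F y z) + (\<Sum>y\<in>C. \<Sum>z\<in>C. F y z) = 0"
    using dot_pieces[of c d] H unfolding d unfolding c F_def by simp
  have nn: "(\<Sum>y\<in>X. \<Sum>z\<in>X. F y z) \<ge> 0" if "X = A \<or> X = B \<or> X = C" for X
    using XV[OF that] Fnn by (intro sum_nonneg) auto
  have s0: "(\<Sum>y\<in>X. \<Sum>z\<in>X. F y z) = 0" if "X = A \<or> X = B \<or> X = C" for X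
  proof -
    have "(\<Sum>y\<in>A. \<Sum>z\<in>A. F y z) \<ge> 0" "(\<Sum>y\<in>B. \<Sum>z\<in>B. F y z) \<ge> 0" "(\<Sum>y\<in>C. \<Sum>z\<in>C. F y z) \<ge> 0"
      using nn by blast+
    then have "(\<Sum>y\<in>A. \<Sum>z\<in>A. F y z) = 0" "(\<Sum>y\<in>B. \<Sum>z\<in>B. F y z) = 0" "(\<Sum>y\<in>C. \<Sum>z\<in>C. F y z) = 0"
      using tot by linarith+
    then show ?thesis using that by blast
  qed
  have F0: "F y z = 0" if X: "X = A \<or> X = B \<or> X = C" and "y \<in> X" "z \<in> X" for X y z
  proof -
    have "(\<Sum>z\<in>X. F y z) = 0"
      using s0[OF X] XV[OF X] Fnn that by (subst (asm) sum_nonneg_eq_0_iff) (auto intro!: sum_nonneg)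
    then show ?thesis using XV[OF X] Fnn that by (subst (asm) sum_nonneg_eq_0_iff) auto
  qed
  show ?thesis
  proof (intro exI[of _ c] conjI ballI impI)
    fix X y z assume "X \<in> {A, B, C}" "y \<in> X" "z \<in> X" "a y z \<noteq> 0"
    then have Fz: "(c y - c z) * (d y - d z) = 0" using F0[of X y z] by (auto simp: F_def)
    then show "c y = c z" if "y \<noteq> q" "z \<noteq> q" using that by (auto simp: d_def)
    show "c y = c q \<or> c y = c q - 1" if "y \<noteq> q" "z = q" using Fz that by (auto simp: d_def)
  next
    have "g (v q) = g m1 + g (m0 + ?e)" using f_add(4)[OF p(1) n0] m(3) by (simp add: add.assoc)
    then show "g (v q) = g (cmb c)" using f0n c by simp
    \<comment> \<open>\<open>fi m1\<close> and \<open>fj m1\<close> are 0; adding them lets the six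
      coefficients regroup so that each bracket compares the two attaching vertices of one
      piece.\<close>
    have "g m1 = - (f0 m1 + fi m1 + fj m1)" using f_G1[OF m(1)] by simp
    then show "g (cmb c) = - ((c hi - c t0) + (c hj - c ti) + (c h0 - c tj))"
      unfolding c f0_def fi_def fj_def using memV by (simp add: coeff_diff_cmb)
  qed
qed

text \<open>Such a vector is a combination of the three piece cuts, and on each of them coordinate 0
  equals the jump along \<open>h0 t0\<close>.\<close>

lemma g_piecewise:
  assumes b: "\<And>y. y \<in> A \<Longrightarrow> b y = bA" "\<And>y. y \<in> B \<Longrightarrow> b y = bB" "\<And>y. y \<in> C \<Longrightarrow> b y = bC"
  shows "g (cmb b) = 0"
proof -
  have fin: "finite A" "finite B" "finite C" using subV finite_subV by auto
  have "cmb b 0 = (\<Sum>y\<in>A \<union> B \<union> C. b y * v y 0)" unfolding cmb_def parts(1) ..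
  also have "\<dots> = (\<Sum>y\<in>A. b y * v y 0) + (\<Sum>y\<in>B. b y * v y 0) + (\<Sum>y\<in>C. b y * v y 0)"
    using fin parts by (subst sum.union_disjoint; simp add: sum.union_disjoint Int_Un_distrib2)
  also have "\<dots> = bA * cutv A 0 + bB * cutv B 0 + bC * cutv C 0"
    using b by (simp add: cutv_def sum_distrib_left)
  also have "\<dots> = bB - bC" unfolding cuts using ij by (auto simp: xv_def)
  finally have "cmb b 0 = bB - bC" .
  moreover have "f0 (cmb b) = bB - bC" unfolding f0_def using memV memP b by (simp add: coeff_diff_cmb)
  ultimately show ?thesis by (simp add: g_def)
qed

text \<open>\<open>pp\<close> and \<open>qq\<close> are the vertices at which \<open>X\<close> is
  attached to the other pieces. The coefficients from \<open>star_splits\<close> are constant on the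
  other pieces and equal to \<open>c q\<close> or \<open>c q - 1\<close> on \<open>X\<close>;
  \<open>S\<close> is the set of the lower value. So \<open>g (v q)\<close> depends only on whether
  \<open>pp\<close> and \<open>qq\<close> lie in \<open>S\<close>, and adding \<open>f0\<close>
  gives coordinate 0.\<close>

lemma star_in_piece:
  assumes X: "(X, pp, qq) \<in> {(C, hi, t0), (A, hj, ti), (B, h0, tj)}" and q: "q \<in> X"
  shows "\<exists>S\<subseteq>X - {q}. (\<forall>y\<in>S. \<forall>z\<in>X - S - {q}. a y z = 0) \<and>
    v q 0 = of_bool (q = h0) - of_bool (q = t0) + of_bool (pp \<in> S) - of_bool (qq \<in> S) \<and>
    (\<Sum>y\<in>S. v y 0) = of_bool (h0 \<in> S) - of_bool (t0 \<in> S) - (of_bool (pp \<in> S) - of_bool (qq \<in> S))"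
proof -
  have X3: "X = A \<or> X = B \<or> X = C" using X by auto
  have XV: "X \<subseteq> V" using X3 subV by auto
  have qV: "q \<in> V" using q XV by auto
  obtain c where c: "\<And>X y z. X = A \<or> X = B \<or> X = C \<Longrightarrow> y \<in> X \<Longrightarrow> z \<in> X \<Longrightarrow> a y z \<noteq> 0 \<Longrightarrow> y \<noteq> q \<Longrightarrow> z \<noteq> q \<Longrightarrow> c y = c z"
    "\<And>X y. X = A \<or> X = B \<or> X = C \<Longrightarrow> y \<in> X \<Longrightarrow> q \<in> X \<Longrightarrow> a y q \<noteq> 0 \<Longrightarrow> y \<noteq> q \<Longrightarrow> c y = c q \<or> c y = c q - 1"
    "g (v q) = g (cmb c)" "g (cmb c) = - ((c hi - c t0) + (c hj - c ti) + (c h0 - c tj))"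
  proof -
    obtain c where *: "\<forall>X\<in>{A, B, C}. \<forall>y\<in>X. \<forall>z\<in>X. a y z \<noteq> 0 \<longrightarrow>
        (y \<noteq> q \<longrightarrow> z \<noteq> q \<longrightarrow> c y = c z) \<and> (y \<noteq> q \<longrightarrow> z = q \<longrightarrow> c y = c q \<or> c y = c q - 1)"
      "g (v q) = g (cmb c)" "g (cmb c) = - ((c hi - c t0) + (c hj - c ti) + (c h0 - c tj))"
      using star_splits[OF qV] by blast
    show ?thesis by (rule that[of c]) (use * in \<open>fastforce+\<close>)
  qed
  have const: "c y = c y'" if Y: "Y = A \<or> Y = B \<or> Y = C" "q \<notin> Y" "y \<in> Y" "y' \<in> Y" for Y y y'
  proof (rule ccontr)
    assume n: "c y \<noteq> c y'"
    let ?T = "{w \<in> Y. c w = c y}"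
    have "y \<in> ?T" "y' \<notin> ?T" using n Y(3,4) by simp_all
    then have "?T \<noteq> {}" "?T \<noteq> Y" using Y(4) by blast+
    then obtain w z where wz: "w \<in> ?T" "z \<in> Y - ?T" "a w z \<noteq> 0"
      using piece_connected[OF Y(1), of ?T] by blast
    then have "w \<in> Y" "z \<in> Y" "w \<noteq> q" "z \<noteq> q" using Y(2) by auto
    then show False using c(1)[OF Y(1), of w z] wz by auto
  qed
  have two: "c y = c q \<or> c y = c q - 1" if y: "y \<in> X" for y
  proof (rule ccontr)
    assume n: "\<not> ?thesis"
    let ?T = "{w \<in> X. c w \<noteq> c q \<and> c w \<noteq> c q - 1}"
    have "?T \<noteq> {}" "?T \<noteq> X" using n y q by auto
    then obtain w z where wz: "w \<in> ?T" "z \<in> X - ?T" "a w z \<noteq> 0"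
      using piece_connected[OF X3, of ?T] by blast
    have "w \<noteq> q" using wz by auto
    then show False using c(1)[OF X3, of w z] c(2)[OF X3, of w] wz q by (cases "z = q") auto
  qed
  define S where "S = {y \<in> X. c y \<noteq> c q}"
  have SX: "S \<subseteq> X - {q}" by (auto simp: S_def)
  have SV: "S \<subseteq> V" using SX XV by auto
  have cS: "c y = c q - of_bool (y \<in> S)" if "y \<in> X" for y using two[OF that] that by (auto simp: S_def)
  have edges: "a y z = 0" if "y \<in> S" "z \<in> X - S - {q}" for y z
    using c(1)[OF X3, of y z] that SX by (auto simp: S_def)
  have gv: "g (v q) = of_bool (pp \<in> S) - of_bool (qq \<in> S)"
  proof -
    have CC: "c hi = c t0" if "X \<noteq> C" using that X q memP parts by (intro const[of C]) auto
    have AA: "c hj = c ti" if "X \<noteq> A" using that X q memP parts by (intro const[of A]) auto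
    have BB: "c h0 = c tj" if "X \<noteq> B" using that X q memP parts by (intro const[of B]) auto
    have ne: "A \<noteq> B" "A \<noteq> C" "B \<noteq> C" using memP parts by auto
    have "pp \<in> X" "qq \<in> X" using X memP by auto
    then have pq: "c pp = c q - of_bool (pp \<in> S)" "c qq = c q - of_bool (qq \<in> S)" using cS by simp_all
    consider "X = C" "pp = hi" "qq = t0" | "X = A" "pp = hj" "qq = ti" | "X = B" "pp = h0" "qq = tj"
      using X by auto
    then have "g (cmb c) = - (c pp - c qq)"
    proof cases
      case 1
      then show ?thesis unfolding c(4) using AA BB ne by simp
    next
      case 2
      then show ?thesis unfolding c(4) using CC BB ne by simp
    next
      case 3
      then show ?thesis unfolding c(4) using CC AA ne by simp
    qed
    then show ?thesis using c(3) pq by simp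
  qed
  have vL: "v q \<in> perp s N" using v_in_L[OF qV] .
  have f0v: "f0 (v q) = of_bool (q = h0) - of_bool (q = t0)" using f_cut(1)[of "{q}"] qV by (auto simp: eq_commute)
  have e1: "v q 0 = of_bool (q = h0) - of_bool (q = t0) + of_bool (pp \<in> S) - of_bool (qq \<in> S)"
    using coord(3)[OF vL] f0v gv by simp
  \<comment> \<open>Raising \<open>c\<close> by 1 on \<open>S\<close> makes it constant on every
    piece, so \<open>g\<close> takes opposite values on \<open>cutv S\<close> and on
    \<open>v q\<close>.\<close>
  define b where "b = (\<lambda>y. c y + of_bool (y \<in> S))"
  have bc: "b y = b y'" if Y: "Y = A \<or> Y = B \<or> Y = C" "y \<in> Y" "y' \<in> Y" for Y y y'
  proof (cases "Y = X")
    case True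
    then show ?thesis using cS[of y] cS[of y'] that by (simp add: b_def)
  next
    case False
    have disj: "Y \<inter> X = {}" using False Y(1) X3 parts by auto
    then show ?thesis using const[OF Y(1) _ Y(2,3)] q SX Y by (auto simp: b_def)
  qed
  have "g (cmb b) = 0"
    by (rule g_piecewise[of b "b hj" "b h0" "b hi"]) (use bc memP in auto)
  moreover have "cmb b = cmb c + cutv S" unfolding cut_cmb[OF SV] cmb_add b_def ..
  ultimately have "g (cutv S) = - g (v q)" using f_add(4)[OF cmb_in_L cut_in_L[OF SV]] c(3) by simp
  then have "cutv S 0 = of_bool (h0 \<in> S) - of_bool (t0 \<in> S) - (of_bool (pp \<in> S) - of_bool (qq \<in> S))"
    using gv f_cut(1)[OF SV] coord(3)[OF cut_in_L[OF SV]] by simp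
  then show ?thesis using SX edges e1 by (intro exI[of _ S]) (auto simp: cutv_def)
qed

end

lemma zgen_lincomb:
  assumes "finite S" "\<And>y. y \<in> S \<Longrightarrow> v y \<in> zgen X"
  shows "(\<lambda>i. \<Sum>y\<in>S. c y * v y i) \<in> zgen X"
  using assms
proof (induction S rule: finite_induct)
  case empty
  have "(\<lambda>i. \<Sum>y\<in>{}. c y * v y i) = 0" by (rule ext) simp
  then show ?case using zgen_zero by metis
next
  case (insert y S)
  have "(\<lambda>i. \<Sum>y\<in>insert y S. c y * v y i) = (\<lambda>i. \<Sum>y\<in>S. c y * v y i) + zsmult (c y) (v y)"
    using insert by (intro ext) (simp add: zsmult_def)
  moreover have "(\<lambda>i. \<Sum>y\<in>S. c y * v y i) + zsmult (c y) (v y) \<in> zgen X"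
    using insert by (intro zgen_plus zgen_scale) auto
  ultimately show ?case by (simp only:)
qed

context superbase_lattice begin

lemma cmb_const: "cmb (\<lambda>_. t) = 0"
proof
  fix i
  have "cmb (\<lambda>_. t) i = t * cutv V i" by (simp add: cmb_def cutv_def sum_distrib_left)
  then show "cmb (\<lambda>_. t) i = 0 i" using cut_all by simp
qed

text \<open>A 2-separation of the graph: \<open>P\<close> is one side of the separating pair
  \<open>u\<close>, \<open>w\<close>.\<close>

definition good_step :: "nat \<Rightarrow> nat \<Rightarrow> nat set \<Rightarrow> bool" where
  "good_step u w P \<longleftrightarrow> u \<in> V \<and> w \<in> V \<and> u \<noteq> w \<and> P \<subseteq> V - {u, w} \<and> P \<noteq> {} \<and> V - P - {u, w} \<noteq> {} \<and>
    (\<forall>y\<in>P. \<forall>z\<in>V - P - {u, w}. a y z = 0)"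

text \<open>As in \<open>star_splits\<close>, all terms of the Dirichlet form of the two summands
  have one sign and hence vanish. By connectedness the coefficients \<open>c\<close> are constant
  off \<open>q\<close>, and their value at \<open>q\<close> is the same or larger by 1; so one
  summand is 0.\<close>

lemma irr_star:
  assumes q: "q \<in> V"
    and conn: "\<And>S. S \<subseteq> V - {q} \<Longrightarrow> S \<noteq> {} \<Longrightarrow> S \<noteq> V - {q} \<Longrightarrow> \<exists>y\<in>S. \<exists>z\<in>V - {q} - S. a y z \<noteq> 0"
    and e: "v q = n1 + n2" "n1 \<in> L" "n2 \<in> L" "dot N n1 n2 \<ge> 0"
  shows "n1 = 0 \<or> n2 = 0"
proof -
  obtain c where c: "n1 = cmb c" using e cmbE by blast
  define d where "d = (\<lambda>y. of_bool (y = q) - c y)"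
  have vq: "v q = cmb (\<lambda>y. of_bool (y = q))" using cut_cmb[of "{q}"] q by simp
  have d: "n2 = cmb d"
  proof -
    have "n2 = v q - n1" using e(1) by (simp add: algebra_simps)
    also have "\<dots> = cmb d" unfolding vq c cmb_diff d_def ..
    finally show ?thesis .
  qed
  define F where "F = (\<lambda>y z. a y z * ((c y - c z) * (d y - d z)))"
  have Fnn: "F y z \<ge> 0" if "y \<in> V" "z \<in> V" for y z
  proof (cases "y = z")
    case False
    have sq: "t * (1 - t) \<le> 0" "t * (- 1 - t) \<le> 0" "t * (- t) \<le> 0" for t :: int
    proof -
      show "t * (1 - t) \<le> 0" by (cases "t \<ge> 1") (auto simp: mult_le_0_iff)
      show "t * (- 1 - t) \<le> 0" by (cases "t \<ge> 0") (auto simp: mult_le_0_iff)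
      show "t * (- t) \<le> 0" by simp
    qed
    have "(c y - c z) * (d y - d z) \<le> 0"
    proof -
      consider "y = q" "z \<noteq> q" | "y \<noteq> q" "z = q" | "y \<noteq> q" "z \<noteq> q" using False by auto
      then show ?thesis
      proof cases
        case 1 then show ?thesis using sq(1)[of "c y - c z"] by (simp add: d_def algebra_simps)
      next
        case 2 then show ?thesis using sq(2)[of "c y - c z"] by (simp add: d_def algebra_simps)
      next
        case 3 then show ?thesis using sq(3)[of "c y - c z"] by (simp add: d_def algebra_simps)
      qed
    qed
    then show ?thesis using a_nonpos[OF that False] unfolding F_def by (simp add: mult_nonpos_nonpos)
  qed (simp add: F_def)
  have "(\<Sum>y\<in>V. \<Sum>z\<in>V. F y z) \<le> 0"
    using dot_cmb_cmb[of c d] e(4) unfolding d unfolding c F_def by simp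
  then have "(\<Sum>y\<in>V. \<Sum>z\<in>V. F y z) = 0" using Fnn by (intro antisym sum_nonneg) auto
  then have "(\<Sum>z\<in>V. F y z) = 0" if "y \<in> V" for y
    using that Fnn by (subst (asm) sum_nonneg_eq_0_iff) (auto intro!: sum_nonneg)
  then have F0: "F y z = 0" if "y \<in> V" "z \<in> V" for y z
    using that Fnn by (metis (no_types, lifting) finite_V sum_nonneg_eq_0_iff)
  have const: "c y = c y'" if y: "y \<in> V - {q}" "y' \<in> V - {q}" for y y'
  proof (rule ccontr)
    assume n: "c y \<noteq> c y'"
    let ?T = "{w \<in> V - {q}. c w = c y}"
    have "y \<in> ?T" "y' \<notin> ?T" using n y by simp_all
    then have "?T \<noteq> {}" "?T \<noteq> V - {q}" using y by blast+
    then obtain w z where wz: "w \<in> ?T" "z \<in> V - {q} - ?T" "a w z \<noteq> 0" using conn[of ?T] by blast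
    then have "(c w - c z) * (d w - d z) = 0" using F0[of w z] by (auto simp: F_def)
    then show False using wz by (auto simp: d_def)
  qed
  show ?thesis
  proof (cases "V = {q}")
    case True
    then have "v q = 0" using cut_all by simp
    then have "n1 = - n2" using e(1) by (simp add: eq_neg_iff_add_eq_0)
    then have "dot N n2 n2 \<le> 0" using e(4) by (simp add: dot_minus)
    then have "dot N n2 n2 = 0" using dot_self_nonneg[of N n2] by simp
    then show ?thesis using dot_self_eq_0 e(3) Lsub by blast
  next
    case False
    then obtain p where p: "p \<in> V - {q}" using q by blast
    have "\<exists>z\<in>V - {q}. a q z \<noteq> 0"
    proof (rule ccontr)
      assume "\<not> ?thesis"
      then have "dot N (cutv {q}) (cutv (V - {q})) = 0" by (intro dot_cut_zeroI) auto
      moreover have "cutv (V - {q}) = - cutv {q}" using q by (intro cut_compl) auto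
      ultimately have "dot N (cutv {q}) (cutv {q}) = 0" by (simp add: dot_minus)
      then show False using dot_cut_self_pos[of "{q}"] q False by auto
    qed
    then obtain z where z: "z \<in> V - {q}" "a q z \<noteq> 0" by blast
    then have "(c q - c z) * (d q - d z) = 0" using F0[of q z] q by (auto simp: F_def)
    then have "c q = c z \<or> c q = c z + 1" using z by (auto simp: d_def)
    then show ?thesis
    proof
      assume "c q = c z"
      then have "c y = c z" if "y \<in> V" for y using const[of y z] z that by (cases "y = q") auto
      then have "cmb c = cmb (\<lambda>y. c z)" unfolding cmb_def by (intro ext sum.cong) auto
      also have "\<dots> = 0" by (rule cmb_const)
      finally show ?thesis using c by simp
    next
      assume cq: "c q = c z + 1"
      then have "d y = - c z" if "y \<in> V" for y using const[of y z] z that by (cases "y = q") (auto simp: d_def)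
      then have "cmb d = cmb (\<lambda>y. - c z)" unfolding cmb_def by (intro ext sum.cong) auto
      also have "\<dots> = 0" by (rule cmb_const)
      finally show ?thesis using d by simp
    qed
  qed
qed

end

section \<open>Nested sets at elements with coordinate 1\<close>

context typed_triangle begin

text \<open>With the edge \<open>h0 t0\<close> deleted, a good set lies on the side of the cut vertex \<open>q\<close> away from \<open>t0\<close>.
  Good sets are nested, and the difference of two consecutive ones is the set to be twisted.\<close>

definition good :: "nat \<Rightarrow> nat set \<Rightarrow> bool" where
  "good q S \<longleftrightarrow> S \<subseteq> V - {q} \<and> t0 \<notin> S \<and> q \<noteq> t0 \<and> (h0 \<in> S \<or> h0 = q) \<and> (\<Sum>y\<in>S. v y 0) = 0 \<and>
    (\<forall>y\<in>S. \<forall>z\<in>V - S - {q}. a y z \<noteq> 0 \<longrightarrow> y = h0 \<and> z = t0)"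

lemma sum_pieces: "(\<Sum>y\<in>B. v y 0) = 1" "(\<Sum>y\<in>A. v y 0) = 0"
  using cuts ij by (auto simp: cutv_def fun_eq_iff xv_def)

lemma piece_exits:
  "y \<in> B \<Longrightarrow> z \<in> V - B \<Longrightarrow> a y z \<noteq> 0 \<Longrightarrow> (y = h0 \<and> z = t0) \<or> (y = tj \<and> z = hj)"
  "y \<in> A \<Longrightarrow> z \<in> V - A \<Longrightarrow> a y z \<noteq> 0 \<Longrightarrow> (y = hj \<and> z = tj) \<or> (y = ti \<and> z = hi)"
  "y \<in> C \<Longrightarrow> z \<in> V - C \<Longrightarrow> a y z \<noteq> 0 \<Longrightarrow> (y = hi \<and> z = ti) \<or> (y = t0 \<and> z = h0)"
  using pieces unfolding piece_def by (auto simp: of_bool_def split: if_splits)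

text \<open>Without the edge \<open>h0 t0\<close> the pieces form a chain from \<open>h0\<close>
  through \<open>B\<close>, \<open>A\<close> and \<open>C\<close> to \<open>t0\<close>. Coordinate 1
  says that \<open>q\<close> cuts its own piece between its attaching vertices; the good set
  consists of the near part \<open>S\<close> and all earlier pieces. For \<open>q = h0\<close> it is
  empty.\<close>

lemma good_exists:
  assumes q: "q \<in> V"
  shows "\<bar>v q 0\<bar> \<le> 1" "v q 0 = 1 \<Longrightarrow> \<exists>S. good q S"
proof -
  have "\<bar>v q 0\<bar> \<le> 1 \<and> (v q 0 = 1 \<longrightarrow> (\<exists>S. good q S))"
  proof -
    consider "q \<in> B" | "q \<in> A" | "q \<in> C" using q parts by auto
    then show ?thesis
    proof cases
      case 1
      obtain S where S: "S \<subseteq> B - {q}" "\<forall>y\<in>S. \<forall>z\<in>B - S - {q}. a y z = 0"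
        "v q 0 = of_bool (q = h0) - of_bool (q = t0) + of_bool (h0 \<in> S) - of_bool (tj \<in> S)"
        "(\<Sum>y\<in>S. v y 0) = of_bool (h0 \<in> S) - of_bool (t0 \<in> S) - (of_bool (h0 \<in> S) - of_bool (tj \<in> S))"
        using star_in_piece[of B h0 tj q] 1 by auto
      have ne: "q \<noteq> t0" "t0 \<notin> S" "q = h0 \<Longrightarrow> h0 \<notin> S" using 1 S(1) memP parts by auto
      have "\<exists>S. good q S" if "v q 0 = 1"
      proof (cases "q = h0")
        case True
        then show ?thesis using ne by (intro exI[of _ "{}"]) (auto simp: good_def)
      next
        case False
        then have S': "h0 \<in> S" "tj \<notin> S" using S(3) ne that by (auto simp: of_bool_def split: if_splits)
        have "y = h0 \<and> z = t0" if "y \<in> S" "z \<in> V - S - {q}" "a y z \<noteq> 0" for y z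
        proof (cases "z \<in> B")
          case True
          then show ?thesis using S(2) that by blast
        next
          case False
          then show ?thesis using piece_exits(1)[of y z] that S(1) S' by auto
        qed
        moreover have "(\<Sum>y\<in>S. v y 0) = 0" using S(4) S' ne by simp
        moreover have "S \<subseteq> V - {q}" using S(1) subV by auto
        ultimately have "good q S" using S' ne unfolding good_def by blast
        then show ?thesis by blast
      qed
      then show ?thesis using S(3) ne by (auto simp: of_bool_def)
    next
      case 2
      obtain S where S: "S \<subseteq> A - {q}" "\<forall>y\<in>S. \<forall>z\<in>A - S - {q}. a y z = 0"
        "v q 0 = of_bool (q = h0) - of_bool (q = t0) + of_bool (hj \<in> S) - of_bool (ti \<in> S)"
        "(\<Sum>y\<in>S. v y 0) = of_bool (h0 \<in> S) - of_bool (t0 \<in> S) - (of_bool (hj \<in> S) - of_bool (ti \<in> S))"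
        using star_in_piece[of A hj ti q] 2 by auto
      have ne: "q \<noteq> t0" "q \<noteq> h0" "t0 \<notin> S" "h0 \<notin> S" "t0 \<notin> B" "q \<notin> B" "B \<inter> S = {}" using 2 S(1) memP parts by auto
      have fin: "finite S" "finite B" using S(1) subV finite_subV[of S] finite_subV[of B] by auto
      have "\<exists>S. good q S" if "v q 0 = 1"
      proof -
        have S': "hj \<in> S" "ti \<notin> S" using S(3) ne that by (auto simp: of_bool_def split: if_splits)
        have "y = h0 \<and> z = t0" if y: "y \<in> B \<union> S" "z \<in> V - (B \<union> S) - {q}" "a y z \<noteq> 0" for y z
        proof (cases "y \<in> B")
          case True
          then show ?thesis using piece_exits(1)[of y z] y S' by auto
        next
          case False
          then have yS: "y \<in> S" using y by auto
          show ?thesis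
          proof (cases "z \<in> A")
            case True
            then show ?thesis using S(2) y yS by blast
          next
            case False
            then show ?thesis using piece_exits(2)[of y z] y yS S(1) S' memP by auto
          qed
        qed
        moreover have "(\<Sum>y\<in>B \<union> S. v y 0) = 0"
          using sum.union_disjoint[OF fin(2,1) ne(7), of "\<lambda>y. v y 0"] S(4) S' ne sum_pieces by simp
        ultimately show ?thesis using S ne subV memP by (intro exI[of _ "B \<union> S"]) (auto simp: good_def)
      qed
      then show ?thesis using S(3) ne by (auto simp: of_bool_def)
    next
      case 3
      obtain S where S: "S \<subseteq> C - {q}" "\<forall>y\<in>S. \<forall>z\<in>C - S - {q}. a y z = 0"
        "v q 0 = of_bool (q = h0) - of_bool (q = t0) + of_bool (hi \<in> S) - of_bool (t0 \<in> S)"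
        "(\<Sum>y\<in>S. v y 0) = of_bool (h0 \<in> S) - of_bool (t0 \<in> S) - (of_bool (hi \<in> S) - of_bool (t0 \<in> S))"
        using star_in_piece[of C hi t0 q] 3 by auto
      have ne: "q \<noteq> h0" "h0 \<notin> S" "q \<notin> B" "q \<notin> A" "t0 \<notin> B" "t0 \<notin> A" "A \<inter> (B \<union> S) = {}" "B \<inter> S = {}" "q = t0 \<Longrightarrow> t0 \<notin> S"
        using 3 S(1) memP parts by auto
      have fin: "finite S" "finite B" "finite A" using S(1) subV finite_subV[of S] finite_subV[of B] finite_subV[of A] by auto
      have "\<exists>S. good q S" if "v q 0 = 1"
      proof -
        have S': "hi \<in> S" "t0 \<notin> S" "q \<noteq> t0" using S(3) ne that by (auto simp: of_bool_def split: if_splits)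
        have "y = h0 \<and> z = t0" if y: "y \<in> A \<union> (B \<union> S)" "z \<in> V - (A \<union> (B \<union> S)) - {q}" "a y z \<noteq> 0" for y z
        proof -
          consider "y \<in> A" | "y \<in> B" | "y \<in> S" using y by auto
          then show ?thesis
          proof cases
            case 1
            then show ?thesis using piece_exits(2)[of y z] y S' memP by auto
          next
            case 2
            then show ?thesis using piece_exits(1)[of y z] y S' memP by auto
          next
            case 3
            show ?thesis
            proof (cases "z \<in> C")
              case True
              then show ?thesis using S(2) y 3 by blast
            next
              case False
              then show ?thesis using parts y by auto
            qed
          qed
        qed
        moreover have "(\<Sum>y\<in>A \<union> (B \<union> S). v y 0) = 0"
          using sum.union_disjoint[OF fin(3) _ ne(7), of "\<lambda>y. v y 0"] sum.union_disjoint[OF fin(2,1) ne(8), of "\<lambda>y. v y 0"]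
            fin S(4) S' ne sum_pieces by simp
        ultimately show ?thesis using S S' ne subV memP by (intro exI[of _ "A \<union> (B \<union> S)"]) (auto simp: good_def)
      qed
      then show ?thesis using S(3) ne by (auto simp: of_bool_def)
    qed
  qed
  then show "\<bar>v q 0\<bar> \<le> 1" "v q 0 = 1 \<Longrightarrow> \<exists>S. good q S" by auto
qed

text \<open>A set left only along \<open>h0 t0\<close> would have a cut of norm at most 1, which no
  nonzero lattice vector has.\<close>

lemma connected_without_a0:
  assumes S: "S \<subseteq> V" "S \<noteq> {}" "S \<noteq> V"
  shows "\<exists>y\<in>S. \<exists>z\<in>V - S. a y z \<noteq> 0 \<and> {y, z} \<noteq> {h0, t0}"
proof (rule ccontr)
  assume n: "\<not> ?thesis"
  define p r where "p = (if h0 \<in> S then h0 else t0)" and "r = (if h0 \<in> S then t0 else h0)"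
  have b: "- a y z \<le> of_bool (y = p \<and> z = r)" if "y \<in> S" "z \<in> V - S" for y z
  proof (cases "a y z = 0")
    case False
    then have "{y, z} = {h0, t0}" using n that by blast
    then have yz: "(y = h0 \<and> z = t0) \<or> (y = t0 \<and> z = h0)" by (simp add: doubleton_eq_iff)
    then have "a y z = -1" using a_h0_t0 a_sym[of h0 t0] by auto
    moreover have "y = p \<and> z = r" using yz that by (auto simp: p_def r_def)
    ultimately show ?thesis by simp
  qed simp
  have ob: "(\<Sum>z\<in>T. of_bool (P \<and> z = q)) = (of_bool (P \<and> q \<in> T) :: int)" if "finite T" for T P and q :: nat
    using that by (cases P) (simp_all add: of_bool_def)
  have fin: "finite S" using S finite_subV by auto
  have "dot N (cutv S) (cutv S) = - dot N (cutv S) (cutv (V - S))"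
    using cut_compl[OF S(1)] by (simp add: dot_minus)
  also have "\<dots> = (\<Sum>y\<in>S. \<Sum>z\<in>V - S. - a y z)" unfolding dot_cut_cut by (simp add: sum_negf)
  also have "\<dots> \<le> (\<Sum>y\<in>S. \<Sum>z\<in>V - S. of_bool (y = p \<and> z = r))" using b by (intro sum_mono) auto
  also have "\<dots> = (\<Sum>y\<in>S. of_bool (y = p \<and> r \<in> V - S))" by (simp only: ob finite_Diff finite_V)
  also have "\<dots> = of_bool (r \<in> V - S \<and> p \<in> S)"
    unfolding conj_commute[of _ "r \<in> V - S"] by (rule ob[OF fin])
  also have "\<dots> \<le> 1" by simp
  finally have "dot N (cutv S) (cutv S) \<le> 1" .
  moreover have "cutv S \<noteq> 0" using cut_eq_0 S by blast
  ultimately show False using norm_ge_2[of "cutv S"] cut_in_L[OF S(1)] by simp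
qed

text \<open>Any failure yields a proper set of vertices left only along \<open>h0 t0\<close>: the
  part of one good set with its vertex that lies inside or outside the other good set, or, if each
  vertex lies in the other set, the complement of both.\<close>

lemma good_nested:
  assumes g1: "good p D1" and g2: "good q D2" and ne: "p \<noteq> q" "p \<in> V" "q \<in> V"
  shows "D1 \<union> {p} \<subseteq> D2 \<or> D2 \<union> {q} \<subseteq> D1"
proof -
  have inner: "D1 \<union> {p} \<subseteq> D2"
    if g1: "good p D1" and g2: "good q D2" and ne: "p \<noteq> q" "p \<in> V" "q \<in> V" and q: "q \<notin> D1" for p q D1 D2
  proof (rule ccontr)
    assume n: "\<not> ?thesis"
    define T where "T = (D1 \<union> {p}) \<inter> D2"
    define U where "U = (D1 \<union> {p}) - D2"
    have "h0 \<in> D1 \<union> {p}" "h0 \<in> D2 \<or> h0 = q" using g1 g2 by (auto simp: good_def)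
    then have hT: "h0 \<in> T" using q ne by (auto simp: T_def)
    have Une: "U \<noteq> {}" using n by (auto simp: U_def)
    have sub: "D1 \<subseteq> V" "D2 \<subseteq> V" using g1 g2 by (auto simp: good_def)
    have qU: "q \<notin> U" using q ne by (auto simp: U_def)
    have TU: "{y, z} = {h0, t0}" if "y \<in> T" "z \<in> U" "a y z \<noteq> 0" for y z
    proof -
      have "y \<in> D2" "z \<in> V - D2 - {q}" using that qU sub ne by (auto simp: T_def U_def)
      then show ?thesis using g2 that unfolding good_def by auto
    qed
    have D1out: "{y, z} = {h0, t0}" if "y \<in> D1" "z \<in> V - D1 - {p}" "a y z \<noteq> 0" for y z
      using g1 that unfolding good_def by auto
    show False
    proof (cases "p \<in> U")
      case False
      then have UD: "U \<subseteq> D1" by (auto simp: U_def)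
      have "U \<subseteq> V" "U \<noteq> V" using UD sub hT memV by (auto simp: T_def U_def)
      then obtain y z where yz: "y \<in> U" "z \<in> V - U" "a y z \<noteq> 0" "{y, z} \<noteq> {h0, t0}"
        using connected_without_a0[of U] Une by blast
      then have "z \<in> D1 \<union> {p}" using D1out[of y z] UD by blast
      then have "z \<in> T" using yz by (auto simp: T_def U_def)
      then have "{z, y} = {h0, t0}" using TU[of z y] yz a_sym[of y z] by auto
      then show False using yz by (simp add: insert_commute)
    next
      case True
      then have TD: "T \<subseteq> D1" by (auto simp: T_def U_def)
      have "T \<subseteq> V" "T \<noteq> {}" "T \<noteq> V" using hT sub TD True ne by (auto simp: T_def U_def)
      then obtain y z where yz: "y \<in> T" "z \<in> V - T" "a y z \<noteq> 0" "{y, z} \<noteq> {h0, t0}"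
        using connected_without_a0[of T] by blast
      then have "z \<in> D1 \<union> {p}" using D1out[of y z] TD by blast
      then have "z \<in> U" using yz by (auto simp: T_def U_def)
      then show False using TU[of y z] yz by auto
    qed
  qed
  show ?thesis
  proof (cases "q \<in> D1")
    case False
    then show ?thesis using inner[OF g1 g2 ne] by blast
  next
    case qD: True
    show ?thesis
    proof (cases "p \<in> D2")
      case False
      then show ?thesis using inner[OF g2 g1] ne by blast
    next
      case pD: True
      define U where "U = V - D1 - D2"
      have sub: "D1 \<subseteq> V" "D2 \<subseteq> V" "t0 \<in> U" "p \<notin> U" using g1 g2 memV pD by (auto simp: good_def U_def)
      have "U \<subseteq> V" "U \<noteq> {}" "U \<noteq> V" using sub ne by (auto simp: U_def)
      then obtain y z where yz: "y \<in> U" "z \<in> V - U" "a y z \<noteq> 0" "{y, z} \<noteq> {h0, t0}"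
        using connected_without_a0[of U] by blast
      have "z \<in> D1 \<or> z \<in> D2" using yz by (auto simp: U_def)
      moreover have "y \<noteq> p" "y \<noteq> q" using yz(1) pD qD by (auto simp: U_def)
      moreover have "y \<in> V - D1" "y \<in> V - D2" "a z y \<noteq> 0" using yz a_sym[of y z] by (auto simp: U_def)
      moreover have "\<forall>y\<in>D1. \<forall>z\<in>V - D1 - {p}. a y z \<noteq> 0 \<longrightarrow> y = h0 \<and> z = t0"
        "\<forall>y\<in>D2. \<forall>z\<in>V - D2 - {q}. a y z \<noteq> 0 \<longrightarrow> y = h0 \<and> z = t0"
        using g1 g2 unfolding good_def by blast+
      ultimately have "z = h0 \<and> y = t0" by blast
      then show ?thesis using yz by auto
    qed
  qed
qed

lemma sum_v: "(\<Sum>y\<in>V. v y 0) = 0"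
  using cut_all by (auto simp: cutv_def fun_eq_iff)

text \<open>The part between two nested good sets, without the inner vertex, is attached only to the
  two vertices. Its coordinates 0 sum to \<open>0 - 0 - 1\<close>, and this -1 is what the twist
  adds at both vertices.\<close>

lemma positive_pair_step:
  assumes "p \<in> V" "q \<in> V" "p \<noteq> q" "v p 0 = 1" "v q 0 = 1"
  shows "\<exists>u w P. good_step u w P \<and> v u 0 = 1 \<and> v w 0 = 1 \<and> (\<Sum>y\<in>P. v y 0) = -1"
proof -
  have main: "\<exists>P. good_step p q P \<and> (\<Sum>y\<in>P. v y 0) = -1"
    if g1: "good p D1" and g2: "good q D2" and sub: "D1 \<union> {p} \<subseteq> D2" and pq: "p \<in> V" "q \<in> V" "v p 0 = 1" "v q 0 = 1"
    for p q D1 D2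
  proof -
    define P where "P = D2 - (D1 \<union> {p})"
    have DV: "D1 \<subseteq> V - {p}" "D2 \<subseteq> V - {q}" using g1 g2 by (auto simp: good_def)
    have fin: "finite D1" "finite D2" using DV finite_subV[of D1] finite_subV[of D2] by auto
    have ne: "p \<noteq> q" using sub DV by auto
    have "(\<Sum>y\<in>D2. v y 0) = (\<Sum>y\<in>P. v y 0) + (\<Sum>y\<in>D1 \<union> {p}. v y 0)"
      unfolding P_def using sum.subset_diff[OF sub fin(2)] by blast
    moreover have "(\<Sum>y\<in>D1 \<union> {p}. v y 0) = (\<Sum>y\<in>D1. v y 0) + v p 0"
    proof -
      have "p \<notin> D1" using DV by auto
      then show ?thesis using fin by simp
    qed
    ultimately have sP: "(\<Sum>y\<in>P. v y 0) = -1" using g1 g2 pq by (simp add: good_def)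
    have PV: "P \<subseteq> V - {p, q}" using DV by (auto simp: P_def)
    \<comment> \<open>If nothing were left over, the coordinates 0 of all elements would sum to
      \<open>1 + 1 - 1\<close> instead of 0.\<close>
    have rest: "V - P - {p, q} \<noteq> {}"
    proof
      assume "V - P - {p, q} = {}"
      then have "V = insert p (insert q P)" using PV pq by auto
      then have "(\<Sum>y\<in>V. v y 0) = v p 0 + (v q 0 + (\<Sum>y\<in>P. v y 0))"
        using PV ne finite_subV[of P] by (metis (no_types, lifting) Diff_iff finite_insert insertCI insert_iff subset_iff sum.insert finite_V finite_subset subset_insertI)
      then show False using sum_v sP pq by simp
    qed
    have "P \<noteq> {}" using sP by auto
    moreover have "a y z = 0" if y: "y \<in> P" and z: "z \<in> V - P - {p, q}" for y z
    proof (rule ccontr)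
      assume n: "a y z \<noteq> 0"
      have yy: "y \<in> D2" "y \<notin> D1" "y \<noteq> p" "y \<in> V" using y PV by (auto simp: P_def)
      show False
      proof (cases "z \<in> D1")
        case True
        then have "z = h0 \<and> y = t0" using g1 yy n a_sym[of y z] unfolding good_def by auto
        then show False using g2 yy by (auto simp: good_def)
      next
        case False
        then have "z \<in> V - D2 - {q}" using z by (auto simp: P_def)
        then have "y = h0 \<and> z = t0" using g2 yy n unfolding good_def by auto
        then show False using g1 yy by (auto simp: good_def)
      qed
    qed
    ultimately have "good_step p q P" using PV rest pq ne by (auto simp: good_step_def)
    then show ?thesis using sP by blast
  qed
  obtain D1 D2 where "good p D1" "good q D2" using good_exists(2) assms by metis
  then show ?thesis using good_nested[of p D1 q D2] main[of p D1 q D2] main[of q D2 p D1] assms by blast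
qed

section \<open>Cut vertices and the final superbase\<close>

text \<open>With a cut vertex every irreducible vector would, up to sign, be a cut inside
  \<open>S\<close> or inside \<open>T\<close>, and these two kinds are orthogonal. The other
  generators all pair nontrivially with \<open>e10\<close>, so they are on its side; an element on
  the opposite side would be orthogonal to the whole lattice.\<close>

lemma no_cut_vertex:
  assumes q: "q \<in> V" and S: "S \<subseteq> V - {q}" "S \<noteq> {}" "S \<noteq> V - {q}"
  shows "\<exists>y\<in>S. \<exists>z\<in>V - {q} - S. a y z \<noteq> 0"
proof (rule ccontr)
  assume n: "\<not> ?thesis"
  define T where "T = V - {q} - S"
  have T: "T \<noteq> {}" "T \<subseteq> V - {q}" "S \<inter> T = {}" "S \<union> T = V - {q}" using S by (auto simp: T_def)
  have ST: "a y z = 0" if "y \<in> S" "z \<in> T" for y z using n that by (auto simp: T_def)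
  \<comment> \<open>A cut and its complement differ by sign; allowing signs makes it possible to
    choose the one that avoids \<open>q\<close>.\<close>
  define sp where "sp = (\<lambda>X z. \<exists>R\<subseteq>X. z = cutv R \<or> z = - cutv R)"
  have spo: "dot N y z = 0" if y: "sp S y" and z: "sp T z" for y z
  proof -
    obtain R where "R \<subseteq> S" "y = cutv R \<or> y = - cutv R" using y unfolding sp_def by metis
    moreover obtain R' where "R' \<subseteq> T" "z = cutv R' \<or> z = - cutv R'" using z unfolding sp_def by metis
    ultimately have R: "R \<subseteq> S" "R' \<subseteq> T" "y = cutv R \<or> y = - cutv R" "z = cutv R' \<or> z = - cutv R'" by simp_all
    have "dot N (cutv R) (cutv R') = 0" using R ST by (intro dot_cut_zeroI) auto
    then show ?thesis using R(3,4) by (auto simp: dot_minus)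
  qed
  have split: "sp S z \<or> sp T z" if z: "irreducible_in N (perp s N) z" for z
  proof -
    obtain R0 where R0: "R0 \<subseteq> V" "z = cutv R0" using irr_cut[OF z] by metis
    obtain R where R: "R \<subseteq> V - {q}" "z = cutv R \<or> z = - cutv R"
    proof (cases "q \<in> R0")
      case True
      have "z = - cutv (V - R0)" using cut_compl[OF R0(1)] R0(2) by simp
      then show ?thesis using that[of "V - R0"] True by auto
    next
      case False
      then show ?thesis using that[of R0] R0 by auto
    qed
    have RV: "R \<inter> S \<subseteq> V" "R \<inter> T \<subseteq> V" using R by auto
    have fin: "finite (R \<inter> S)" "finite (R \<inter> T)" using RV finite_subV by auto
    have "(R \<inter> S) \<union> (R \<inter> T) = R" "(R \<inter> S) \<inter> (R \<inter> T) = {}" using R T by auto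
    then have c: "cutv R = cutv (R \<inter> S) + cutv (R \<inter> T)" using cut_union[OF fin] by metis
    have o: "dot N (cutv (R \<inter> S)) (cutv (R \<inter> T)) = 0" using ST by (intro dot_cut_zeroI) auto
    have L: "cutv (R \<inter> S) \<in> perp s N" "cutv (R \<inter> T) \<in> perp s N" using cut_in_L RV by auto
    have "cutv (R \<inter> S) = 0 \<or> cutv (R \<inter> T) = 0"
      using R(2)
    proof
      assume "z = cutv R"
      then show ?thesis using irrD[OF z L] c o by simp
    next
      assume "z = - cutv R"
      then have "z = - cutv (R \<inter> S) + - cutv (R \<inter> T)" using c by simp
      then have "- cutv (R \<inter> S) = 0 \<or> - cutv (R \<inter> T) = 0"
        using irrD[OF z L_uminus[OF L(1)] L_uminus[OF L(2)]] o by (simp add: dot_minus)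
      then show ?thesis by simp
    qed
    then have "cutv R = cutv (R \<inter> S) \<or> cutv R = cutv (R \<inter> T)" using c by auto
    then show ?thesis using R(2) unfolding sp_def by (metis inf_le2)
  qed
  have impossible: False if X: "sp X e10" and Y: "Y \<noteq> {}" "Y \<subseteq> V - {q}"
    and o: "\<And>y z. sp X y \<Longrightarrow> sp Y z \<Longrightarrow> dot N y z = 0" and XY: "\<And>z. irreducible_in N (perp s N) z \<Longrightarrow> sp X z \<or> sp Y z" for X Y
  proof -
    have gen: "sp X z" if "irreducible_in N (perp s N) z" "dot N z e10 \<noteq> 0" for z
      using XY[OF that(1)] o[OF X, of z] that(2) by (auto simp: dot_commute)
    have "sp X z" if "z \<in> insert e10 (G1 \<union> G0)" for z
    proof -
      have xk: "sp X (x k)" if "m \<le> k" "k < N" for k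
      proof (rule gen[OF x_irr[OF that]])
        show "dot N (x k) e10 \<noteq> 0" unfolding dot_e10 using x_coords[OF that] by simp
      qed
      have "sp X (xv {b} 1)" if "2 \<le> b" "b < m" for b
      proof (rule gen)
        show "irreducible_in N (perp s N) (xv {b} 1)" using xv_irr_pair[of b 1] that by simp
        show "dot N (xv {b} 1) e10 \<noteq> 0" unfolding dot_e10 using that by (simp add: xv_def)
      qed
      then show ?thesis using that X xk by (auto simp: G1_def G0_def)
    qed
    note gens = this
    obtain y where y: "y \<in> Y" using Y by auto
    then have yV: "y \<in> V" "y \<noteq> q" using Y by auto
    have spy: "sp Y (v y)" unfolding sp_def using y by (intro exI[of _ "{y}"]) auto
    have "dot N z w = 0" if "z \<in> zgen (insert e10 (G1 \<union> G0))" "w \<in> zgen {v y}" for z w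
      by (rule zgen_orth[OF _ that]) (use gens o spy in auto)
    moreover have "v y \<in> zgen (insert e10 (G1 \<union> G0))" using perp_generated v_in_L[OF yV(1)] by blast
    moreover have "v y \<in> zgen {v y}" by (rule zgen_base) simp
    ultimately have "dot N (v y) (v y) = 0" by blast
    then have "cutv {y} = 0" using dot_self_eq_0 v_in_L[OF yV(1)] Lsub by auto
    then show False using cut_eq_0[of "{y}"] yV q by auto
  qed
  have "irreducible_in N (perp s N) e10" using xv_irr_pair[of 1 0] m3 by simp
  from split[OF this] show False
  proof
    assume "sp S e10"
    from impossible[OF this T(1,2) spo split] show False .
  next
    assume "sp T e10"
    from impossible[OF this S(2,1)] show False using spo split by (metis dot_commute)
  qed
qed

text \<open>Coordinates 0 sum to 0, so a single 1 is matched by a single -1, at \<open>r\<close>.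
  All other elements vanish in coordinate 0 and are irreducible, so each lies in the span of one
  type; orthogonality of the types makes \<open>p\<close>, \<open>r\<close> a separating
  pair.\<close>

lemma single_positive_star:
  assumes no: "\<not> (\<exists>p\<in>V. \<exists>q\<in>V. p \<noteq> q \<and> v p 0 = 1 \<and> v q 0 = 1)"
  shows "\<exists>p r P. good_step p r P \<and> (\<forall>y\<in>V. v y 0 = of_bool (y = p) - of_bool (y = r))"
proof -
  have vals: "v y 0 = 0 \<or> v y 0 = 1 \<or> v y 0 = -1" if "y \<in> V" for y using good_exists(1)[OF that] by auto
  obtain c where c: "e10 = cmb c" using e10_perp cmbE by blast
  \<comment> \<open>A lattice vector with nonzero coordinate 0 exists, so some element of the
    superbase has one as well.\<close>
  have "e10 0 = -1" by (simp add: xv_def)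
  then have "(\<Sum>y\<in>V. c y * v y 0) = -1" unfolding c cmb_def .
  then obtain y0 where y0: "y0 \<in> V" "v y0 0 \<noteq> 0" by (metis (no_types, lifting) mult_zero_right neg_equal_0_iff_equal one_neq_zero sum.neutral)
  define Pos where "Pos = {y \<in> V. v y 0 = 1}"
  define Neg where "Neg = {y \<in> V. v y 0 = -1}"
  have fin: "finite Pos" "finite Neg" by (auto simp: Pos_def Neg_def)
  have disj: "Pos \<inter> Neg = {}" by (auto simp: Pos_def Neg_def)
  have "(\<Sum>y\<in>V. v y 0) = (\<Sum>y\<in>Pos \<union> Neg. v y 0)"
    using vals by (intro sum.mono_neutral_right) (auto simp: Pos_def Neg_def)
  also have "\<dots> = (\<Sum>y\<in>Pos. v y 0) + (\<Sum>y\<in>Neg. v y 0)" using fin disj by (rule sum.union_disjoint)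
  also have "(\<Sum>y\<in>Pos. v y 0) = int (card Pos)" by (simp add: Pos_def)
  also have "(\<Sum>y\<in>Neg. v y 0) = - int (card Neg)" by (simp add: Neg_def)
  finally have cards: "card Pos = card Neg" using sum_v by simp
  have "y0 \<in> Pos \<or> y0 \<in> Neg" using y0 vals[OF y0(1)] by (auto simp: Pos_def Neg_def)
  then have "card Pos \<noteq> 0" using cards fin by auto
  then have "Pos \<noteq> {}" by auto
  then obtain p where p: "p \<in> Pos" by auto
  have Pp: "Pos = {p}" using p no by (auto simp: Pos_def)
  then have "card Neg = 1" using cards by simp
  then obtain r where r: "Neg = {r}" by (auto simp: card_1_singleton_iff)
  have pV: "p \<in> V" "r \<in> V" "p \<noteq> r" using p r by (auto simp: Pos_def Neg_def)
  have ev: "v y 0 = of_bool (y = p) - of_bool (y = r)" if "y \<in> V" for y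
    using vals[OF that] that Pp r pV unfolding Pos_def Neg_def by (auto simp: of_bool_def)
  let ?W = "V - {p, r}"
  have split: "v y \<in> zgen G1 \<or> v y \<in> zgen G0" if y: "y \<in> ?W" for y
  proof -
    have yV: "y \<in> V" using y by auto
    have "v y 0 = 0" using ev[OF yV] y by simp
    then obtain m1 m0 where m: "m1 \<in> zgen G1" "m0 \<in> zgen G0" "v y = m1 + m0"
      using perp_decomp[OF v_in_L[OF yV]] by blast
    have "m1 = 0 \<or> m0 = 0"
      by (rule irr_star[OF yV no_cut_vertex[OF yV] m(3)])
        (use m f_G1 f_G0 M_orth in auto)
    then show ?thesis using m by auto
  qed
  define P where "P = {y \<in> ?W. v y \<in> zgen G1}"
  have Q: "v y \<in> zgen G0" if "y \<in> V - P - {p, r}" for y using split[of y] that by (auto simp: P_def)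
  have sep: "a y z = 0" if "y \<in> P" "z \<in> V - P - {p, r}" for y z
    using M_orth[of "v y" "v z"] Q[OF that(2)] that(1) by (simp add: P_def a_def)
  \<comment> \<open>If coordinate 0 of a combination vanishes, its coefficients at \<open>p\<close>
    and \<open>r\<close> agree, and a shift makes both 0.\<close>
  have span: "z \<in> zgen X" if z: "z \<in> perp s N" "z 0 = 0" and X: "\<And>y. y \<in> ?W \<Longrightarrow> v y \<in> zgen X" for z X
  proof -
    obtain c where c: "z = cmb c" using z cmbE by blast
    have ob: "(\<Sum>y\<in>V. c y * of_bool (y = q)) = c q" if "q \<in> V" for q
      using that by (simp add: of_bool_def if_distrib cong: if_cong)
    have "cmb c 0 = (\<Sum>y\<in>V. c y * (of_bool (y = p) - of_bool (y = r)))"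
      unfolding cmb_def using ev by (intro sum.cong) auto
    also have "\<dots> = c p - c r" using ob[OF pV(1)] ob[OF pV(2)] by (simp add: right_diff_distrib sum_subtractf)
    finally have cpr: "c p = c r" using z(2) c by simp
    have "z = cmb (\<lambda>y. c y - c p)" using c cmb_shift by simp
    also have "\<dots> = (\<lambda>i. \<Sum>y\<in>?W. (c y - c p) * v y i)"
      unfolding cmb_def using cpr by (intro ext sum.mono_neutral_right) auto
    also have "\<dots> \<in> zgen X" using X by (intro zgen_lincomb) auto
    finally show ?thesis .
  qed
  have self: "z = 0" if "z \<in> zgen G1" "z \<in> zgen G0" for z
    using M_orth[OF that] f_G0[OF that(2)] dot_self_eq_0[of z N] by (simp add: perp_def)
  \<comment> \<open>If one type did not occur among these elements, the span of the other would
    contain every vector with vanishing coordinate 0, in particular those of the missing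
    type.\<close>
  have "P \<noteq> {}"
  proof
    assume "P = {}"
    then have all: "v y \<in> zgen G0" if "y \<in> ?W" for y using Q that by auto
    obtain z where z: "z \<in> zgen G1" "z \<noteq> 0" using M_nonzero by blast
    have "z \<in> zgen G0" using span[of z G0] G_coord0(1)[OF z(1)] all f_G1[OF z(1)] by blast
    then show False using self z by blast
  qed
  moreover have "V - P - {p, r} \<noteq> {}"
  proof
    assume e: "V - P - {p, r} = {}"
    then have all: "v y \<in> zgen G1" if "y \<in> ?W" for y using that by (auto simp: P_def)
    obtain z where z: "z \<in> zgen G0" "z \<noteq> 0" using M_nonzero by blast
    have "z \<in> zgen G1" using span[of z G1] G_coord0(2)[OF z(1)] all f_G0[OF z(1)] by blast
    then show False using self z by blast
  qed
  ultimately have "good_step p r P" using pV sep unfolding good_step_def P_def by auto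
  then show ?thesis using ev by blast
qed

end

context slack_superbase begin

lemma typed_triangle_exists: "\<exists>D ty i j h0 t0 hi ti hj tj A B C. typed_triangle s N m D ty K v i j h0 t0 hi ti hj tj A B C"
proof -
  obtain i j h0 t0 hi ti hj tj A B C where t: "unit_triangle s N m K v i j h0 t0 hi ti hj tj A B C"
    using unit_triangle_exists by blast
  have "\<forall>k\<in>{m..<N}. \<exists>D. D \<subseteq> {m..<k} \<and> (1 + (\<Sum>i\<in>D. s i) = s k \<or> int (m - 1) + (\<Sum>i\<in>D. s i) = s k)"
    using ones_type_cases by auto
  then obtain D where D: "\<And>k. k \<in> {m..<N} \<Longrightarrow> D k \<subseteq> {m..<k} \<and> (1 + (\<Sum>i\<in>D k. s i) = s k \<or> int (m - 1) + (\<Sum>i\<in>D k. s i) = s k)"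
    by metis
  define ty where "ty = (\<lambda>k. int (m - 1) + (\<Sum>i\<in>D k. s i) = s k)"
  have "ones_types s N m D ty"
    using slack_vector_axioms by (rule ones_types.intro) (use D in \<open>auto simp: ones_types_axioms_def ty_def\<close>)
  then have "typed_triangle s N m D ty K v i j h0 t0 hi ti hj tj A B C" using t by (rule typed_triangle.intro)
  then show ?thesis by blast
qed

lemma star_complement_connected:
  "q \<in> V \<Longrightarrow> S \<subseteq> V - {q} \<Longrightarrow> S \<noteq> {} \<Longrightarrow> S \<noteq> V - {q} \<Longrightarrow> \<exists>y\<in>S. \<exists>z\<in>V - {q} - S. a y z \<noteq> 0"
  using typed_triangle_exists typed_triangle.no_cut_vertex by metis

lemma step_or_terminal:
  "(\<exists>u w P. good_step u w P \<and> v u 0 = 1 \<and> v w 0 = 1 \<and> (\<Sum>y\<in>P. v y 0) = -1) \<or>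
   (\<exists>p r P. good_step p r P \<and> (\<forall>y\<in>V. v y 0 = of_bool (y = p) - of_bool (y = r)))"
proof -
  obtain D ty i j h0 t0 hi ti hj tj A B C where "typed_triangle s N m D ty K v i j h0 t0 hi ti hj tj A B C"
    using typed_triangle_exists by blast
  then interpret typed_triangle s N m D ty K v i j h0 t0 hi ti hj tj A B C .
  show ?thesis using positive_pair_step single_positive_star by blast
qed

lemma decomposition:
  "\<exists>M1 M0. M1 \<noteq> {0} \<and> M0 \<noteq> {0} \<and> 0 \<in> M1 \<and> 0 \<in> M0 \<and>
    (\<forall>x\<in>M1. \<forall>y\<in>M1. x - y \<in> M1) \<and> (\<forall>x\<in>M0. \<forall>y\<in>M0. x - y \<in> M0) \<and>
    (\<forall>x\<in>M1. \<forall>y\<in>M0. dot N x y = 0) \<and>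
    {z \<in> perp s N. z 0 = 0} = {x + y | x y. x \<in> M1 \<and> y \<in> M0}"
proof -
  obtain D ty i j h0 t0 hi ti hj tj A B C where "typed_triangle s N m D ty K v i j h0 t0 hi ti hj tj A B C"
    using typed_triangle_exists by blast
  then interpret typed_triangle s N m D ty K v i j h0 t0 hi ti hj tj A B C .
  have "{z \<in> perp s N. z 0 = 0} = {x + y | x y. x \<in> zgen G1 \<and> y \<in> zgen G0}"
  proof (intro equalityI subsetI)
    fix z assume "z \<in> {z \<in> perp s N. z 0 = 0}"
    then show "z \<in> {x + y | x y. x \<in> zgen G1 \<and> y \<in> zgen G0}" using perp_decomp[of z] by auto
  next
    fix z assume "z \<in> {x + y | x y. x \<in> zgen G1 \<and> y \<in> zgen G0}"
    then obtain x y where xy: "z = x + y" "x \<in> zgen G1" "y \<in> zgen G0" by blast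
    have "x \<in> perp s N" "y \<in> perp s N" "x 0 = 0" "y 0 = 0"
      using G_coord0 f_G1[OF xy(2)] f_G0[OF xy(3)] xy by auto
    then show "z \<in> {z \<in> perp s N. z 0 = 0}" using perp_add xy(1) by simp
  qed
  moreover have "zgen G1 \<noteq> {0}" "zgen G0 \<noteq> {0}" using M_nonzero by blast+
  moreover have "\<forall>x\<in>zgen G1. \<forall>y\<in>zgen G0. dot N x y = 0" using M_orth by blast
  moreover have "\<forall>x\<in>zgen X. \<forall>y\<in>zgen X. x - y \<in> zgen X" for X using zgen_minus by blast
  moreover note zgen_zero[of G1] zgen_zero[of G0]
  ultimately show ?thesis
    by (intro exI[of _ "zgen G1"] exI[of _ "zgen G0"] conjI)
qed

end

subsection \<open>Whitney twists\<close>

context superbase_lattice begin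

text \<open>Negating the elements of \<open>P\<close> takes \<open>2 * cutv P\<close> out of the sum
  of the superbase; adding \<open>cutv P\<close> at both \<open>u\<close> and \<open>w\<close>
  restores it.\<close>

definition twist :: "nat \<Rightarrow> nat \<Rightarrow> nat set \<Rightarrow> nat \<Rightarrow> nat \<Rightarrow> int" where
  "twist u w P x = (if x \<in> P then - v x else if x = u \<or> x = w then v x + cutv P else v x)"

text \<open>An element of \<open>P\<close> has edges only to \<open>P\<close>, \<open>u\<close> and
  \<open>w\<close>, so its pairing with \<open>cutv P\<close> is minus the sum of its pairings with
  \<open>v u\<close> and \<open>v w\<close>. After negation its edges to \<open>u\<close> and
  \<open>w\<close> are therefore exchanged.\<close>

lemma twist_dot:
  assumes g: "good_step u w P" and xy: "x \<in> V" "y \<in> V" "x \<noteq> y"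
  shows "dot N (twist u w P x) (twist u w P y) =
    (if x \<in> P \<or> y \<in> P then a (Transposition.transpose u w x) (Transposition.transpose u w y) else a x y)"
proof -
  note G = g[unfolded good_step_def]
  let ?R = "V - P - {u, w}"
  let ?t = "Transposition.transpose u w"
  have fin: "finite P" using G finite_subV[of P] by auto
  have outP: "u \<notin> P" "w \<notin> P" using G by auto
  have PR: "a y z = 0" "a z y = 0" if "y \<in> P" "z \<in> ?R" for y z using G that a_sym[of y z] by auto
  have dP: "dot N (v y) (cutv P) = (\<Sum>z\<in>P. a y z)" for y
    using dot_cut_cut[of "{y}" P] by simp
  have pP: "dot N (v y) (cutv P) = - a y u - a y w" if y: "y \<in> P" for y
  proof -
    have V3: "V = insert u (insert w (P \<union> ?R))" using G by auto
    have "(\<Sum>z\<in>V. a y z) = dot N (cutv {y}) (cutv V)" unfolding dot_cut_cut by simp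
    then have "(\<Sum>z\<in>V. a y z) = 0" by (simp add: cut_all dot_zero)
    moreover have "(\<Sum>z\<in>V. a y z) = (\<Sum>z\<in>insert u (insert w P). a y z)"
      using G PR(1)[OF y] by (intro sum.mono_neutral_right) auto
    moreover have "(\<Sum>z\<in>insert u (insert w P). a y z) = a y u + (a y w + (\<Sum>z\<in>P. a y z))"
      using G fin outP by simp
    ultimately show ?thesis unfolding dP by simp
  qed
  have rP: "dot N (v z) (cutv P) = 0" if "z \<in> ?R" for z unfolding dP using PR(2)[OF _ that] by simp
  have cc: "dot N (cutv P) (cutv P) = - dot N (v u) (cutv P) - dot N (v w) (cutv P)"
  proof -
    have "dot N (cutv P) (cutv P) = (\<Sum>y\<in>P. - a y u - a y w)" unfolding dot_cut[of P "cutv P"] using pP by simp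
    also have "\<dots> = - (\<Sum>y\<in>P. a u y) - (\<Sum>y\<in>P. a w y)" by (simp add: sum_subtractf sum_negf a_sym)
    finally show ?thesis unfolding dP .
  qed
  have cl: "dot N (cutv P) (v y) = dot N (v y) (cutv P)" for y by (rule dot_commute)
  have t: "twist u w P x = (if x \<in> P then - v x else if x = u \<or> x = w then v x + cutv P else v x)" for x
    by (rule twist_def)
  have main: "dot N (twist u w P x) (twist u w P y) = (if x \<in> P \<or> y \<in> P then a (?t x) (?t y) else a x y)"
    if c: "(x \<in> P \<and> y \<in> V) \<or> (x = u \<and> y = w) \<or> (x \<in> {u, w} \<and> y \<in> ?R) \<or> (x \<in> ?R \<and> y \<in> ?R)" and ne: "x \<noteq> y" for x y
  proof -
    consider "x \<in> P" "y \<in> P" | "x \<in> P" "y = u" | "x \<in> P" "y = w" | "x \<in> P" "y \<in> ?R"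
      | "x = u" "y = w" | "x \<in> {u, w}" "y \<in> ?R" | "x \<in> ?R" "y \<in> ?R" using c by blast
    then show ?thesis
    proof cases
      case 1
      then have "x \<noteq> u" "x \<noteq> w" "y \<noteq> u" "y \<noteq> w" using outP by auto
      then show ?thesis using 1 unfolding t by (simp add: dot_minus a_def)
    next
      case 2
      then have "x \<noteq> u" "x \<noteq> w" using outP by auto
      then show ?thesis using 2 outP pP[OF 2(1)] unfolding t by (simp add: dot_minus dot_add a_def[symmetric])
    next
      case 3
      then have "x \<noteq> u" "x \<noteq> w" using outP by auto
      then show ?thesis using 3 outP pP[OF 3(1)] unfolding t by (simp add: dot_minus dot_add a_def[symmetric])
    next
      case 4
      then have "x \<noteq> u" "x \<noteq> w" "y \<noteq> u" "y \<noteq> w" "y \<notin> P" using outP by auto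
      then show ?thesis using 4 PR(1)[OF 4] unfolding t by (simp add: dot_minus a_def[symmetric])
    next
      case 5
      then show ?thesis using outP cc unfolding t by (simp add: dot_add cl a_def[symmetric])
    next
      case 6
      then have "y \<noteq> u" "y \<noteq> w" "y \<notin> P" "x \<notin> P" using outP by auto
      then show ?thesis using 6 rP[OF 6(2)] unfolding t by (auto simp: dot_add cl a_def[symmetric])
    next
      case 7
      then show ?thesis unfolding t by (simp add: a_def[symmetric])
    qed
  qed
  have "x \<in> P \<or> x = u \<or> x = w \<or> x \<in> ?R" "y \<in> P \<or> y = u \<or> y = w \<or> y \<in> ?R" using xy by auto
  then consider "(x \<in> P \<and> y \<in> V) \<or> (x = u \<and> y = w) \<or> (x \<in> {u, w} \<and> y \<in> ?R) \<or> (x \<in> ?R \<and> y \<in> ?R)"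
    | "(y \<in> P \<and> x \<in> V) \<or> (y = u \<and> x = w) \<or> (y \<in> {u, w} \<and> x \<in> ?R) \<or> (y \<in> ?R \<and> x \<in> ?R)"
    using xy by blast
  then show ?thesis
  proof cases
    case 1
    then show ?thesis using main xy by blast
  next
    case 2
    have "dot N (twist u w P y) (twist u w P x) = (if y \<in> P \<or> x \<in> P then a (?t y) (?t x) else a y x)"
      using main[OF 2] xy by blast
    then show ?thesis using a_sym dot_commute by (metis (no_types, lifting))
  qed
qed

text \<open>On coefficients the twist is the reflection \<open>c x \<mapsto> c u + c w - c x\<close>
  on \<open>P\<close>. This is an involution, so the span is unchanged.\<close>

lemma twist_lincomb:
  assumes g: "good_step u w P"
  shows "(\<lambda>i. \<Sum>x\<in>V. c x * twist u w P x i) = cmb (\<lambda>x. if x \<in> P then c u + c w - c x else c x)"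
proof
  fix i
  note G = g[unfolded good_step_def]
  have PV: "P \<subseteq> V" using G by auto
  have ob: "(\<Sum>x\<in>V. of_bool (x = q) * c x) = c q" if "q \<in> V" for q
    using that by (simp add: of_bool_def if_distrib[of "\<lambda>t. t * _"] cong: if_cong)
  have twist: "twist u w P x i = (if x \<in> P then -1 else 1) * v x i + (of_bool (x = u) + of_bool (x = w)) * cutv P i" for x
    using G by (auto simp: twist_def)
  have cP: "cutv P i = (\<Sum>x\<in>V. of_bool (x \<in> P) * v x i)" using cut_cmb[OF PV] by (simp add: cmb_def)
  have "(\<Sum>x\<in>V. c x * twist u w P x i) = (\<Sum>x\<in>V. (c x * (if x \<in> P then -1 else 1)) * v x i)
      + (\<Sum>x\<in>V. of_bool (x = u) * c x) * cutv P i + (\<Sum>x\<in>V. of_bool (x = w) * c x) * cutv P i"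
    unfolding twist sum_distrib_right by (simp add: algebra_simps sum.distrib)
  also have "\<dots> = (\<Sum>x\<in>V. (c x * (if x \<in> P then -1 else 1)) * v x i) + (c u + c w) * cutv P i"
    using ob[of u] ob[of w] G by (simp add: distrib_right)
  also have "\<dots> = (\<Sum>x\<in>V. (c x * (if x \<in> P then -1 else 1)) * v x i + (c u + c w) * (of_bool (x \<in> P) * v x i))"
    unfolding cP by (simp only: sum.distrib sum_distrib_left)
  also have "\<dots> = cmb (\<lambda>x. if x \<in> P then c u + c w - c x else c x) i"
    unfolding cmb_def by (intro sum.cong) (auto simp: algebra_simps)
  finally show "(\<Sum>x\<in>V. c x * twist u w P x i) = cmb (\<lambda>x. if x \<in> P then c u + c w - c x else c x) i" .
qed

lemma twist_superbase:
  assumes g: "good_step u w P"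
  shows "obtuse_superbase N L K (twist u w P)"
  unfolding obtuse_superbase_def
proof (intro conjI allI impI)
  note G = g[unfolded good_step_def]
  have P: "P \<subseteq> V" "u \<notin> P" "w \<notin> P" using G by auto
  show "has_rank L K" using sb unfolding obtuse_superbase_def by blast
  show "twist u w P x \<in> L" if "x \<le> K" for x
    using that v_in_L[of x] cut_in_L[OF P(1)] L_add L_uminus by (auto simp: twist_def V_def)
  have span: "zspan (Suc K) (twist u w P) = {cmb (\<lambda>x. if x \<in> P then c u + c w - c x else c x) | c. True}"
    unfolding zspan_altdef twist_lincomb[OF g, symmetric] by (simp only: lessThan_Suc_atMost V_def)
  show "L = zspan (Suc K) (twist u w P)"
  proof (intro equalityI subsetI)
    fix z assume "z \<in> L"
    then obtain c where c: "z = cmb c" using cmbE by blast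
    define d where "d = (\<lambda>x. if x \<in> P then c u + c w - c x else c x)"
    have "cmb c = cmb (\<lambda>x. if x \<in> P then d u + d w - d x else d x)"
      by (rule arg_cong[of _ _ cmb]) (auto simp: d_def P)
    then show "z \<in> zspan (Suc K) (twist u w P)" unfolding span c by blast
  next
    fix z assume "z \<in> zspan (Suc K) (twist u w P)"
    then show "z \<in> L" unfolding span using cmb_in_L by blast
  qed
  show "dot N (twist u w P x) (twist u w P y) \<le> 0" if "x \<le> K" "y \<le> K" "x \<noteq> y" for x y
  proof -
    have xy: "x \<in> V" "y \<in> V" using that by (auto simp: V_def)
    let ?t = "Transposition.transpose u w"
    have "?t x \<in> V" "?t y \<in> V" using xy G by (auto simp: Transposition.transpose_def)
    moreover have "?t x \<noteq> ?t y" using that(3) by (metis Transposition.transpose_involutory)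
    ultimately show ?thesis unfolding twist_dot[OF g xy that(3)] using a_nonpos xy that(3) by auto
  qed
  have "(\<lambda>i. \<Sum>x\<in>V. 1 * twist u w P x i) = cmb (\<lambda>x. if x \<in> P then 1 + 1 - 1 else 1)"
    by (rule twist_lincomb[OF g])
  also have "\<dots> = 0" using cmb_const[of 1] by (simp cong: if_cong)
  finally have "(\<Sum>x\<in>V. twist u w P x i) = 0" for i by (auto simp: fun_eq_iff)
  then show "(\<Sum>x\<le>K. twist u w P x) = 0" by (intro ext) (simp add: sum_fun_apply V_def)
qed

end

context slack_superbase begin

lemma planar_superbase_twist:
  assumes g: "good_step u w P" and pl: "planar_superbase N K v"
  shows "planar_superbase N K (twist u w P)"
    and "(\<And>i j. i \<le> K \<Longrightarrow> j \<le> K \<Longrightarrow> i \<noteq> j \<Longrightarrow>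
      m' i j = (if {i, j} = {u, w} then nat \<bar>a i j\<bar> + 1 else nat \<bar>a i j\<bar>)) \<Longrightarrow> planar_multigraph K m'"
proof -
  note G = g[unfolded good_step_def V_def]
  let ?m = "\<lambda>i j. nat \<bar>a i j\<bar>"
  have pl': "planar_multigraph K ?m" using pl by (simp add: planar_superbase_def a_def)
  have sym: "?m i j = ?m j i" for i j by (simp add: a_sym)
  have nocut: "\<exists>y\<in>S. \<exists>z\<in>{..K} - {x} - S. ?m y z > 0"
    if "x \<le> K" "S \<subseteq> {..K} - {x}" "S \<noteq> {}" "S \<noteq> {..K} - {x}" for x S
    using star_complement_connected[of x S] that unfolding V_def by fastforce
  have uw: "u \<le> K" "w \<le> K" "u \<noteq> w" using G by auto
  have P: "P \<subseteq> {..K} - {u, w}" "P \<noteq> {}" "{..K} - P - {u, w} \<noteq> {}" using G by auto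
  have sep: "?m y z = 0" if "y \<in> P" "z \<in> {..K} - P - {u, w}" for y z using G that by auto
  show "planar_superbase N K (twist u w P)"
    unfolding planar_superbase_def
    by (rule planar_twist[OF pl' sym nocut uw P sep]) (use twist_dot[OF g] in \<open>auto simp: V_def\<close>)
  show "planar_multigraph K m'" if "\<And>i j. i \<le> K \<Longrightarrow> j \<le> K \<Longrightarrow> i \<noteq> j \<Longrightarrow>
      m' i j = (if {i, j} = {u, w} then nat \<bar>a i j\<bar> + 1 else nat \<bar>a i j\<bar>)"
    by (rule planar_add[OF pl' sym nocut uw P sep that])
qed

lemma slack_superbase_twist: "good_step u w P \<Longrightarrow> slack_superbase s N m K (twist u w P)"
  using slack_vector_axioms twist_superbase Lsub by (intro slack_superbase.intro superbase_lattice.intro)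

end

text \<open>A twist at two elements with coordinate 1 makes both coordinates 0 and otherwise only
  flips signs on \<open>P\<close>, so the sum of absolute values drops by 2.\<close>

lemma twist_reduction:
  assumes "slack_superbase s N m K v"
  shows "\<exists>v' p r P. slack_superbase s N m K v' \<and> (planar_superbase N K v \<longrightarrow> planar_superbase N K v') \<and>
    superbase_lattice.good_step N K v' p r P \<and> (\<forall>y\<le>K. v' y 0 = of_bool (y = p) - of_bool (y = r))"
  using assms
proof (induction "nat (\<Sum>y\<le>K. \<bar>v y 0\<bar>)" arbitrary: v rule: less_induct)
  case less
  interpret slack_superbase s N m K v by (rule less.prems)
  from step_or_terminal show ?case
  proof
    assume "\<exists>u w P. good_step u w P \<and> v u 0 = 1 \<and> v w 0 = 1 \<and> (\<Sum>y\<in>P. v y 0) = -1"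
    then obtain u w P where g: "good_step u w P" and 1: "v u 0 = 1" "v w 0 = 1" "(\<Sum>y\<in>P. v y 0) = -1" by blast
    note G = g[unfolded good_step_def]
    have uw: "u \<in> V" "w \<in> V" "u \<noteq> w" "u \<notin> P" "w \<notin> P" using G by auto
    have cP: "cutv P 0 = -1" using 1 by (simp add: cutv_def)
    have val: "\<bar>twist u w P y 0\<bar> = (if y = u \<or> y = w then 0 else \<bar>v y 0\<bar>)" for y
      using 1 cP uw by (auto simp: twist_def)
    have "(\<Sum>y\<in>V. \<bar>twist u w P y 0\<bar>) < (\<Sum>y\<in>V. \<bar>v y 0\<bar>)"
      by (rule sum_strict_mono_ex1) (use val uw 1 in auto)
    moreover have "(\<Sum>y\<in>V. \<bar>twist u w P y 0\<bar>) \<ge> 0" by (intro sum_nonneg) auto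
    ultimately have "nat (\<Sum>y\<le>K. \<bar>twist u w P y 0\<bar>) < nat (\<Sum>y\<le>K. \<bar>v y 0\<bar>)"
      by (simp only: V_def nat_less_eq_zless)
    from less.hyps[OF this slack_superbase_twist[OF g]] show ?thesis using planar_superbase_twist(1)[OF g] by blast
  next
    assume "\<exists>p r P. good_step p r P \<and> (\<forall>y\<in>V. v y 0 = of_bool (y = p) - of_bool (y = r))"
    then obtain p r P where t: "good_step p r P" "\<forall>y\<in>V. v y 0 = of_bool (y = p) - of_bool (y = r)" by blast
    show ?thesis
      using less.prems t by (intro exI[of _ v] exI[of _ p] exI[of _ r] exI[of _ P]) (auto simp: V_def)
  qed
qed

subsection \<open>The half-integer lattice and the tail lattice\<close>

definition emb :: "(nat \<Rightarrow> int) \<Rightarrow> nat \<Rightarrow> int" where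
  "emb z = case_nat (z 0) z"

lemma emb_simps [simp]: "emb z 0 = z 0" "emb z (Suc n) = z n"
  by (simp_all add: emb_def)

lemma emb_lincomb: "emb (\<lambda>i. \<Sum>x\<in>S. c x * v x i) = (\<lambda>i. \<Sum>x\<in>S. c x * emb (v x) i)"
proof
  fix i show "emb (\<lambda>i. \<Sum>x\<in>S. c x * v x i) i = (\<Sum>x\<in>S. c x * emb (v x) i)" by (cases i) auto
qed

lemma emb_inj: "emb y = emb z \<Longrightarrow> y = z"
  by (rule ext) (metis emb_simps(2))

lemma emb_zero: "emb 0 = 0"
  by (rule ext) (metis emb_simps zero_fun_apply not0_implies_Suc)

lemma zspan_emb: "zspan k (\<lambda>x. emb (b x)) = emb ` zspan k b"
  unfolding zspan_altdef by (auto simp: emb_lincomb[symmetric])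

lemma dot_emb: "dot (Suc N) (emb y) (emb z) = y 0 * z 0 + dot N y z"
  by (simp add: dot_def sum.lessThan_Suc_shift del: sum.lessThan_Suc)

lemma has_rank_emb:
  assumes "has_rank L k" shows "has_rank (emb ` L) k"
proof -
  obtain b where b: "\<And>i. i < k \<Longrightarrow> b i \<in> L" "zlin_indep k b" "L = zspan k b"
    using assms by (auto simp: has_rank_def)
  have lc: "(\<Sum>i<k. zsmult (c i) (b i)) = (\<lambda>j. \<Sum>i<k. c i * b i j)"
    "(\<Sum>i<k. zsmult (c i) (emb (b i))) = (\<lambda>j. \<Sum>i<k. c i * emb (b i) j)" for c
    by (rule ext, simp add: sum_fun_apply zsmult_def)+
  have "zlin_indep k (\<lambda>x. emb (b x))"
    unfolding zlin_indep_def
  proof (intro allI impI)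
    fix c i assume c: "(\<Sum>i<k. zsmult (c i) (emb (b i))) = 0" and i: "i < k"
    have "emb (\<lambda>j. \<Sum>i<k. c i * b i j) = emb 0" using c unfolding lc emb_lincomb emb_zero .
    then have "(\<Sum>i<k. zsmult (c i) (b i)) = 0" unfolding lc by (rule emb_inj)
    then show "c i = 0" using b(2) i by (simp add: zlin_indep_def)
  qed
  then show ?thesis unfolding has_rank_def using b zspan_emb[of k b] by (intro exI[of _ "\<lambda>x. emb (b x)"]) auto
qed

lemma cm_lattice_perp: "cm_lattice t = perp (cm_vec t) (length t)"
  by (simp add: cm_lattice_def perp_def)

text \<open>Orthogonality to \<open>half_w1\<close> says that the first two coordinates agree;
  orthogonality to \<open>half_w2 t\<close> is that of the shifted vector to the coefficients
  \<open>1 # t\<close>.\<close>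

lemma half_cm_lattice_emb: "half_cm_lattice t = emb ` cm_lattice (1 # t)"
proof -
  let ?n = "length t"
  have d1: "dot (?n + 2) x half_w1 = x 0 - x 1" for x
    by (simp add: dot_def half_w1_def sum.lessThan_Suc_shift del: sum.lessThan_Suc)
  have d2: "dot (?n + 2) x (half_w2 t) = dot (Suc ?n) (\<lambda>i. x (Suc i)) (cm_vec (1 # t))" for x
    by (simp add: dot_def half_w2_def cm_vec_def sum.lessThan_Suc_shift del: sum.lessThan_Suc)
  show ?thesis
  proof (intro equalityI subsetI)
    fix x assume x: "x \<in> half_cm_lattice t"
    define y where "y = (\<lambda>i. x (Suc i))"
    have "y \<in> cm_lattice (1 # t)"
      using x unfolding half_cm_lattice_def cm_lattice_def d2 y_def by (auto simp: zvec_def)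
    moreover have "x = emb y"
    proof
      fix i show "x i = emb y i" using x unfolding half_cm_lattice_def d1 by (cases i) (auto simp: y_def)
    qed
    ultimately show "x \<in> emb ` cm_lattice (1 # t)" by blast
  next
    fix x assume "x \<in> emb ` cm_lattice (1 # t)"
    then obtain y where y: "x = emb y" "y \<in> cm_lattice (1 # t)" by auto
    have "emb y \<in> zvec (?n + 2)"
      unfolding zvec_def
    proof (intro CollectI allI impI)
      fix i assume "?n + 2 \<le> i"
      then show "emb y i = 0" using y(2) by (cases i) (auto simp: cm_lattice_def zvec_def)
    qed
    then show "x \<in> half_cm_lattice t"
      using y unfolding half_cm_lattice_def d1 d2 by (auto simp: cm_lattice_def)
  qed
qed

text \<open>The embedding adds \<open>v x 0 * v y 0\<close> to a pairing. As coordinate 0 is 1 at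
  \<open>p\<close>, -1 at \<open>r\<close> and 0 elsewhere, only the pairing of \<open>p\<close>
  with \<open>r\<close> changes among distinct elements, and it drops by 1.\<close>

lemma half_superbase:
  assumes c: "slack_superbase (cm_vec (1 # t)) (Suc (length t)) m K v"
    and pr: "superbase_lattice.good_step (Suc (length t)) K v p r P" "\<forall>y\<le>K. v y 0 = of_bool (y = p) - of_bool (y = r)"
  shows "obtuse_superbase (length t + 2) (half_cm_lattice t) K (\<lambda>x. emb (v x))"
    and "planar_superbase (Suc (length t)) K v \<Longrightarrow> planar_superbase (length t + 2) K (\<lambda>x. emb (v x))"
proof -
  let ?N = "Suc (length t)"
  let ?L = "perp (cm_vec (1 # t)) ?N"
  interpret slack_superbase "cm_vec (1 # t)" ?N m K v by (rule c)
  have L: "half_cm_lattice t = emb ` ?L" unfolding half_cm_lattice_emb cm_lattice_perp by simp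
  have G: "p \<le> K" "r \<le> K" "p \<noteq> r" using pr(1) by (auto simp: good_step_def V_def)
  have v0: "v y 0 = of_bool (y = p) - of_bool (y = r)" if "y \<le> K" for y using pr(2) that by blast
  have dt: "dot (length t + 2) (emb (v x)) (emb (v y)) = a x y - of_bool ({x, y} = {p, r})"
    if "x \<le> K" "y \<le> K" "x \<noteq> y" for x y
  proof -
    have "dot (length t + 2) (emb (v x)) (emb (v y)) = v x 0 * v y 0 + a x y"
      using dot_emb[of ?N "v x" "v y"] by (simp add: a_def)
    then show ?thesis unfolding v0[OF that(1)] v0[OF that(2)] using that(3) G
      by (auto simp: of_bool_def doubleton_eq_iff)
  qed
  have np: "a x y \<le> 0" if "x \<le> K" "y \<le> K" "x \<noteq> y" for x y using a_nonpos[of x y] that by (simp add: V_def)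
  have sbs: "has_rank ?L K" "\<And>i. i \<le> K \<Longrightarrow> v i \<in> ?L" "?L = zspan (Suc K) v" "(\<Sum>i\<le>K. v i) = 0"
    using sb unfolding obtuse_superbase_def by auto
  show "obtuse_superbase (length t + 2) (half_cm_lattice t) K (\<lambda>x. emb (v x))"
    unfolding obtuse_superbase_def L
  proof (intro conjI allI impI)
    show "has_rank (emb ` ?L) K" by (rule has_rank_emb[OF sbs(1)])
    show "emb (v i) \<in> emb ` ?L" if "i \<le> K" for i using sbs(2) that by blast
    show "emb ` ?L = zspan (Suc K) (\<lambda>x. emb (v x))" unfolding zspan_emb using sbs(3) by simp
    show "dot (length t + 2) (emb (v x)) (emb (v y)) \<le> 0" if "x \<le> K" "y \<le> K" "x \<noteq> y" for x y
      unfolding dt[OF that] using np[OF that] by (simp add: of_bool_def)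
    show "(\<Sum>i\<le>K. emb (v i)) = 0"
    proof
      fix n
      have s0: "(\<Sum>i\<le>K. v i j) = 0" for j using sbs(4) by (metis sum_fun_apply zero_fun_apply)
      show "(\<Sum>i\<le>K. emb (v i)) n = 0 n" unfolding sum_fun_apply using s0 by (cases n) auto
    qed
  qed
  assume pl: "planar_superbase ?N K v"
  show "planar_superbase (length t + 2) K (\<lambda>x. emb (v x))"
    unfolding planar_superbase_def
  proof (rule planar_superbase_twist(2)[OF pr(1) pl])
    fix i j assume ij: "i \<le> K" "j \<le> K" "i \<noteq> j"
    show "nat \<bar>dot (length t + 2) (emb (v i)) (emb (v j))\<bar> =
        (if {i, j} = {p, r} then nat \<bar>a i j\<bar> + 1 else nat \<bar>a i j\<bar>)"
      unfolding dt[OF ij] using np[OF ij] by (auto simp: of_bool_def)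
  qed
qed

lemma decomposable_tail:
  assumes c: "slack_superbase (cm_vec (1 # t)) (Suc (length t)) m K v"
  shows "decomposable (length t) (cm_lattice t)"
proof -
  let ?N = "Suc (length t)" and ?n = "length t"
  let ?L = "{z \<in> perp (cm_vec (1 # t)) ?N. z 0 = 0}"
  define sh :: "(nat \<Rightarrow> int) \<Rightarrow> nat \<Rightarrow> int" where "sh = (\<lambda>z i. z (Suc i))"
  obtain M1 M0 where MM: "M1 \<noteq> {0} \<and> M0 \<noteq> {0} \<and> 0 \<in> M1 \<and> 0 \<in> M0 \<and>
      (\<forall>x\<in>M1. \<forall>y\<in>M1. x - y \<in> M1) \<and> (\<forall>x\<in>M0. \<forall>y\<in>M0. x - y \<in> M0) \<and>
      (\<forall>x\<in>M1. \<forall>y\<in>M0. dot ?N x y = 0) \<and> ?L = {x + y | x y. x \<in> M1 \<and> y \<in> M0}"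
    using slack_superbase.decomposition[OF c] by (elim exE) (rule that)
  have M: "M1 \<noteq> {0}" "M0 \<noteq> {0}" "0 \<in> M1" "0 \<in> M0"
    "\<And>x y. x \<in> M1 \<Longrightarrow> y \<in> M1 \<Longrightarrow> x - y \<in> M1" "\<And>x y. x \<in> M0 \<Longrightarrow> y \<in> M0 \<Longrightarrow> x - y \<in> M0"
    "\<And>x y. x \<in> M1 \<Longrightarrow> y \<in> M0 \<Longrightarrow> dot ?N x y = 0" "?L = {x + y | x y. x \<in> M1 \<and> y \<in> M0}"
    using MM by (elim conjE, blast)+
  have sub: "M1 \<subseteq> ?L" "M0 \<subseteq> ?L"
  proof -
    have "x + 0 \<in> ?L" if "x \<in> M1" for x unfolding M(8) using that M(4) by blast
    then show "M1 \<subseteq> ?L" by auto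
    have "0 + x \<in> ?L" if "x \<in> M0" for x unfolding M(8) using that M(3) by blast
    then show "M0 \<subseteq> ?L" by auto
  qed
  have dsh: "dot ?N x y = x 0 * y 0 + dot ?n (sh x) (sh y)" for x y
    by (simp add: dot_def sh_def sum.lessThan_Suc_shift del: sum.lessThan_Suc)
  have dcm: "dot ?N x (cm_vec (1 # t)) = x 0 + dot ?n (sh x) (cm_vec t)" for x
    by (simp add: dot_def sh_def cm_vec_def sum.lessThan_Suc_shift del: sum.lessThan_Suc)
  have lat: "cm_lattice t = sh ` ?L"
  proof (intro equalityI subsetI)
    fix x assume x: "x \<in> cm_lattice t"
    define y where "y = case_nat 0 x"
    have y: "sh y = x" "y 0 = 0" by (auto simp: y_def sh_def)
    have "y \<in> ?L"
      using x y dcm[of y] unfolding perp_def cm_lattice_def by (auto simp: zvec_def y_def split: nat.split)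
    then show "x \<in> sh ` ?L" using y by blast
  next
    fix x assume "x \<in> sh ` ?L"
    then obtain y where y: "x = sh y" "y \<in> ?L" by auto
    then show "x \<in> cm_lattice t" using dcm[of y] unfolding perp_def cm_lattice_def by (auto simp: zvec_def sh_def)
  qed
  have shd: "sh (x - y) = sh x - sh y" "sh (x + y) = sh x + sh y" "sh 0 = 0" for x y
    by (rule ext, simp add: sh_def)+
  have nz: "sh ` M \<noteq> {0}" if M: "M \<noteq> {0}" "0 \<in> M" "M \<subseteq> ?L" for M
  proof -
    obtain x where x: "x \<in> M" "x \<noteq> 0" using M(1,2) by blast
    have "sh x \<noteq> 0"
    proof
      assume "sh x = 0"
      then have "x (Suc i) = 0" for i by (metis sh_def zero_fun_apply)
      moreover have "x 0 = 0" using x M(3) by auto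
      ultimately have "x i = 0" for i by (cases i) auto
      then show False using x(2) by auto
    qed
    then show ?thesis using x by blast
  qed
  have sl: "sublattice (sh ` M) (cm_lattice t)" if "0 \<in> M" "\<And>x y. x \<in> M \<Longrightarrow> y \<in> M \<Longrightarrow> x - y \<in> M" "M \<subseteq> ?L" for M
    unfolding sublattice_def
  proof (intro conjI ballI)
    show "sh ` M \<subseteq> cm_lattice t" unfolding lat using that(3) by (rule image_mono)
    show "0 \<in> sh ` M" using that(1) shd(3) by (metis image_eqI)
    fix x y assume "x \<in> sh ` M" "y \<in> sh ` M"
    then show "x - y \<in> sh ` M" using that(2) by (auto simp: shd(1)[symmetric])
  qed
  have orth: "dot ?n x y = 0" if xM: "x \<in> sh ` M1" and yM: "y \<in> sh ` M0" for x y
  proof -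
    obtain x' y' where xy: "x = sh x'" "y = sh y'" "x' \<in> M1" "y' \<in> M0" using xM yM by blast
    then have "x' 0 = 0" using sub by auto
    then show ?thesis using dsh[of x' y'] M(7)[OF xy(3,4)] xy by simp
  qed
  have sum: "cm_lattice t = {x + y | x y. x \<in> sh ` M1 \<and> y \<in> sh ` M0}"
  proof (intro equalityI subsetI)
    fix z assume "z \<in> cm_lattice t"
    then obtain x y where "z = sh (x + y)" "x \<in> M1" "y \<in> M0" unfolding lat M(8) by blast
    then show "z \<in> {x + y | x y. x \<in> sh ` M1 \<and> y \<in> sh ` M0}" unfolding shd(2) by blast
  next
    fix z assume "z \<in> {x + y | x y. x \<in> sh ` M1 \<and> y \<in> sh ` M0}"
    then obtain x y where "z = sh (x + y)" "x \<in> M1" "y \<in> M0" unfolding shd(2) by blast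
    then show "z \<in> cm_lattice t" unfolding lat M(8) by blast
  qed
  have sl': "sublattice (sh ` M1) (cm_lattice t)" "sublattice (sh ` M0) (cm_lattice t)"
    by (rule sl[OF M(3) _ sub(1)], rule M(5), assumption+) (rule sl[OF M(4) _ sub(2)], rule M(6))
  show ?thesis unfolding decomposable_def
    by (intro exI[of _ "sh ` M1"] exI[of _ "sh ` M0"] conjI ballI sl' nz[OF M(1,3) sub(1)]
        nz[OF M(2,4) sub(2)] orth sum)
qed

section \<open>From coefficient lists to vectors\<close>

lemma changemaker_sorted:
  assumes "changemaker t"
  shows "sorted t" "\<And>x. x \<in> set t \<Longrightarrow> x \<ge> 1"
proof -
  show s: "sorted t"
    unfolding sorted_iff_nth_Suc
  proof (intro allI impI)
    fix i assume "Suc i < length t"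
    then show "t ! i \<le> t ! Suc i" using assms unfolding changemaker_def by (metis diff_Suc_1 zero_less_Suc)
  qed
  fix x assume "x \<in> set t"
  then obtain i where "i < length t" "x = t ! i" by (auto simp: in_set_conv_nth)
  then have "t ! 0 \<le> x" using sorted_nth_mono[OF s, of 0 i] by simp
  then show "x \<ge> 1" using assms by (simp add: changemaker_def)
qed

text \<open>The norm is the number of ones plus the squares of the stable coefficients, so
  \<open>sigma\<close> has one more 1 than \<open>tau\<close>; both lists are sorted.\<close>

lemma changemaker_tail:
  fixes sigma tau :: "int list"
  assumes s: "changemaker sigma" and t: "changemaker tau"
    and n: "sqnorm tau = sqnorm sigma - 1" and st: "stable_coeffs tau = stable_coeffs sigma"
  shows "sigma = 1 # tau"
proof -
  have ms: "mset u = replicate_mset (count (mset u) 1) 1 + stable_coeffs u" if "changemaker u" for u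
  proof -
    have "mset u = filter_mset (\<lambda>x. x = 1) (mset u) + filter_mset (\<lambda>x. x \<noteq> 1) (mset u)"
      by (rule multiset_partition)
    moreover have "filter_mset (\<lambda>x. x \<noteq> 1) (mset u) = stable_coeffs u"
      unfolding stable_coeffs_def mset_filter
      using changemaker_sorted(2)[OF that] by (intro filter_mset_cong) force+
    moreover have "filter_mset (\<lambda>x. x = 1) (mset u) = replicate_mset (count (mset u) 1) 1"
      by (rule filter_eq_replicate_mset)
    ultimately show ?thesis by simp
  qed
  have sq: "sqnorm u = int (count (mset u) 1) + sum_mset (image_mset (\<lambda>x. x * x) (stable_coeffs u))"
    if "changemaker u" for u
  proof -
    have "sqnorm u = sum_mset (image_mset (\<lambda>x. x * x) (mset u))"
      by (metis mset_map sqnorm_def sum_mset_sum_list)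
    also have "\<dots> = sum_mset (image_mset (\<lambda>x. x * x) (replicate_mset (count (mset u) 1) 1 + stable_coeffs u))"
      using ms[OF that] by simp
    also have "\<dots> = int (count (mset u) 1) + sum_mset (image_mset (\<lambda>x. x * x) (stable_coeffs u))" by simp
    finally show ?thesis .
  qed
  have "int (count (mset tau) 1) = int (count (mset sigma) 1) - 1"
    using n sq[OF s] sq[OF t] st by simp
  then have "count (mset sigma) 1 = Suc (count (mset tau) 1)" by simp
  then have "mset sigma = mset (1 # tau)" using ms[OF s] ms[OF t] st by simp
  moreover have "sorted (1 # tau)" using changemaker_sorted[OF t] by simp
  ultimately have "sort sigma = 1 # tau" by (metis properties_for_sort)
  then show ?thesis using changemaker_sorted(1)[OF s] by (simp add: sorted_sort_id)
qed

lemma very_slack_slack_vector: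
  fixes sigma :: "int list"
  assumes s: "changemaker sigma" and vs: "very_slack sigma" and l: "last sigma > 1"
  shows "\<exists>m. slack_vector (cm_vec sigma) (length sigma) m"
proof -
  let ?N = "length sigma"
  have ne: "sigma \<noteq> []" and s0: "sigma ! 0 = 1" using s by (auto simp: changemaker_def)
  note so = changemaker_sorted[OF s]
  define m where "m = (LEAST i. i < ?N \<and> sigma ! i > 1)"
  have ex: "?N - 1 < ?N \<and> sigma ! (?N - 1) > 1" using ne l by (simp add: last_conv_nth)
  have m: "m < ?N" "sigma ! m > 1" using LeastI[of "\<lambda>i. i < ?N \<and> sigma ! i > 1", OF ex] by (auto simp: m_def)
  have ones: "sigma ! i = 1" if "i < m" for i
  proof -
    have "\<not> (i < ?N \<and> sigma ! i > 1)" using that not_less_Least unfolding m_def by blast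
    then have "sigma ! i \<le> 1" using that m by auto
    moreover have "sigma ! i \<ge> 1" using so(2)[of "sigma ! i"] that m by auto
    ultimately show ?thesis by simp
  qed
  have big: "sigma ! i \<ge> 2" if "m \<le> i" "i < ?N" for i
    using sorted_nth_mono[OF so(1) that] m by simp
  have sum: "sum_list (take k sigma) = (\<Sum>i<k. cm_vec sigma i)" if "k \<le> ?N" for k
    using that by (simp add: sum_list_sum_nth cm_vec_def atLeast0LessThan)
  have slack: "sigma ! k \<le> (\<Sum>i<k. cm_vec sigma i) - 1" if "m \<le> k" "k < ?N" for k
    using vs big[OF that] that sum[of k] by (auto simp: very_slack_def)
  have "(\<Sum>i<m. cm_vec sigma i) = (\<Sum>i<m. 1)" using ones m by (intro sum.cong) (auto simp: cm_vec_def)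
  \<comment> \<open>At the least large coefficient the slack bound reads
    \<open>2 \<le> sigma ! m \<le> m - 1\<close>.\<close>
  then have "sigma ! m \<le> int m - 1" using slack[of m] m by simp
  then have "3 \<le> m" using m(2) by linarith
  then have "slack_vector (cm_vec sigma) ?N m"
    using m ones big slack by (intro slack_vector.intro) (auto simp: cm_vec_def)
  then show ?thesis by blast
qed

theorem theorem5p11:
  fixes sigma tau :: "int list" and n :: int and k :: nat and B :: "nat \<Rightarrow> nat \<Rightarrow> int"
  assumes "changemaker sigma" and "very_slack sigma"
    and "last sigma > 1"
    and "sqnorm sigma = n"
    and "obtuse_superbase (length sigma) (cm_lattice sigma) k B"
    and "changemaker tau" and "sqnorm tau = n - 1"
    and "stable_coeffs tau = stable_coeffs sigma"
  shows "admits_obtuse_superbase (length tau + 2) (half_cm_lattice tau)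
       \<and> (planar_superbase (length sigma) k B \<longrightarrow>
            admits_planar_obtuse_superbase (length tau + 2) (half_cm_lattice tau))
       \<and> decomposable (length tau) (cm_lattice tau)"
proof -
  have sigma: "sigma = 1 # tau" using changemaker_tail assms by simp
  obtain m where "slack_vector (cm_vec sigma) (length sigma) m" using very_slack_slack_vector assms by blast
  moreover have "superbase_lattice (length sigma) k (perp (cm_vec sigma) (length sigma)) B"
    using assms(5) unfolding cm_lattice_perp by (intro superbase_lattice.intro) (auto simp: perp_def)
  ultimately have "slack_superbase (cm_vec sigma) (length sigma) m k B" by (rule slack_superbase.intro)
  then have c: "slack_superbase (cm_vec (1 # tau)) (Suc (length tau)) m k B" unfolding sigma by simp
  obtain v p r P where v: "slack_superbase (cm_vec (1 # tau)) (Suc (length tau)) m k v"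
    "planar_superbase (Suc (length tau)) k B \<longrightarrow> planar_superbase (Suc (length tau)) k v"
    "superbase_lattice.good_step (Suc (length tau)) k v p r P" "\<forall>y\<le>k. v y 0 = of_bool (y = p) - of_bool (y = r)"
    using twist_reduction[OF c] by blast
  have "length sigma = Suc (length tau)" using sigma by simp
  then show ?thesis
    using half_superbase[OF v(1,3,4)] v(2) decomposable_tail[OF c]
    unfolding admits_obtuse_superbase_def admits_planar_obtuse_superbase_def by metis
qed

end
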